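(* Let $\Gamma=(X,\mathcal E)$ be the Foster graph (the distance-regular graph with $90$ vertices and intersection array $\{3,2,2,2,2,1,1,1;1,1,1,1,2,2,2,3\}$); the spectrum of its adjacency matrix $A$ is $3^1(\sqrt6)^{12}2^91^{18}0^{10}(-1)^{18}(-2)^9(-\sqrt6)^{12}(-3)^1$. Let $x\in X$ and $T=T(x)$. With the vertices within each $\Gamma_i(x)$ suitably ordered (one ordering for all the vectors listed), the standard module $V=\mathbb C^X$ is an orthogonal direct sum of irreducible $T$-modules $V=W_0\oplus W_{1,a}\oplus W_{1,b}\oplus W_{2,a}\oplus W_{2,b}\oplus W_{2,c}\oplus W_{3,a}\oplus\cdots\oplus W_{3,f}\oplus W_{4,a}\oplus\cdots\oplus W_{4,f}\oplus W_5$, where two summands are isomorphic if and only if they have the same type in the following list, and the data are as listed. Each listed basis is a pure basis of the module. For each summand other than $W_0$, the seed vector $\nu$ spans $E_r^*W$ (so $\dim E_r^*W=1$), where $r$ is the endpoint of the summand $W$, and is given by its essential part. Write $\langle a_1,\dots,a_m\rangle$ for the row vector $[a_1,-a_1,a_2,-a_2,\dots,a_m,-a_m]$. Type I ($W_0$): endpoint 0, multiplicity 1, dimension 9, diameter 8, shape $(1,1,1,1,1,1,1,1,1)$; basis $e_0^*,\dots,e_8^*$; matrix representing $A$: $$\begin{pmatrix}0&3&0&0&0&0&0&0&0\\1&0&2&0&0&0&0&0&0\\0&1&0&2&0&0&0&0&0\\0&0&1&0&2&0&0&0&0\\0&0&0&1&0&2&0&0&0\\0&0&0&0&2&0&1&0&0\\0&0&0&0&0&2&0&1&0\\0&0&0&0&0&0&2&0&1\\0&0&0&0&0&0&0&3&0\end{pmatrix},$$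 with eigenvalues $3,\sqrt6,2,1,0,-1,-2,-\sqrt6,-3$. Type II ($W_{1,a},W_{1,b}$): endpoint 1, multiplicity 2, dimension 7, diameter 6, shape $(1,1,1,1,1,1,1)$; basis $\nu,A\nu,E_3^*A^2\nu,E_4^*A^3\nu,E_5^*A^4\nu,E_6^*A^5\nu,E_7^*A^6\nu$ (with $A\nu=E_2^*A\nu$), where $\nu=[1,-1,0]$ for $W_{1,a}$ and $\nu=[1,1,-2]$ for $W_{1,b}$; matrix representing $A$: $\begin{pmatrix}0&2&0&0&0&0&0\\1&0&2&0&0&0&0\\0&1&0&2&0&0&0\\0&0&1&0&1&0&0\\0&0&0&1&0&2&0\\0&0&0&0&1&0&2\\0&0&0&0&0&1&0\end{pmatrix}$, with eigenvalues $\sqrt6,2,1,0,-1,-2,-\sqrt6$. Type III ($W_{2,a},W_{2,b},W_{2,c}$): endpoint 2, multiplicity 3, dimension 7, diameter 4, shape $(1,1,2,2,1)$; basis $\nu,A\nu,E_4^*A^2\nu,E_4^*A^4\nu-6E_4^*A^2\nu,E_5^*A^3\nu,E_5^*A^5\nu-7E_5^*A^3\nu,E_6^*A^6\nu$ (with $A\nu=E_3^*A\nu$), where $\nu=\langle1,0,0\rangle,\langle0,1,0\rangle,\langle0,0,1\rangle$ respectively; matrix representing $A$: $\begin{pmatrix}0&2&0&0&0&0&0\\1&0&2&0&0&0&0\\0&1&0&0&2&0&0\\0&0&0&0&1&2&0\\0&0&1&1&0&0&0\\0&0&0&1&0&0&2\\0&0&0&0&0&1&0\end{pmatrix}$, with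 eigenvalues $\sqrt6,2,1,0,-1,-2,-\sqrt6$. Type IV ($W_{3,a},W_{3,b},W_{3,c}$): endpoint 3, multiplicity 3, dimension 4, diameter 2, shape $(1,2,1)$; basis $\nu,A\nu,E_4^*A^3\nu,E_5^*A^2\nu$ (with $A\nu=E_4^*A\nu$), where $W_{3,a}$: $\nu=\langle0,0,1,-1,1,-1\rangle$; $W_{3,b}$: $\nu=\langle2,0,1,1,-1,-1\rangle$; $W_{3,c}$: $\nu=\langle0,2,-1,-1,-1,-1\rangle$; matrix representing $A$: $\begin{pmatrix}0&2&6&0\\1&0&0&-2\\0&0&0&1\\0&1&5&0\end{pmatrix}$, with eigenvalues $2,1,-1,-2$. Type V ($W_{3,d},W_{3,e},W_{3,f}$): endpoint 3, multiplicity 3, dimension 5, diameter 3, shape $(1,1,2,1)$; basis $\nu,A\nu,E_5^*A^2\nu,E_5^*A^4\nu,E_6^*A^3\nu$ (with $A\nu=E_4^*A\nu$), where $W_{3,d}$: $\nu=\langle0,0,1,-1,-1,1\rangle$; $W_{3,e}$: $\nu=\langle1,-1,-1,-1,0,0\rangle$; $W_{3,f}$: $\nu=\langle1,1,0,0,1,1\rangle$; matrix representing $A$: $\begin{pmatrix}0&2&0&0&0\\1&0&3&19&0\\0&1&0&0&-5\\0&0&0&0&1\\0&0&1&7&0\end{pmatrix}$, with eigenvalues $\sqrt6,1,0,-1,-\sqrt6$. Type VI ($W_{4,a}$): endpoint 4, multiplicity 1, dimension 1, diameter 0, shape $(1)$; basis $\nu$, where $\nu=\langle1,-1,-1,1,1,-1,-1,-1,1,-1,-1,-1\rangle$;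 matrix representing $A$: $\begin{pmatrix}0\end{pmatrix}$, with eigenvalue $0$. Type VII ($W_{4,b},W_{4,c},W_{4,d}$): endpoint 4, multiplicity 3, dimension 2, diameter 1, shape $(1,1)$; basis $\nu,A\nu$ (with $A\nu=E_5^*A\nu$), where $W_{4,b}$: $\nu=\langle1,1,1,1,-1,-1,1,-1,0,0,0,0\rangle$; $W_{4,c}$: $\nu=\langle-1,-1,1,1,1,1,1,-1,-2,-2,0,0\rangle$; $W_{4,d}$: $\nu=\langle1,1,-1,-1,1,1,1,-1,0,0,-2,2\rangle$; matrix representing $A$: $\begin{pmatrix}0&1\\1&0\end{pmatrix}$, with eigenvalues $1,-1$. Type VIII ($W_{4,e},W_{4,f}$): endpoint 4, multiplicity 2, dimension 4, diameter 3, shape $(1,1,1,1)$; basis $\nu,A\nu,E_6^*A^2\nu,E_7^*A^3\nu$ (with $A\nu=E_5^*A\nu$), where $W_{4,e}$: $\nu=\langle1,-1,-1,1,-1,1,1,1,0,0,0,0\rangle$; $W_{4,f}$: $\nu=\langle1,-1,-1,1,1,-1,-1,-1,-2,2,2,2\rangle$; matrix representing $A$: $\begin{pmatrix}0&3&0&0\\1&0&2&0\\0&1&0&2\\0&0&1&0\end{pmatrix}$, with eigenvalues $\sqrt6,1,-1,-\sqrt6$. Type IX ($W_5$): endpoint 5, multiplicity 1, dimension 4, diameter 3, shape $(1,1,1,1)$; basis $\nu,A\nu,E_7^*A^2\nu,E_8^*A^3\nu$ (with $A\nu=E_6^*A\nu$), where $\nu=\langle1,1,1,-1,-1,-1,-1,1,-1,1,1,1\rangle$;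 matrix representing $A$: $\begin{pmatrix}0&2&0&0\\1&0&2&0\\0&1&0&3\\0&0&1&0\end{pmatrix}$, with eigenvalues $\sqrt6,1,-1,-\sqrt6$. Moreover $\dim T=9^2+7^2+7^2+4^2+5^2+1^2+2^2+4^2+4^2=257$.
   Context: Let $\Gamma=(X,\mathcal E)$ be a finite undirected connected graph without loops or multiple edges, with path-length distance $d$ and diameter $D\ge1$; put $\Gamma_i(x)=\{y\in X:d(x,y)=i\}$. $\Gamma$ is distance-regular if for all $0\le h,i,j\le D$ the number $p^h_{i,j}=|\Gamma_i(y)\cap\Gamma_j(z)|$ is the same for all $y,z\in X$ with $d(y,z)=h$. Its intersection array is $\{b_0,\dots,b_{D-1};c_1,\dots,c_D\}$ with $b_i=p^i_{1,i+1}$, $c_i=p^i_{1,i-1}$. $A\in\mathrm{Mat}_X(\mathbb C)$ is the adjacency matrix; in its spectrum, exponents denote multiplicities. The standard module $V=\mathbb C^X$ (column vectors) carries the Hermitian inner product $\langle u,v\rangle=u^t\bar v$. Fix a base vertex $x\in X$. For $0\le i\le D$, $E_i^*=E_i^*(x)$ is the diagonal matrix with $(y,y)$-entry $1$ if $d(x,y)=i$ and $0$ otherwise, and $e_i^*\in V$ is the vector with $y$-entry $1$ if $d(x,y)=i$ and $0$ otherwise. The Terwilliger algebra $T=T(x)$ is the subalgebra of $\mathrm{Mat}_X(\mathbb C)$ generated by $A$ and $E_0^*,\dots,E_D^*$. A $T$-module is a subspace $W\subseteq V$ with $BW\subseteq W$ for all $B\in T$; it is irreducible if $W\ne0$ and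 it properly contains no nonzero $T$-module. Isomorphisms of $T$-modules are vector space isomorphisms commuting with every $B\in T$. The endpoint of $W$ is $r=\min\{i:E_i^*W\ne0\}$; the diameter of an irreducible $W$ is $\delta=|\{i:E_i^*W\ne0\}|-1$, and its shape is $(\dim E_r^*W,\dots,\dim E_{r+\delta}^*W)$. The multiplicity of an irreducible module is the number of summands isomorphic to it in an orthogonal decomposition of $V$ into irreducible $T$-modules. A nonzero vector is pure with support $i$ if it lies in $E_i^*V$; its essential part is the row vector of its coordinates at the vertices of $\Gamma_i(x)$, in the chosen order (all its other coordinates are $0$). A pure basis of an irreducible $T$-module is an ordered basis of pure vectors with weakly increasing supports. The matrix $B$ representing $A$ with respect to a basis $v_1,\dots,v_\ell$ is given by $Av_j=\sum_iB_{ij}v_i$. *)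

theory Defs
  imports "HOL-Analysis.Analysis" "Jordan_Normal_Form.Spectral_Radius"
begin

(* Vectors and matrices indexed by vertices are those of HOL-Analysis.  Jordan_Normal_Form is used
   only for the small numerical matrices (type complex mat) and their spectra. *)
no_notation Matrix.vec_index (infixl \<open>$\<close> 100)


section \<open>Distance-regular graphs\<close>

(* A graph on the finite vertex type 'v is given by its adjacency relation. *)

definition simple_graph :: "('v \<Rightarrow> 'v \<Rightarrow> bool) \<Rightarrow> bool" where
  "simple_graph adj \<longleftrightarrow> symp adj \<and> irreflp adj"

definition graph_connected :: "('v \<Rightarrow> 'v \<Rightarrow> bool) \<Rightarrow> bool" where
  "graph_connected adj \<longleftrightarrow> (\<forall>y z. adj\<^sup>*\<^sup>* y z)"

definition gdist :: "('v \<Rightarrow> 'v \<Rightarrow> bool) \<Rightarrow> 'v \<Rightarrow> 'v \<Rightarrow> nat" where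
  "gdist adj y z = (LEAST n. (adj ^^ n) y z)"

definition gdiam :: "('v::finite \<Rightarrow> 'v \<Rightarrow> bool) \<Rightarrow> nat" where
  "gdiam adj = Max {gdist adj y z | y z. True}"

definition gsphere :: "('v \<Rightarrow> 'v \<Rightarrow> bool) \<Rightarrow> nat \<Rightarrow> 'v \<Rightarrow> 'v set" where
  "gsphere adj i y = {z. gdist adj y z = i}"

definition distance_regular :: "('v::finite \<Rightarrow> 'v \<Rightarrow> bool) \<Rightarrow> bool" where
  "distance_regular adj \<longleftrightarrow>
     simple_graph adj \<and> graph_connected adj \<and> gdiam adj \<ge> 1 \<and>
     (\<forall>h\<le>gdiam adj. \<forall>i\<le>gdiam adj. \<forall>j\<le>gdiam adj. \<exists>p. \<forall>y z. gdist adj y z = h \<longrightarrow>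
        card (gsphere adj i y \<inter> gsphere adj j z) = p)"

definition intersection_number :: "('v::finite \<Rightarrow> 'v \<Rightarrow> bool) \<Rightarrow> nat \<Rightarrow> nat \<Rightarrow> nat \<Rightarrow> nat" where
  "intersection_number adj h i j =
     (THE p. \<forall>y z. gdist adj y z = h \<longrightarrow> card (gsphere adj i y \<inter> gsphere adj j z) = p)"

definition intersection_array :: "('v::finite \<Rightarrow> 'v \<Rightarrow> bool) \<Rightarrow> nat list \<times> nat list" where
  "intersection_array adj =
     (map (\<lambda>i. intersection_number adj i 1 (i + 1)) [0..<gdiam adj],
      map (\<lambda>i. intersection_number adj i 1 (i - 1)) [1..<gdiam adj + 1])"


section \<open>Adjacency matrix, dual idempotents, Terwilliger algebra\<close>

definition adjacency_matrix :: "('v::finite \<Rightarrow> 'v \<Rightarrow> bool) \<Rightarrow> complex^'v^'v" where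
  "adjacency_matrix adj = (\<chi> y z. if adj y z then 1 else 0)"

definition dual_idem :: "('v::finite \<Rightarrow> 'v \<Rightarrow> bool) \<Rightarrow> 'v \<Rightarrow> nat \<Rightarrow> complex^'v^'v" where
  "dual_idem adj x i = (\<chi> y z. if y = z \<and> gdist adj x y = i then 1 else 0)"

definition e_star :: "('v::finite \<Rightarrow> 'v \<Rightarrow> bool) \<Rightarrow> 'v \<Rightarrow> nat \<Rightarrow> complex^'v" where
  "e_star adj x i = (\<chi> y. if gdist adj x y = i then 1 else 0)"

definition herm :: "complex^'v::finite \<Rightarrow> complex^'v \<Rightarrow> complex" where
  "herm u v = (\<Sum>y\<in>UNIV. u $ y * cnj (v $ y))"

definition eigenspace :: "complex^'v^'v::finite \<Rightarrow> complex \<Rightarrow> (complex^'v) set" where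
  "eigenspace M \<theta> = {v. M *v v = \<theta> *s v}"

definition has_spectrum :: "complex^'v^'v::finite \<Rightarrow> (complex \<times> nat) list \<Rightarrow> bool" where
  "has_spectrum M l \<longleftrightarrow>
     distinct (map fst l) \<and> {\<theta>. eigenspace M \<theta> \<noteq> {0}} = set (map fst l) \<and>
     (\<forall>(\<theta>, m)\<in>set l. vec.dim (eigenspace M \<theta>) = m)"

definition mscale :: "complex \<Rightarrow> complex^'v^'v::finite \<Rightarrow> complex^'v^'v" where
  "mscale c M = (\<chi> i j. c * M $ i $ j)"

interpretation cmat: vector_space "mscale :: complex \<Rightarrow> complex^'v^'v::finite \<Rightarrow> complex^'v^'v"
  by unfold_locales (simp_all add: mscale_def Finite_Cartesian_Product.vec_eq_iff distrib_left distrib_right mult.assoc)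

definition subalgebra :: "(complex^'v^'v::finite) set \<Rightarrow> bool" where
  "subalgebra S \<longleftrightarrow>
     Finite_Cartesian_Product.mat 1 \<in> S \<and>
     (\<forall>M\<in>S. \<forall>N\<in>S. M + N \<in> S \<and> M ** N \<in> S) \<and>
     (\<forall>c. \<forall>M\<in>S. mscale c M \<in> S)"

definition terwilliger_algebra ::
    "('v::finite \<Rightarrow> 'v \<Rightarrow> bool) \<Rightarrow> 'v \<Rightarrow> (complex^'v^'v) set" where
  "terwilliger_algebra adj x =
     subalgebra hull insert (adjacency_matrix adj) (dual_idem adj x ` {0..gdiam adj})"


section \<open>Modules\<close>

definition T_module :: "(complex^'v^'v::finite) set \<Rightarrow> (complex^'v) set \<Rightarrow> bool" where
  "T_module T W \<longleftrightarrow> vec.subspace W \<and> (\<forall>B\<in>T. \<forall>w\<in>W. B *v w \<in> W)"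

definition irreducible_T_module :: "(complex^'v^'v::finite) set \<Rightarrow> (complex^'v) set \<Rightarrow> bool" where
  "irreducible_T_module T W \<longleftrightarrow>
     T_module T W \<and> W \<noteq> {0} \<and> \<not> (\<exists>U. T_module T U \<and> U \<noteq> {0} \<and> U \<subset> W)"

definition T_isomorphic ::
    "(complex^'v^'v::finite) set \<Rightarrow> (complex^'v) set \<Rightarrow> (complex^'v) set \<Rightarrow> bool" where
  "T_isomorphic T U W \<longleftrightarrow>
     (\<exists>f. bij_betw f U W \<and>
        (\<forall>u\<in>U. \<forall>v\<in>U. f (u + v) = f u + f v) \<and>
        (\<forall>c. \<forall>u\<in>U. f (c *s u) = c *s f u) \<and>
        (\<forall>B\<in>T. \<forall>u\<in>U. f (B *v u) = B *v f u))"

(* Pairwise orthogonal subspaces automatically form a direct sum. *)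
definition orthogonal_decomposition ::
    "(complex^'v^'v::finite) set \<Rightarrow> (complex^'v) set list \<Rightarrow> bool" where
  "orthogonal_decomposition T Ws \<longleftrightarrow>
     (\<forall>W\<in>set Ws. irreducible_T_module T W) \<and>
     (\<forall>i<length Ws. \<forall>j<length Ws. i \<noteq> j \<longrightarrow> (\<forall>u\<in>Ws ! i. \<forall>w\<in>Ws ! j. herm u w = 0)) \<and>
     vec.span (\<Union> (set Ws)) = UNIV"

definition multiplicity_in ::
    "(complex^'v^'v::finite) set \<Rightarrow> (complex^'v) set list \<Rightarrow> (complex^'v) set \<Rightarrow> nat" where
  "multiplicity_in T Ws W = length (filter (\<lambda>U. T_isomorphic T U W) Ws)"

definition dual_part ::
    "('v::finite \<Rightarrow> 'v \<Rightarrow> bool) \<Rightarrow> 'v \<Rightarrow> nat \<Rightarrow> (complex^'v) set \<Rightarrow> (complex^'v) set" where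
  "dual_part adj x i W = (\<lambda>w. dual_idem adj x i *v w) ` W"

definition endpoint ::
    "('v::finite \<Rightarrow> 'v \<Rightarrow> bool) \<Rightarrow> 'v \<Rightarrow> (complex^'v) set \<Rightarrow> nat" where
  "endpoint adj x W = (LEAST i. dual_part adj x i W \<noteq> {0})"

definition module_diameter ::
    "('v::finite \<Rightarrow> 'v \<Rightarrow> bool) \<Rightarrow> 'v \<Rightarrow> (complex^'v) set \<Rightarrow> nat" where
  "module_diameter adj x W = card {i. i \<le> gdiam adj \<and> dual_part adj x i W \<noteq> {0}} - 1"

definition module_shape ::
    "('v::finite \<Rightarrow> 'v \<Rightarrow> bool) \<Rightarrow> 'v \<Rightarrow> (complex^'v) set \<Rightarrow> nat list" where
  "module_shape adj x W =
     map (\<lambda>i. vec.dim (dual_part adj x i W))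
       [endpoint adj x W..<endpoint adj x W + module_diameter adj x W + 1]"

(* r: endpoint, m: multiplicity (counted in the decomposition Ws), l: dimension,
   d: diameter, s: shape *)
definition module_profile ::
    "('v::finite \<Rightarrow> 'v \<Rightarrow> bool) \<Rightarrow> 'v \<Rightarrow> (complex^'v) set list \<Rightarrow> (complex^'v) set \<Rightarrow>
     nat \<Rightarrow> nat \<Rightarrow> nat \<Rightarrow> nat \<Rightarrow> nat list \<Rightarrow> bool" where
  "module_profile adj x Ws W r m l d s \<longleftrightarrow>
     endpoint adj x W = r \<and> multiplicity_in (terwilliger_algebra adj x) Ws W = m \<and>
     vec.dim W = l \<and> module_diameter adj x W = d \<and> module_shape adj x W = s"


section \<open>Pure bases, seed vectors, representing matrices\<close>

definition pure_vector ::
    "('v::finite \<Rightarrow> 'v \<Rightarrow> bool) \<Rightarrow> 'v \<Rightarrow> nat \<Rightarrow> complex^'v \<Rightarrow> bool" where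
  "pure_vector adj x i v \<longleftrightarrow> v \<noteq> 0 \<and> v \<in> dual_part adj x i UNIV"

definition pure_basis ::
    "('v::finite \<Rightarrow> 'v \<Rightarrow> bool) \<Rightarrow> 'v \<Rightarrow> (complex^'v) set \<Rightarrow> (complex^'v) list \<Rightarrow> bool" where
  "pure_basis adj x W vs \<longleftrightarrow>
     distinct vs \<and> vec.independent (set vs) \<and> vec.span (set vs) = W \<and>
     (\<exists>ss. sorted ss \<and> list_all2 (pure_vector adj x) ss vs)"

definition represents ::
    "complex^'v^'v::finite \<Rightarrow> complex Matrix.mat \<Rightarrow> (complex^'v) list \<Rightarrow> bool" where
  "represents M B vs \<longleftrightarrow>
     B \<in> carrier_mat (length vs) (length vs) \<and>
     (\<forall>j<length vs. M *v (vs ! j) = (\<Sum>i<length vs. B $$ (i, j) *s (vs ! i)))"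

definition basis_data ::
    "('v::finite \<Rightarrow> 'v \<Rightarrow> bool) \<Rightarrow> 'v \<Rightarrow> (complex^'v) set \<Rightarrow> (complex^'v) list \<Rightarrow>
     complex Matrix.mat \<Rightarrow> complex set \<Rightarrow> bool" where
  "basis_data adj x W vs B ev \<longleftrightarrow>
     pure_basis adj x W vs \<and> represents (adjacency_matrix adj) B vs \<and> spectrum B = ev"

definition level_ordering ::
    "('v::finite \<Rightarrow> 'v \<Rightarrow> bool) \<Rightarrow> 'v \<Rightarrow> (nat \<Rightarrow> 'v list) \<Rightarrow> bool" where
  "level_ordering adj x ord \<longleftrightarrow>
     (\<forall>i\<le>gdiam adj. distinct (ord i) \<and> set (ord i) = gsphere adj i x)"

definition essential_part :: "(nat \<Rightarrow> 'v::finite list) \<Rightarrow> nat \<Rightarrow> complex^'v \<Rightarrow> complex list" where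
  "essential_part ord i v = map (\<lambda>y. v $ y) (ord i)"

definition seed_vector ::
    "('v::finite \<Rightarrow> 'v \<Rightarrow> bool) \<Rightarrow> 'v \<Rightarrow> (nat \<Rightarrow> 'v list) \<Rightarrow> (complex^'v) set \<Rightarrow> complex list \<Rightarrow>
     complex^'v \<Rightarrow> bool" where
  "seed_vector adj x ord W a \<nu> \<longleftrightarrow>
     pure_vector adj x (endpoint adj x W) \<nu> \<and>
     vec.span {\<nu>} = dual_part adj x (endpoint adj x W) W \<and>
     vec.dim (dual_part adj x (endpoint adj x W) W) = 1 \<and>
     essential_part ord (endpoint adj x W) \<nu> = a"

definition alternating :: "complex list \<Rightarrow> complex list" where
  "alternating as = concat (map (\<lambda>a. [a, - a]) as)"

end

theory Submission imports Defs begin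

text \<open>The intersection array determines the graph: it is a cubic antipodal graph of girth 10 with
  antipodal classes of size 3.  Around the class of the base vertex sit three disjoint trees of depth 3, one
  per member, and the remaining vertices carry the structure of a cube; the absence of short cycles forces
  the shift with which each of them meets the three trees.  Hence the vertices can be numbered so that all
  neighbourhoods are explicit.

  In this numbering the 90 basis vectors of the 19 modules are explicit integer vectors.  For each type \<open>t\<close> a
  polynomial in a self-adjoint element of the corner \<open>E r T E r\<close>, \<open>r\<close> the endpoint, projects onto the seeds of
  type \<open>t\<close>, so the Terwilliger algebra contains operators \<open>P t i\<close> which send every seed of type \<open>t\<close> to the
  \<open>i\<close>-th basis vector of its module and kill all other basis vectors.  They and their adjoints yield
  irreducibility and the isomorphism classes, and the products \<open>P t i ** adjoint_mat (P t j)\<close> form a basis of the algebra.\<close>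

section \<open>The path-length metric\<close>

text \<open>The identification of the graph rests on one principle: two antipodal vertices within
  total distance less than 8 of a common vertex coincide (\<open>antipodal_eqI\<close>). It turns
  short closed walks modulo antipodes into closed walks of the graph, which unique geodesics of
  length at most 4 forbid. A vertex outside the trees has one neighbour in each tree and one below
  each branch, hence carries a bijection from branches to sheets. Its parity is constant on
  antipodal classes, as bijections of opposite parity agree somewhere, and it changes along every
  edge of the cube. This leaves no freedom in the shifts.

  The separating elements answer to coincidences. On level 3, \<open>E A^2 E\<close> has the value 2
  on types IV and V, hence the fourth power. On level 4 it has the value 3 on types II and VIII; the
  extra word through level 3 contributes 2 and 0 and tells them apart.

  The integer bases are not orthogonal inside a level, so the identity is not visibly a combination
  of the products spanning the algebra. An injective element \<open>Kop\<close>, built from these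
  products, takes its place in the dimension count.\<close>

locale connected_graph =
  fixes adj :: "'v::finite \<Rightarrow> 'v \<Rightarrow> bool"
  assumes adj_sym: "adj u v \<Longrightarrow> adj v u"
    and adj_irrefl: "\<not> adj u u"
    and conn: "adj\<^sup>*\<^sup>* u v"
begin

abbreviation d :: "'v \<Rightarrow> 'v \<Rightarrow> nat" where "d \<equiv> gdist adj"

definition nb :: "'v \<Rightarrow> 'v set" where "nb v = {z. adj v z}"

lemma nb_iff [simp]: "z \<in> nb v \<longleftrightarrow> adj v z"
  by (simp add: nb_def)

lemma dist_walk: "(adj ^^ d u v) u v"
proof -
  obtain n where "(adj ^^ n) u v"
    using conn[of u v] rtranclp_imp_relpowp by metis
  then show ?thesis unfolding gdist_def by (rule LeastI)
qed

lemma dist_le: "(adj ^^ n) u v \<Longrightarrow> d u v \<le> n"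
  unfolding gdist_def by (rule Least_le)

lemma walk_rev: "(adj ^^ n) u v \<Longrightarrow> (adj ^^ n) v u"
proof (induction n arbitrary: v)
  case (Suc n)
  then obtain w where "(adj ^^ n) u w" "adj w v" by auto
  then show ?case using Suc.IH adj_sym by (metis relpowp_Suc_I2)
qed auto

lemma dist_sym: "d u v = d v u"
  by (meson antisym dist_le dist_walk walk_rev)

lemma dist_triangle: "d u w \<le> d u v + d v w"
proof -
  have "(adj ^^ (d u v + d v w)) u w"
    using dist_walk[of u v] dist_walk[of v w] by (auto simp: relpowp_add)
  then show ?thesis by (rule dist_le)
qed

lemma dist_refl [simp]: "d u u = 0"
  using dist_le[of 0 u u] by simp

lemma dist_0_iff: "d u v = 0 \<longleftrightarrow> u = v"
  using dist_walk[of u v] by (auto simp: dist_refl)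

lemma dist_1_iff: "d u v = 1 \<longleftrightarrow> adj u v"
proof
  assume "d u v = 1" then show "adj u v" using dist_walk[of u v]
    by (metis One_nat_def relpowp_1)
next
  assume a: "adj u v"
  then have "d u v \<le> 1" using dist_le[of 1 u v] by auto
  moreover have "d u v \<noteq> 0" using a adj_irrefl by (auto simp: dist_0_iff)
  ultimately show "d u v = 1" by linarith
qed

lemma dist_adj_le: "adj v w \<Longrightarrow> d u w \<le> Suc (d u v)"
  using dist_triangle[of u w v] dist_1_iff[of v w] by simp

lemma dist_pred:
  assumes "d u v = Suc n"
  obtains w where "adj w v" "d u w = n"
proof -
  have "(adj ^^ Suc n) u v" using dist_walk[of u v] assms by simp
  then obtain w where w: "(adj ^^ n) u w" "adj w v" by auto
  then have "d u w \<le> n" by (simp add: dist_le)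
  moreover have "Suc n \<le> Suc (d u w)" using dist_adj_le[OF w(2), of u] assms by simp
  ultimately show ?thesis using that w by auto
qed

lemma dist_split:
  assumes "d u v = m + n"
  obtains w where "d u w = m" "d w v = n"
proof -
  have "(adj ^^ (m + n)) u v" using dist_walk[of u v] assms by simp
  then obtain w where w: "(adj ^^ m) u w" "(adj ^^ n) w v" by (auto simp: relpowp_add)
  then have "d u w \<le> m" "d w v \<le> n" by (auto intro: dist_le)
  moreover have "m + n \<le> d u w + d w v" using dist_triangle[of u v w] assms by simp
  ultimately have "d u w = m" "d w v = n" by auto
  then show ?thesis by (rule that)
qed

end

section \<open>Graphs with the intersection array of the Foster graph\<close>

text \<open>These are the numbers \<open>b_h\<close>, and below the \<open>c_h\<close>. The added
  values \<open>b_8 = 0\<close> and \<open>c_0 = 0\<close> make the counting axioms hold at both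
  ends of the range of distances.\<close>

definition up_number :: "nat \<Rightarrow> nat" where
  "up_number h = [3, 2, 2, 2, 2, 1, 1, 1, 0] ! h"

definition down_number :: "nat \<Rightarrow> nat" where
  "down_number h = [0, 1, 1, 1, 1, 2, 2, 2, 3] ! h"

locale foster_graph = connected_graph adj
  for adj :: "'v::finite \<Rightarrow> 'v \<Rightarrow> bool" +
  assumes dist_le_8: "d u v \<le> 8"
    and ex_dist_8: "\<exists>v. d u v = 8"
    and card_nb: "card (nb v) = 3"
    and up: "card {z. adj v z \<and> d u z = Suc (d u v)} = up_number (d u v)"
    and down: "card {z. adj v z \<and> Suc (d u z) = d u v} = down_number (d u v)"

lemma foster_graphI:
  fixes adj :: "'v::finite \<Rightarrow> 'v \<Rightarrow> bool"
  assumes dr: "distance_regular adj"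
    and arr: "intersection_array adj = ([3, 2, 2, 2, 2, 1, 1, 1], [1, 1, 1, 1, 2, 2, 2, 3])"
  shows "foster_graph adj" and "gdiam adj = 8"
proof -
  interpret connected_graph adj
    using dr unfolding distance_regular_def simple_graph_def graph_connected_def
    by unfold_locales (auto dest: sympD irreflpD)
  have a1: "map (\<lambda>i. intersection_number adj i 1 (i + 1)) [0..<gdiam adj] = [3, 2, 2, 2, 2, 1, 1, 1]"
    and a2: "map (\<lambda>i. intersection_number adj i 1 (i - 1)) [1..<gdiam adj + 1] = [1, 1, 1, 1, 2, 2, 2, 3]"
    using arr by (auto simp: intersection_array_def)
  from arg_cong[OF a1, of length] show D: "gdiam adj = 8" by simp
  have fin: "finite {d y z | y z. True}"
    using finite_imageI[of UNIV "\<lambda>(y, z). d y z"] by (rule rev_finite_subset) auto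
  have le8: "d u v \<le> 8" for u v
    using Max_ge[OF fin, of "d u v"] D unfolding gdiam_def by auto
  have "Max {d y z | y z. True} \<in> {d y z | y z. True}" using fin by (intro Max_in) auto
  then obtain y0 z0 where yz0: "d y0 z0 = 8" using D unfolding gdiam_def by auto
  have ex: "\<exists>y z. d y z = h" if h: "h \<le> 8" for h
  proof -
    have "d y0 z0 = h + (8 - h)" using yz0 h by simp
    then obtain w where "d y0 w = h" by (rule dist_split)
    then show ?thesis by blast
  qed
  have drD: "\<forall>h\<le>8. \<forall>i\<le>8. \<forall>j\<le>8. \<exists>p. \<forall>y z. d y z = h \<longrightarrow>
      card (gsphere adj i y \<inter> gsphere adj j z) = p"
    using dr unfolding distance_regular_def D by (elim conjE)
  have inum: "card (gsphere adj i y \<inter> gsphere adj j z) = intersection_number adj h i j"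
    if h: "h \<le> 8" "i \<le> 8" "j \<le> 8" "d y z = h" for h i j y z
  proof -
    obtain p where p: "\<forall>y z. d y z = h \<longrightarrow> card (gsphere adj i y \<inter> gsphere adj j z) = p"
      using drD[rule_format, OF h(1-3)] by auto
    \<comment> \<open>The given pair \<open>y\<close>, \<open>z\<close> at distance \<open>h\<close>
      makes the constant unique, so the definite description denotes it.\<close>
    have "intersection_number adj h i j = p"
      unfolding intersection_number_def
    proof (rule the_equality)
      show "\<forall>y z. d y z = h \<longrightarrow> card (gsphere adj i y \<inter> gsphere adj j z) = p" by (rule p)
    next
      fix q
      assume "\<forall>y z. d y z = h \<longrightarrow> card (gsphere adj i y \<inter> gsphere adj j z) = q"
      then have "card (gsphere adj i y \<inter> gsphere adj j z) = q" using h(4) by simp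
      moreover have "card (gsphere adj i y \<inter> gsphere adj j z) = p" using p h(4) by simp
      ultimately show "q = p" by simp
    qed
    then show ?thesis using p h by auto
  qed
  have up: "card {z. adj v z \<and> d u z = Suc (d u v)} = up_number (d u v)" for u v
  proof (cases "d u v = 8")
    case True
    have "d u z \<noteq> 9" for z using le8[of u z] by linarith
    then have "{z. adj v z \<and> d u z = Suc (d u v)} = {}" using True by simp
    then show ?thesis by (simp add: True up_number_def)
  next
    case False
    then have l: "d u v < 8" using le8[of u v] by simp
    have "intersection_number adj i 1 (i + 1) = up_number i" if "i < 8" for i
      using arg_cong[OF a1, of "\<lambda>xs. xs ! i"] D that
      by (auto simp: up_number_def numeral_eq_Suc less_Suc_eq)
    then have "card (gsphere adj 1 v \<inter> gsphere adj (d u v + 1) u) = up_number (d u v)"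
      using inum[of "d u v" 1 "d u v + 1" v u] l dist_sym[of v u] by auto
    moreover have "gsphere adj 1 v \<inter> gsphere adj (d u v + 1) u = {z. adj v z \<and> d u z = Suc (d u v)}"
      by (auto simp: gsphere_def dist_1_iff simp flip: One_nat_def)
    ultimately show ?thesis by simp
  qed
  have down: "card {z. adj v z \<and> Suc (d u z) = d u v} = down_number (d u v)" for u v
  proof (cases "d u v = 0")
    case True
    then show ?thesis by (simp add: True down_number_def)
  next
    case False
    then obtain k where k: "d u v = Suc k" using not0_implies_Suc by blast
    have l: "d u v \<noteq> 0" "d u v \<le> 8" using le8[of u v] False by auto
    have "intersection_number adj i 1 (i - 1) = down_number i" if "i \<noteq> 0" "i \<le> 8" for i
      using arg_cong[OF a2, of "\<lambda>xs. xs ! (i - 1)"] D that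
      by (auto simp: down_number_def numeral_eq_Suc less_Suc_eq le_Suc_eq nth_append)
    then have "card (gsphere adj 1 v \<inter> gsphere adj (d u v - 1) u) = down_number (d u v)"
      using inum[of "d u v" 1 "d u v - 1" v u] l dist_sym[of v u] by auto
    moreover have "gsphere adj 1 v \<inter> gsphere adj (d u v - 1) u = {z. adj v z \<and> Suc (d u z) = d u v}"
      using k by (auto simp: gsphere_def dist_1_iff simp flip: One_nat_def)
    ultimately show ?thesis by simp
  qed
  have nb3: "card (nb v) = 3" for v
  proof -
    have "nb v = {z. adj v z \<and> d v z = Suc (d v v)}"
      by (auto simp: dist_1_iff simp flip: One_nat_def)
    then show ?thesis using up[of v v] by (simp add: up_number_def)
  qed
  \<comment> \<open>The diameter provides one pair at distance 8. Since \<open>b_n\<close> is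
    nonzero for \<open>n < 8\<close>, a geodesic from an arbitrary \<open>u\<close> can also be
    prolonged up to length 8.\<close>
  have ex8: "\<exists>v. d u v = 8" for u
  proof -
    have step: "\<exists>w. d u w = Suc n" if n: "\<exists>v. d u v = n" "n < 8" for n
    proof -
      obtain v where v: "d u v = n" using n by auto
      have "up_number n \<noteq> 0" using n(2)
        by (auto simp: up_number_def numeral_eq_Suc less_Suc_eq)
      then have "{z. adj v z \<and> d u z = Suc (d u v)} \<noteq> {}" using up[where u = u and v = v] v by fastforce
      then show ?thesis using v by auto
    qed
    have "n \<le> 8 \<longrightarrow> (\<exists>v. d u v = n)" for n
    proof (induction n)
      case 0 show ?case by (intro impI exI[of _ u]) simp
    next
      case (Suc n) then show ?case using step[of n] by simp
    qed
    from this[of 8] show ?thesis by simp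
  qed
  show "foster_graph adj"
    by (rule foster_graph.intro[OF connected_graph_axioms], rule foster_graph_axioms.intro)
      (fact le8 ex8 nb3 up down)+
qed

section \<open>Bipartiteness, unique geodesics and their prolongation\<close>

context foster_graph
begin

text \<open>\<open>b_h + c_h = 3\<close> for every \<open>h\<close>, so the neighbours one step
  farther and one step nearer already exhaust the valency. The graph is bipartite.\<close>

lemma nb_dist:
  assumes "adj v z"
  shows "d u z = Suc (d u v) \<or> Suc (d u z) = d u v"
proof -
  let ?U = "{z. adj v z \<and> d u z = Suc (d u v)}" and ?D = "{z. adj v z \<and> Suc (d u z) = d u v}"
  have "up_number h + down_number h = 3" if "h \<le> 8" for h
    using that by (auto simp: up_number_def down_number_def numeral_eq_Suc le_Suc_eq)
  then have "up_number (d u v) + down_number (d u v) = 3" using dist_le_8 by blast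
  moreover have "card (?U \<union> ?D) = card ?U + card ?D"
  proof (rule card_Un_disjoint)
    show "?U \<inter> ?D = {}"
    proof (rule equals0I)
      fix z assume "z \<in> ?U \<inter> ?D"
      then have "d u z = Suc (d u v)" "Suc (d u z) = d u v" by blast+
      then show False by linarith
    qed
  qed (rule finite)+
  ultimately have "card (?U \<union> ?D) = card (nb v)"
    using up[of v u] down[of v u] card_nb[of v] by linarith
  moreover have "?U \<union> ?D \<subseteq> nb v" by (simp add: nb_def) blast
  ultimately have "?U \<union> ?D = nb v" by (intro card_subset_eq[OF finite])
  moreover have "z \<in> nb v" using assms by (simp add: nb_def)
  ultimately show ?thesis by blast
qed

text \<open>\<open>c_1 = c_2 = c_3 = c_4 = 1\<close>: geodesics of length at most 4 are unique.
  Together with bipartiteness this is how the girth 10 enters.\<close>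

lemma unique_down:
  assumes "d u v = Suc n" "n \<le> 3" "adj v z" "adj v z'" "d u z = n" "d u z' = n"
  shows "z = z'"
proof -
  have "down_number (Suc n) = 1"
    using assms(2) by (auto simp: down_number_def numeral_eq_Suc le_Suc_eq)
  then have "card {z. adj v z \<and> d u z = n} = 1" using down[of v u] assms(1) by simp
  then obtain a where "{z. adj v z \<and> d u z = n} = {a}" by (rule card_1_singletonE)
  moreover have "z \<in> {z. adj v z \<and> d u z = n}" "z' \<in> {z. adj v z \<and> d u z = n}"
    using assms by auto
  ultimately show ?thesis by (metis singletonD)
qed

text \<open>\<open>b_5 = b_6 = b_7 = 1\<close>: beyond distance 4 the way outward is forced, the
  counterpart of \<open>unique_down\<close> as seen from an antipode.\<close>

lemma unique_up:
  assumes "d u v = n" "5 \<le> n" "adj v z" "adj v z'" "d u z = Suc n" "d u z' = Suc n"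
  shows "z = z'"
proof -
  have "n < 8" using assms(5) dist_le_8[of u z] by simp
  then have "up_number n = 1"
    using assms(2) by (auto simp: up_number_def numeral_eq_Suc less_Suc_eq)
  then have "card {z. adj v z \<and> d u z = Suc n} = 1" using up[of v u] assms(1) by simp
  then obtain a where "{z. adj v z \<and> d u z = Suc n} = {a}" by (rule card_1_singletonE)
  moreover have "z \<in> {z. adj v z \<and> d u z = Suc n}" "z' \<in> {z. adj v z \<and> d u z = Suc n}"
    using assms by auto
  ultimately show ?thesis by (metis singletonD)
qed

lemma ex_up:
  assumes "d u v < 8"
  obtains z where "adj v z" "d u z = Suc (d u v)"
proof -
  have "up_number (d u v) \<noteq> 0"
    using assms by (auto simp: up_number_def numeral_eq_Suc less_Suc_eq)
  then have "card {z. adj v z \<and> d u z = Suc (d u v)} \<noteq> 0" using up[of v u] by simp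
  then have "{z. adj v z \<and> d u z = Suc (d u v)} \<noteq> {}" by force
  then show ?thesis using that by blast
qed

text \<open>Below distance 8 there is always a neighbour farther from \<open>y\<close>, so a
  geodesic from \<open>y\<close> to \<open>u\<close> grows to length 8. The triangle inequality
  makes the added piece exactly \<open>8 - d y u\<close> long.\<close>

lemma extend_geodesic:
  obtains y' where "d y y' = 8" "d u y' = 8 - d y u"
proof -
  have "\<exists>y'. d y y' = 8 \<and> d u y' = n" if "d y u + n = 8" for n u using that
  proof (induction n arbitrary: u)
    case 0 then show ?case by (intro exI[of _ u]) simp
  next
    case (Suc n)
    then have "d y u < 8" by simp
    then obtain z where z: "adj u z" "d y z = Suc (d y u)" by (rule ex_up)
    moreover have "d y z + n = 8" using z Suc.prems by simp
    then obtain y' where y': "d y y' = 8" "d z y' = n" using Suc.IH by blast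
    have "d u y' \<le> Suc n" using dist_triangle[of u y' z] z y' dist_1_iff[of u z] by simp
    moreover have "8 \<le> d y u + d u y'" using dist_triangle[of y y' u] y' by simp
    ultimately show ?case using y' Suc.prems by (intro exI[of _ y']) simp
  qed
  from this[of u "8 - d y u"] show ?thesis using that dist_le_8[of y u] by auto
qed

subsection \<open>Antipodal classes\<close>

definition antipodal :: "'v \<Rightarrow> 'v \<Rightarrow> bool" where
  "antipodal u v \<longleftrightarrow> u = v \<or> d u v = 8"

lemma antipodal_refl [simp]: "antipodal u u"
  by (simp add: antipodal_def)

lemma antipodal_sym: "antipodal u v \<Longrightarrow> antipodal v u"
  using dist_sym[of u v] by (auto simp: antipodal_def)

lemma antipodal_eq: "antipodal u v \<Longrightarrow> d u v < 8 \<Longrightarrow> u = v"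
  by (auto simp: antipodal_def)

lemma antipodal_eqI: "antipodal u v \<Longrightarrow> d u w \<le> m \<Longrightarrow> d v w \<le> n \<Longrightarrow> m + n < 8 \<Longrightarrow> u = v"
  using dist_triangle[of u v w] dist_sym[of w v] by (intro antipodal_eq) auto

text \<open>Strong induction on \<open>d y u\<close>, with \<open>w\<close> the predecessor of
  \<open>u\<close>. A step away from \<open>y\<close> is a step towards \<open>y'\<close>: the only
  neighbour of \<open>w\<close> farther from \<open>y'\<close> is the one leading back to
  \<open>y\<close>. This uses \<open>unique_up\<close> at distance at least 5 from
  \<open>y'\<close>, available because \<open>w\<close> is within 3 of \<open>y\<close>. For
  \<open>w = y\<close> the distance would exceed the diameter.\<close>

lemma dist_antipode:
  assumes "d y y' = 8" "d u y \<le> 4"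
  shows "d u y' = 8 - d u y"
proof -
  have "d y' u = 8 - n" if "d y u = n" "n \<le> 4" for n using that
  proof (induction n arbitrary: u rule: less_induct)
    case (less n)
    show ?case
    proof (cases n)
      case 0
      then have "y = u" using less.prems by (simp add: dist_0_iff)
      then show ?thesis using 0 assms(1) dist_sym[of y' u] by simp
    next
      case (Suc m)
      then obtain w where w: "adj w u" "d y w = m" using less.prems by (metis dist_pred)
      have w8: "d y' w = 8 - m" using less.IH[of m w] w Suc less.prems by simp
      have or: "d y' u = Suc (8 - m) \<or> Suc (d y' u) = 8 - m" using nb_dist[OF w(1), of y'] w8 by simp
      have "d y' u \<noteq> Suc (8 - m)"
      proof
        assume a: "d y' u = Suc (8 - m)"
        show False
        proof (cases m)
          case 0 then show False using a dist_le_8[of y' u] by simp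
        next
          case (Suc k)
          then obtain t where t: "adj t w" "d y t = k" using w by (metis dist_pred)
          have "d y' t = 8 - k" using less.IH[of k t] t Suc \<open>n = Suc m\<close> less.prems by simp
          then have "t = u" using unique_up[of y' w "8 - m" t u] a w8 t w Suc \<open>n = Suc m\<close> less.prems adj_sym
            by simp
          then show False using t less.prems Suc \<open>n = Suc m\<close> by simp
        qed
      qed
      then show ?thesis using or Suc less.prems by simp
    qed
  qed
  from this[of "d y u"] show ?thesis using assms(2) dist_sym[of y u] dist_sym[of y' u] by auto
qed

text \<open>Suppose \<open>u\<close> and \<open>w\<close> are at a distance strictly between 0 and
  8. If it is at most 4, \<open>dist_antipode\<close> puts \<open>v\<close> closer than 8 to
  \<open>w\<close>. Otherwise the vertex at distance 4 from \<open>u\<close> on a geodesic to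
  \<open>w\<close> is at distance 4 from \<open>v\<close> by way of \<open>u\<close>, but at
  distance more than 4 by way of \<open>w\<close>.\<close>

lemma antipodal_trans:
  assumes "antipodal u v" "antipodal v w" shows "antipodal u w"
proof (cases "u = v \<or> v = w")
  case True then show ?thesis using assms by auto
next
  case False
  then have 8: "d v u = 8" "d v w = 8" using assms dist_sym[of u v] by (auto simp: antipodal_def)
  show ?thesis
  proof (rule ccontr)
    assume "\<not> antipodal u w"
    then have n: "d u w \<noteq> 0" "d u w < 8" using dist_le_8[of u w]
      by (auto simp: antipodal_def dist_0_iff)
    show False
    proof (cases "d u w \<le> 4")
      case True
      have "d w v = 8 - d w u"
        using dist_antipode[of u v w] 8 True dist_sym[of u v] dist_sym[of w u] by simp
      then show False using 8(2) n(1) dist_sym[of w v] dist_sym[of w u] dist_le_8[of w u] by simp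
    next
      case False
      then have "d u w = 4 + (d u w - 4)" by simp
      then obtain z where z: "d u z = 4" "d z w = d u w - 4" by (rule dist_split)
      have "d z v = 4" using dist_antipode[of u v z] 8 z dist_sym[of u v] dist_sym[of z u] by simp
      moreover have "d z v = 8 - d z w"
        using dist_antipode[of w v z] 8 z n(2) dist_sym[of w v] by simp
      ultimately show False using z n by simp
    qed
  qed
qed

text \<open>\<open>u'\<close> is at distance 8 from \<open>u\<close>, hence 7 from \<open>v\<close>;
  as \<open>b_7\<close> is positive, one more step from \<open>u'\<close> away from \<open>v\<close>
  reaches an antipode of \<open>v\<close>. So edges lift through the antipodal quotient.\<close>

lemma lift_edge:
  assumes "adj u v" "antipodal u u'"
  obtains v' where "antipodal v v'" "adj u' v'"
proof (cases "u = u'")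
  case True then show ?thesis using that[of v] assms by simp
next
  case False
  then have 8: "d u' u = 8" using assms dist_sym[of u u'] by (simp add: antipodal_def)
  then have "d u' v = 7" using nb_dist[OF assms(1), of u'] dist_le_8[of u' v] by simp
  then have "d v u' = 7" using dist_sym[of v u'] by simp
  then have "d v u' < 8" by simp
  then obtain z where "adj u' z" "d v z = Suc (d v u')" by (rule ex_up)
  then show ?thesis using that[of z] \<open>d v u' = 7\<close> by (simp add: antipodal_def)
qed

lemma antipodal_common_nb: "antipodal u u' \<Longrightarrow> adj v u \<Longrightarrow> adj v u' \<Longrightarrow> u = u'"
  using dist_1_iff[of u v] dist_1_iff[of u' v] by (intro antipodal_eqI[of u u' v 1 1]) (auto dest: adj_sym)

text \<open>Lifting a geodesic edge by edge bounds the distance from above. Lifting it back yields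
  an antipode of \<open>v\<close> within 3 of \<open>u\<close>, which is \<open>v\<close> itself
  because \<open>3 + 3 < 8\<close>, and this gives the reverse bound.\<close>

lemma lift_walk:
  assumes "antipodal u u'" "d u v \<le> 3"
  obtains v' where "antipodal v v'" "d u' v' = d u v"
proof -
  have ex: "\<exists>v'. antipodal v v' \<and> d u' v' \<le> n" if "antipodal u u'" "d u v = n" for n u u' v using that
  proof (induction n arbitrary: v)
    case 0 then show ?case by (intro exI[of _ u']) (auto simp: dist_0_iff)
  next
    case (Suc n)
    obtain w where w: "adj w v" "d u w = n" using dist_pred[OF Suc.prems(2)] by blast
    then obtain w' where w': "antipodal w w'" "d u' w' \<le> n" using Suc.IH[of w] Suc.prems by blast
    obtain v' where "antipodal v v'" "adj w' v'" using lift_edge[OF w(1) w'(1)] by blast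
    then show ?case using dist_adj_le[of w' v' u'] w' by (intro exI[of _ v']) auto
  qed
  obtain v' where v': "antipodal v v'" "d u' v' \<le> d u v" using ex[OF assms(1) refl] by blast
  obtain v'' where v'': "antipodal v' v''" "d u v'' \<le> d u' v'"
    using ex[OF antipodal_sym[OF assms(1)] refl] by blast
  have "v = v''" using antipodal_eqI[of v v'' u 3 3] antipodal_trans[OF v'(1) v''(1)] v' v'' assms(2)
      dist_sym[of v u] dist_sym[of v'' u] by auto
  then show ?thesis using that[of v'] v' v'' by simp
qed

text \<open>Passing to an antipode of \<open>y\<close> on the prolonged geodesic turns the distances
  5, ..., 8 into 3, ..., 0. Only at distance 4 nothing is gained.\<close>

lemma nearby_antipode:
  assumes "d u y \<noteq> 4"
  obtains y' where "antipodal y y'" "d u y' \<le> 3"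
proof (cases "d u y \<le> 3")
  case True then show ?thesis using that[of y] by simp
next
  case False
  obtain y' where "d y y' = 8" "d u y' = 8 - d y u" by (rule extend_geodesic)
  then show ?thesis using that[of y'] assms False dist_sym[of u y] by (auto simp: antipodal_def)
qed

subsection \<open>Sizes of the spheres\<close>

text \<open>The edges between two consecutive spheres, counted from both ends.\<close>

lemma sphere_card_Suc:
  "card {v. d u v = i} * up_number i = card {v. d u v = Suc i} * down_number (Suc i)"
proof -
  let ?R = "{(v, z). d u v = i \<and> d u z = Suc i \<and> adj v z}"
  have "?R = (SIGMA v:{v. d u v = i}. {z. adj v z \<and> d u z = Suc (d u v)})" by auto
  then have "card ?R = (\<Sum>v\<in>{v. d u v = i}. card {z. adj v z \<and> d u z = Suc (d u v)})"
    by (simp only: card_SigmaI[OF finite ballI[OF finite]])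
  also have "\<dots> = (\<Sum>v\<in>{v. d u v = i}. up_number i)"
    unfolding up by (rule sum.cong) auto
  finally have 1: "card ?R = card {v. d u v = i} * up_number i" by (simp only: sum_constant of_nat_id)
  have "?R = prod.swap ` (SIGMA z:{v. d u v = Suc i}. {v. adj z v \<and> Suc (d u v) = d u z})"
    by (auto simp: image_iff dest: adj_sym)
  then have "card ?R = card (SIGMA z:{v. d u v = Suc i}. {v. adj z v \<and> Suc (d u v) = d u z})"
    by (simp only: card_image[OF inj_on_subset[OF inj_swap subset_UNIV]])
  also have "\<dots> = (\<Sum>z\<in>{v. d u v = Suc i}. card {v. adj z v \<and> Suc (d u v) = d u z})"
    by (simp only: card_SigmaI[OF finite ballI[OF finite]])
  also have "\<dots> = (\<Sum>z\<in>{v. d u v = Suc i}. down_number (Suc i))"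
    unfolding down by (rule sum.cong) auto
  finally have 2: "card ?R = card {v. d u v = Suc i} * down_number (Suc i)" by (simp only: sum_constant of_nat_id)
  show ?thesis using 1 2 by (simp only:)
qed

lemma card_sphere:
  "card {v. d u v = 2} = 6" "card {v. d u v = 3} = 12" "card {v. d u v = 4} = 24" "card {v. d u v = 8} = 2"
proof -
  have "{v. d u v = 0} = {u}" by (auto simp: dist_0_iff)
  then have 0: "card {v. d u v = 0} = 1" by simp
  have n: "card {v. d u v = Suc i} * ([0, 1, 1, 1, 1, 2, 2, 2, 3] ! Suc i) =
      card {v. d u v = i} * ([3, 2, 2, 2, 2, 1, 1, 1, 0] ! i)" for i
    using sphere_card_Suc[of u i] by (simp only: up_number_def down_number_def)
  have 1: "card {v. d u v = 1} = 3" using n[of 0] 0 by simp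
  show 2: "card {v. d u v = 2} = 6" using n[of 1] 1 by (simp add: numeral_2_eq_2)
  show 3: "card {v. d u v = 3} = 12" using n[of 2] 2 by simp
  show 4: "card {v. d u v = 4} = 24" using n[of 3] 3 by simp
  have 5: "card {v. d u v = 5} = 24" using n[of 4] 4 by simp
  have 6: "card {v. d u v = 6} = 12" using n[of 5] 5 by simp
  have 7: "card {v. d u v = 7} = 6" using n[of 6] 6 by simp
  show 8: "card {v. d u v = 8} = 2" using n[of 7] 7 by simp
qed

end

section \<open>Three sheets around an antipodal class\<close>

locale foster_sheets = foster_graph adj
  for adj :: "'v::finite \<Rightarrow> 'v \<Rightarrow> bool" +
  fixes W :: "nat \<Rightarrow> 'v"
  assumes dist_W: "s < 3 \<Longrightarrow> t < 3 \<Longrightarrow> s \<noteq> t \<Longrightarrow> d (W s) (W t) = 8"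
begin

text \<open>Well defined on the ball of radius 3 about \<open>W 0\<close>: existence is
  \<open>lift_walk\<close>, and two antipodes within 3 of \<open>W s\<close> would be at distance at
  most 6 from each other.\<close>

definition copy :: "nat \<Rightarrow> 'v \<Rightarrow> 'v" where
  "copy s v = (THE v'. antipodal v v' \<and> d (W s) v' \<le> 3)"

lemma antipodal_W: "s < 3 \<Longrightarrow> t < 3 \<Longrightarrow> antipodal (W s) (W t)"
  using dist_W[of s t] by (cases "s = t") (auto simp: antipodal_def)

lemma W_eqD:
  assumes "d (W s) v \<le> 3" "d (W t) v \<le> 4" "s < 3" "t < 3" shows "s = t"
proof (rule ccontr)
  assume "s \<noteq> t"
  then have "W s \<noteq> W t" using dist_W[of s t] assms by auto
  then show False using antipodal_eqI[of "W s" "W t" v 3 4] antipodal_W assms by auto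
qed

lemma copy_eqI:
  assumes "antipodal v v'" "d (W s) v' \<le> 3" shows "copy s v = v'"
  unfolding copy_def
proof (rule the_equality)
  fix w assume w: "antipodal v w \<and> d (W s) w \<le> 3"
  then have "antipodal w v'" using assms antipodal_trans antipodal_sym by blast
  then show "w = v'" using antipodal_eqI[of w v' "W s" 3 3] w assms dist_sym[of "W s" w] dist_sym[of "W s" v'] by simp
qed (use assms in simp)

lemma copy_props:
  assumes "d (W 0) v \<le> 3" "s < 3"
  shows "antipodal v (copy s v)" "d (W s) (copy s v) = d (W 0) v"
proof -
  obtain v' where v': "antipodal v v'" "d (W s) v' = d (W 0) v"
    using lift_walk[OF antipodal_W[of 0 s] assms(1)] assms(2) by auto
  then have "copy s v = v'" using copy_eqI assms by simp
  then show "antipodal v (copy s v)" "d (W s) (copy s v) = d (W 0) v" using v' by auto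
qed

lemma antipodal_copyD:
  assumes "antipodal (copy s u) (copy t v)" "d (W 0) u \<le> 3" "d (W 0) v \<le> 3" "s < 3" "t < 3"
  shows "u = v"
proof -
  have "antipodal u v"
    using copy_props(1)[of u s] copy_props(1)[of v t] assms antipodal_trans antipodal_sym by blast
  then show ?thesis using antipodal_eqI[of u v "W 0" 3 3] assms dist_sym[of "W 0" u] dist_sym[of "W 0" v] by simp
qed

lemma copy_eqD:
  assumes "copy s u = copy t v" "d (W 0) u \<le> 3" "d (W 0) v \<le> 3" "s < 3" "t < 3"
  shows "u = v" "s = t"
proof -
  show "u = v" using antipodal_copyD[of s u t v] assms by simp
  show "s = t" using W_eqD[of s "copy s u" t] copy_props(2)[of u s] copy_props(2)[of v t] assms by simp
qed

lemma antipodal_copies: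
  assumes "d (W 0) v \<le> 3" "s < 3" "t < 3" shows "antipodal (copy s v) (copy t v)"
  using assms copy_props(1)[of v s] copy_props(1)[of v t] antipodal_trans antipodal_sym by blast

text \<open>The three copies lie in different sheets, and since the sphere of radius 8 has two
  elements, an antipodal class has no further members.\<close>

lemma antipode_is_copy:
  assumes "d (W 0) v \<le> 3" "antipodal v w"
  obtains s where "s < 3" "w = copy s v"
proof -
  have sub: "(\<lambda>s. copy s v) ` {..<3} \<subseteq> insert v {w. d v w = 8}"
  proof (rule image_subsetI)
    fix s :: nat assume "s \<in> {..<3}"
    then have "antipodal v (copy s v)" using copy_props(1)[of v s] assms by simp
    then show "copy s v \<in> insert v {w. d v w = 8}" unfolding antipodal_def by auto
  qed
  have "inj_on (\<lambda>s. copy s v) {..<3}"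
    using copy_eqD(2) assms by (auto simp: inj_on_def)
  then have "card ((\<lambda>s. copy s v) ` {..<3}) = 3" by (simp add: card_image)
  moreover have "card (insert v {w. d v w = 8}) = 3" using card_sphere(4)[of v] by (simp add: card_insert_if)
  ultimately have "(\<lambda>s. copy s v) ` {..<3} = insert v {w. d v w = 8}"
    using sub by (intro card_subset_eq[OF finite]) simp_all
  moreover have "w \<in> insert v {w. d v w = 8}" using assms by (auto simp: antipodal_def)
  ultimately show ?thesis using that by blast
qed

lemma copy_adj:
  assumes "adj u v" "d (W 0) u \<le> 3" "d (W 0) v \<le> 3" "s < 3"
  shows "adj (copy s u) (copy s v)"
proof -
  obtain v' where v': "antipodal v v'" "adj (copy s u) v'"
    using lift_edge[OF assms(1) copy_props(1)] assms by metis
  have "d (W s) v' \<le> 4" using dist_adj_le[OF v'(2), of "W s"] copy_props(2)[of u s] assms by simp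
  moreover have "antipodal v' (copy s v)"
    using v' copy_props(1)[of v s] assms antipodal_trans antipodal_sym by blast
  ultimately have "v' = copy s v"
    using antipodal_eqI[of v' "copy s v" "W s" 4 3] copy_props(2)[of v s] assms
      dist_sym[of "W s" v'] dist_sym[of "W s" "copy s v"] by simp
  then show ?thesis using v' by simp
qed

text \<open>Copying preserves edges and is injective, so valency 3 forces equality. The radius is 2
  because the neighbours must still lie in the ball of radius 3.\<close>

lemma nb_copy:
  assumes "d (W 0) v \<le> 2" "s < 3"
  shows "nb (copy s v) = copy s ` nb v"
proof -
  have i: "d (W 0) z \<le> 3" if "z \<in> nb v" for z
    using dist_adj_le[of v z "W 0"] that assms by simp
  have "copy s ` nb v \<subseteq> nb (copy s v)" using copy_adj[of v _ s] i assms by auto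
  moreover have "inj_on (copy s) (nb v)" using copy_eqD(1) i assms by (meson inj_onI)
  then have "card (copy s ` nb v) = card (nb (copy s v))" by (simp add: card_image card_nb)
  ultimately show ?thesis using card_subset_eq[OF finite] by metis
qed

subsection \<open>Vertices outside the sheets\<close>

text \<open>The balls of radius 3 about the three vertices \<open>W s\<close> have 22 vertices each.
  The 24 vertices at distance 4 from \<open>W 0\<close> are at distance 4 from every
  \<open>W s\<close>, by \<open>outer_iff\<close>.\<close>

definition outer :: "'v \<Rightarrow> bool" where "outer u \<longleftrightarrow> d (W 0) u = 4"

lemma outer_iff: assumes "s < 3" shows "outer u \<longleftrightarrow> d (W s) u = 4"
proof (cases "s = 0")
  case False
  then have "d (W 0) (W s) = 8" "d (W s) (W 0) = 8" using dist_W assms by auto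
  then show ?thesis
    using dist_antipode[of "W 0" "W s" u] dist_antipode[of "W s" "W 0" u]
      dist_sym[of u "W 0"] dist_sym[of u "W s"] by (auto simp: outer_def)
qed (simp add: outer_def)

lemma outer_antipodal:
  assumes "outer u" "antipodal u u'" shows "outer u'"
proof (cases "u = u'")
  case False
  then show ?thesis using dist_antipode[of u u' "W 0"] assms by (auto simp: antipodal_def outer_def)
qed (use assms in simp)

lemma outer_leaf_unique:
  assumes "outer u" "s < 3" "d (W 0) v = 3" "d (W 0) v' = 3" "adj u (copy s v)" "adj u (copy s v')"
  shows "v = v'"
proof -
  have "copy s v = copy s v'"
    using unique_down[of "W s" u 3 "copy s v" "copy s v'"] assms outer_iff[of s u]
      copy_props(2)[of v s] copy_props(2)[of v' s] by simp
  then show ?thesis using copy_eqD(1)[of s v s v'] assms by simp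
qed

text \<open>By bipartiteness \<open>d u y\<close> is never 4, so some copy of \<open>y\<close> is
  within 3 of \<open>u\<close>, and at exactly 3 because the root of its sheet is at distance 4. The
  last vertex before \<open>u\<close> on the geodesic is a leaf copy.\<close>

lemma outer_branch:
  assumes "outer u" "adj (W 0) y"
  obtains s v where "s < 3" "d (W 0) v = 3" "d y v = 2" "adj u (copy s v)"
proof -
  have y1: "d (W 0) y = 1" using assms dist_1_iff by blast
  have "d u (W 0) = 4" using assms dist_sym[of u "W 0"] by (simp add: outer_def)
  then have "d u y \<noteq> 4" using nb_dist[OF assms(2), of u] by auto
  then obtain y' where y': "antipodal y y'" "d u y' \<le> 3" by (rule nearby_antipode)
  obtain s where s: "s < 3" "y' = copy s y" using antipode_is_copy[OF _ y'(1)] y1 by auto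
  have Wy: "d (W s) y' = 1" using copy_props(2)[of y s] s y1 by simp
  have Wu: "d (W s) u = 4" using assms s outer_iff by simp
  have "d y' u = Suc 2" using y'(2) dist_triangle[of "W s" u y'] Wy Wu dist_sym[of u y'] by simp
  then obtain w where w: "adj w u" "d y' w = 2" by (rule dist_pred)
  obtain v where v: "antipodal w v" "d y v = 2"
    using lift_walk[OF antipodal_sym[OF y'(1)], of w] w by auto
  have Ww: "d (W s) w = 3"
    using dist_triangle[of "W s" w y'] dist_adj_le[OF w(1), of "W s"] w Wy Wu by simp
  then have c: "copy s v = w" using v antipodal_sym by (intro copy_eqI) auto
  have le: "d (W 0) v \<le> 3" using dist_triangle[of "W 0" v y] y1 v by simp
  then have "d (W 0) v = 3" using copy_props(2)[of v s] c Ww s by simp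
  then show ?thesis using that[of s v] s v w c adj_sym by simp
qed

lemma dist_branch_copy:
  assumes "adj (W 0) y" "d (W 0) v = 3" "d y v = 2" "s < 3" "adj u (copy s v)"
  shows "d u (copy s y) \<le> 3"
proof -
  have y1: "d (W 0) y = 1" using assms dist_1_iff by blast
  obtain v' where v': "antipodal v v'" "d (copy s y) v' = 2"
    using lift_walk[OF copy_props(1)[of y s], of v] y1 assms by auto
  have "d (W s) v' \<le> 3"
    using dist_triangle[of "W s" v' "copy s y"] copy_props(2)[of y s] y1 v' assms by simp
  then have "copy s v = v'" using v' by (intro copy_eqI)
  moreover have "d u (copy s v) = 1" using assms dist_1_iff by blast
  ultimately show ?thesis
    using dist_triangle[of u "copy s y" "copy s v"] v' dist_sym[of "copy s v" "copy s y"] by simp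
qed

text \<open>Either leaf puts a copy of \<open>y\<close> within 3 of \<open>u\<close>. As
  \<open>3 + 3 < 8\<close> the two copies coincide, hence so do the sheets, and
  \<open>c_4 = 1\<close> identifies the leaves.\<close>

lemma outer_branch_unique:
  assumes "outer u" "adj (W 0) y"
    and "s < 3" "d (W 0) v = 3" "d y v = 2" "adj u (copy s v)"
    and "s' < 3" "d (W 0) v' = 3" "d y v' = 2" "adj u (copy s' v')"
  shows "s = s'" "v = v'"
proof -
  have y1: "d (W 0) y = 1" using assms dist_1_iff by blast
  have "copy s y = copy s' y"
    using antipodal_eqI[of "copy s y" "copy s' y" u 3 3] antipodal_copies[of y s s'] y1 assms
      dist_branch_copy[of y v s u] dist_branch_copy[of y v' s' u]
      dist_sym[of u "copy s y"] dist_sym[of u "copy s' y"] by simp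
  then show "s = s'" using copy_eqD(2)[of s y s' y] y1 assms by simp
  then show "v = v'" using outer_leaf_unique[of u s v v'] assms by simp
qed

text \<open>Coordinates of an outer vertex: for every branch \<open>y\<close> at the root,
  \<open>u\<close> is adjacent to the copy of \<open>leaf u y\<close> in sheet
  \<open>sheet u y\<close>, and this describes all three neighbours.\<close>

definition sheet :: "'v \<Rightarrow> 'v \<Rightarrow> nat" where
  "sheet u y = (THE s. s < 3 \<and> (\<exists>v. d (W 0) v = 3 \<and> d y v = 2 \<and> adj u (copy s v)))"

definition leaf :: "'v \<Rightarrow> 'v \<Rightarrow> 'v" where
  "leaf u y = (THE v. d (W 0) v = 3 \<and> d y v = 2 \<and> (\<exists>s<3. adj u (copy s v)))"

lemma sheet_leaf_eqI:
  assumes "outer u" "adj (W 0) y" "s < 3" "d (W 0) v = 3" "d y v = 2" "adj u (copy s v)"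
  shows "sheet u y = s" "leaf u y = v"
proof -
  show "sheet u y = s"
    unfolding sheet_def by (rule the_equality) (use assms outer_branch_unique(1)[OF assms(1,2)] in blast)+
  show "leaf u y = v"
    unfolding leaf_def by (rule the_equality) (use assms outer_branch_unique(2)[OF assms(1,2)] in blast)+
qed

lemma sheet_leaf:
  assumes "outer u" "adj (W 0) y"
  shows "sheet u y < 3" "d (W 0) (leaf u y) = 3" "d y (leaf u y) = 2" "adj u (copy (sheet u y) (leaf u y))"
proof -
  obtain s v where sv: "s < 3" "d (W 0) v = 3" "d y v = 2" "adj u (copy s v)"
    using outer_branch[OF assms] by blast
  then show "sheet u y < 3" "d (W 0) (leaf u y) = 3" "d y (leaf u y) = 2"
    "adj u (copy (sheet u y) (leaf u y))"
    using sheet_leaf_eqI[OF assms sv] by auto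
qed

lemma branch_unique:
  assumes "d (W 0) v = 3" "adj (W 0) y" "adj (W 0) y'" "d y v = 2" "d y' v = 2"
  shows "y = y'"
  using unique_down[of v "W 0" 2 y y'] assms dist_sym[of v "W 0"] dist_sym[of v y] dist_sym[of v y'] by simp

text \<open>\<open>c_4 = 1\<close> allows only one neighbour in each sheet, so equal sheets give
  equal leaves and thus equal branches. Hence \<open>sheet u\<close> is a bijection from the three
  branches to the three sheets.\<close>

lemma sheet_inj:
  assumes "outer u" "adj (W 0) y" "adj (W 0) y'" "sheet u y = sheet u y'"
  shows "y = y'"
proof -
  have "leaf u y = leaf u y'"
    using outer_leaf_unique[of u "sheet u y" "leaf u y" "leaf u y'"] sheet_leaf[OF assms(1,2)]
      sheet_leaf[OF assms(1,3)] assms by simp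
  then show ?thesis using branch_unique[of "leaf u y" y y'] sheet_leaf[OF assms(1,2)]
      sheet_leaf[OF assms(1,3)] assms by simp
qed

lemma dist_copy_branch:
  assumes "outer u" "adj (W 0) y" shows "d (copy (sheet u y) y) u = 3"
proof -
  note sl = sheet_leaf[OF assms]
  have y1: "d (W 0) y = 1" using assms dist_1_iff by blast
  have "d u (copy (sheet u y) y) \<le> 3" using dist_branch_copy[of y "leaf u y" "sheet u y" u] sl assms by simp
  moreover have "d (W (sheet u y)) u \<le> 1 + d (copy (sheet u y) y) u"
    using dist_triangle[of "W (sheet u y)" u "copy (sheet u y) y"] copy_props(2)[of y "sheet u y"] y1 sl by simp
  moreover have "d (W (sheet u y)) u = 4" using outer_iff[of "sheet u y" u] sl assms by simp
  ultimately show ?thesis using dist_sym[of u "copy (sheet u y) y"] by simp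
qed

text \<open>The edge from the leaf copy to \<open>u\<close> lifts to an edge ending in
  \<open>u'\<close>, which starts in another copy of the same leaf. It cannot be the same copy,
  since antipodes have no common neighbour.\<close>

lemma leaf_antipodal:
  assumes "outer u" "adj (W 0) y" "antipodal u u'"
  shows "leaf u' y = leaf u y" "u \<noteq> u' \<Longrightarrow> sheet u' y \<noteq> sheet u y"
proof -
  note sl = sheet_leaf[OF assms(1,2)]
  have o': "outer u'" using outer_antipodal assms by blast
  let ?c = "copy (sheet u y) (leaf u y)"
  obtain w where w: "antipodal ?c w" "adj u' w" using lift_edge[OF sl(4) assms(3)] by blast
  have "antipodal (leaf u y) w" using w(1) copy_props(1)[of "leaf u y" "sheet u y"] sl antipodal_trans by simp
  then obtain t where t: "t < 3" "w = copy t (leaf u y)" using antipode_is_copy[of "leaf u y" w] sl by auto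
  then show l: "leaf u' y = leaf u y"
    using sheet_leaf_eqI(2)[of u' y t "leaf u y"] o' w sl assms by simp
  show "sheet u' y \<noteq> sheet u y" if "u \<noteq> u'"
  proof
    assume "sheet u' y = sheet u y"
    then have "adj u' ?c" using sheet_leaf(4)[OF o' assms(2)] l by simp
    then have "u = u'" using antipodal_common_nb[of u u' ?c] sl(4) assms(3) adj_sym by blast
    then show False using that by simp
  qed
qed

lemma class_member:
  assumes "outer u" "adj (W 0) y" "t < 3"
  obtains u' where "antipodal u u'" "sheet u' y = t"
proof -
  note sl = sheet_leaf[OF assms(1,2)]
  have "antipodal (copy (sheet u y) (leaf u y)) (copy t (leaf u y))" using antipodal_copies sl assms by simp
  then obtain u' where u': "antipodal u u'" "adj (copy t (leaf u y)) u'"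
    using lift_edge[OF adj_sym[OF sl(4)]] by blast
  then show ?thesis
    using that[of u'] sheet_leaf_eqI(1)[of u' y t "leaf u y"] outer_antipodal[of u u'] sl assms adj_sym by simp
qed

lemma leaf_outer_nbs:
  assumes "d (W 0) v = 3" "s < 3"
  shows "card {u. outer u \<and> adj (copy s v) u} = 2"
proof -
  have "d (W s) (copy s v) = 3" using copy_props(2)[of v s] assms by simp
  then have "card {z. adj (copy s v) z \<and> d (W s) z = 4} = 2"
    using up[of "copy s v" "W s"] by (simp add: up_number_def)
  then show ?thesis using outer_iff[OF assms(2)] by (simp add: conj_commute)
qed

subsection \<open>Consequences of the girth\<close>

text \<open>If the sheets at \<open>y'\<close> agreed, \<open>u\<close> and \<open>u'\<close> would
  both be adjacent to the leaf copy \<open>m\<close> and at distance 3 from the branch copy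
  \<open>c\<close>. If \<open>d c m = 4\<close>, geodesics from \<open>c\<close> to \<open>m\<close>
  are not unique. If \<open>d c m = 2\<close>, then \<open>m\<close> lies in the sheet of
  \<open>c\<close> and \<open>u\<close> meets that sheet on two branches.\<close>

lemma shared_leaf_sheets:
  assumes "outer u" "outer u'" "u \<noteq> u'" "adj (W 0) y" "adj (W 0) y'" "y \<noteq> y'"
    and "leaf u y = leaf u' y" "sheet u y = sheet u' y"
  shows "sheet u y' \<noteq> sheet u' y'"
proof
  assume e: "sheet u y' = sheet u' y'"
  define m where "m = copy (sheet u y) (leaf u y)"
  define c where "c = copy (sheet u y') y'"
  have m: "adj m u" "adj m u'"
    using sheet_leaf(4)[of u y] sheet_leaf(4)[of u' y] assms adj_sym unfolding m_def by auto
  have c: "d c u = 3" "d c u' = 3"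
    using dist_copy_branch[of u y'] dist_copy_branch[of u' y'] e assms unfolding c_def by auto
  have y1: "d (W 0) y' = 1" using assms dist_1_iff by blast
  have "d c m = 4 \<or> d c m = 2" using nb_dist[OF m(1), of c] c by auto
  then show False
  proof
    assume "d c m = 4"
    then show False using unique_down[of c m 3 u u'] m c assms by simp
  next
    assume "d c m = 2"
    then have "d (W (sheet u y')) m \<le> 3"
      using dist_triangle[of "W (sheet u y')" m c] copy_props(2)[of y' "sheet u y'"] y1
        sheet_leaf(1)[of u y'] assms unfolding c_def by simp
    moreover have "d (W (sheet u y)) m = 3"
      using copy_props(2)[of "leaf u y" "sheet u y"] sheet_leaf[of u y] assms unfolding m_def by simp
    ultimately have "sheet u y' = sheet u y"
      using W_eqD[of "sheet u y'" m "sheet u y"] sheet_leaf(1)[of u y] sheet_leaf(1)[of u y'] assms by simp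
    then show False using sheet_inj[of u y' y] assms by simp
  qed
qed

lemma dist_common_nb: "adj m u \<Longrightarrow> adj m v \<Longrightarrow> d u v \<le> 2"
  using dist_triangle[of u v m] dist_1_iff[of m u] dist_1_iff[of m v] dist_sym[of u m] by simp

text \<open>A shared leaf and a shared grandparent would close a walk of length 6 in the quotient.\<close>

lemma shared_leaf_parent:
  assumes "outer u" "outer u'" "\<not> antipodal u u'" "adj (W 0) y" "adj (W 0) y'" "y \<noteq> y'"
    and "leaf u y = leaf u' y" "d (W 0) z = 2" "adj z (leaf u y')" "adj z (leaf u' y')"
  shows False
proof -
  obtain u1 where u1: "antipodal u' u1" "sheet u1 y = sheet u y"
    using class_member[of u' y "sheet u y"] sheet_leaf(1)[of u y] assms by blast
  have o1: "outer u1" using outer_antipodal u1 assms by blast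
  have l1: "leaf u1 y = leaf u' y" "leaf u1 y' = leaf u' y'" using leaf_antipodal(1) u1 assms by blast+
  have "u \<noteq> u1" using u1 assms antipodal_sym by blast
  then have ne: "sheet u y' \<noteq> sheet u1 y'" using shared_leaf_sheets[of u u1 y y'] o1 l1 u1 assms by simp
  have "d u u1 \<le> 2"
    using dist_common_nb[of "copy (sheet u y) (leaf u y)" u u1] sheet_leaf(4)[of u y] sheet_leaf(4)[of u1 y]
      o1 l1 u1 assms adj_sym by simp
  moreover have z2: "d u (copy (sheet u y') z) \<le> 2"
    using dist_common_nb[of "copy (sheet u y') (leaf u y')" u "copy (sheet u y') z"] sheet_leaf[of u y']
      copy_adj[of "leaf u y'" z "sheet u y'"] assms adj_sym by simp
  moreover have "d u1 (copy (sheet u1 y') z) \<le> 2"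
    using dist_common_nb[of "copy (sheet u1 y') (leaf u1 y')" u1 "copy (sheet u1 y') z"] sheet_leaf[of u1 y']
      copy_adj[of "leaf u1 y'" z "sheet u1 y'"] o1 l1 assms adj_sym by simp
  ultimately have le: "d u (copy (sheet u1 y') z) \<le> 4"
    using dist_triangle[of u "copy (sheet u1 y') z" u1] by simp
  have "copy (sheet u y') z = copy (sheet u1 y') z"
    using antipodal_eqI[of "copy (sheet u y') z" "copy (sheet u1 y') z" u 2 4] z2 le
      antipodal_copies[of z "sheet u y'" "sheet u1 y'"] sheet_leaf(1)[of u y'] sheet_leaf(1)[of u1 y']
      dist_sym[of u "copy (sheet u y') z"] dist_sym[of u "copy (sheet u1 y') z"] o1 assms by simp
  then show False using copy_eqD(2)[of "sheet u y'" z "sheet u1 y'" z] ne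
      sheet_leaf(1)[of u y'] sheet_leaf(1)[of u1 y'] o1 assms by simp
qed

lemma leaf_parent:
  assumes "d (W 0) v = 3" obtains z where "d (W 0) z = 2" "adj z v"
  using dist_pred[of "W 0" v 2] assms by auto

lemma shared_leaves_antipodal:
  assumes "outer u" "outer u'" "adj (W 0) y" "adj (W 0) y'" "y \<noteq> y'"
    and "leaf u y = leaf u' y" "leaf u y' = leaf u' y'"
  shows "antipodal u u'"
  using shared_leaf_parent[of u u' y y'] leaf_parent[of "leaf u y'"] sheet_leaf(2)[of u y'] assms by metis

text \<open>The shared leaves would form a hexagon in the quotient. Choosing \<open>u1\<close> and
  \<open>u2\<close> in their classes so that the sheets match gives a path
  \<open>u, m, u1, m', u2\<close>. It closes at \<open>n\<close>, because \<open>n\<close> and its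
  copy next to \<open>u2\<close> are at distances at most 1 and 5 from \<open>u\<close>.\<close>

lemma no_triangle:
  assumes o: "outer u" "outer u'" "outer u''"
    and na: "\<not> antipodal u u'" "\<not> antipodal u' u''"
    and y: "adj (W 0) y" "adj (W 0) y'" "adj (W 0) y''" "y \<noteq> y'" "y' \<noteq> y''" "y'' \<noteq> y"
    and l: "leaf u y = leaf u' y" "leaf u' y' = leaf u'' y'" "leaf u'' y'' = leaf u y''"
  shows False
proof -
  obtain u1 where u1: "antipodal u' u1" "sheet u1 y = sheet u y"
    using class_member[of u' y "sheet u y"] sheet_leaf(1)[of u y] o y by blast
  have o1: "outer u1" using outer_antipodal u1 o by blast
  obtain u2 where u2: "antipodal u'' u2" "sheet u2 y' = sheet u1 y'"
    using class_member[of u'' y' "sheet u1 y'"] sheet_leaf(1)[of u1 y'] o o1 y by blast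
  have o2: "outer u2" using outer_antipodal u2 o by blast
  have l1: "leaf u1 a = leaf u' a" and l2: "leaf u2 a = leaf u'' a" if "adj (W 0) a" for a
    using leaf_antipodal(1) u1 u2 o that by blast+
  define m where "m = copy (sheet u y) (leaf u y)"
  define m' where "m' = copy (sheet u1 y') (leaf u1 y')"
  have adjm: "adj m u" "adj m u1" "adj m' u1" "adj m' u2"
    using sheet_leaf(4)[of u y] sheet_leaf(4)[of u1 y] sheet_leaf(4)[of u1 y'] sheet_leaf(4)[of u2 y']
      o o1 o2 y l l1 l2 u1 u2 adj_sym unfolding m_def m'_def by auto
  define n where "n = copy (sheet u y'') (leaf u y'')"
  have n: "adj n u" using sheet_leaf(4)[of u y''] o y adj_sym unfolding n_def by blast
  let ?n' = "copy (sheet u2 y'') (leaf u y'')"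
  have n': "adj ?n' u2" using sheet_leaf(4)[of u2 y''] o2 y l2[of y''] l adj_sym by simp
  have "d u u2 \<le> 4"
    using dist_triangle[of u u2 u1] dist_common_nb[OF adjm(1,2)] dist_common_nb[OF adjm(3,4)] by simp
  moreover have "d u2 ?n' = 1" "d u n = 1" using n n' dist_1_iff adj_sym by blast+
  ultimately have "d u ?n' \<le> 5" using dist_triangle[of u ?n' u2] by simp
  then have "n = ?n'"
    using antipodal_eqI[of n ?n' u 1 5] antipodal_copies[of "leaf u y''" "sheet u y''" "sheet u2 y''"]
      \<open>d u n = 1\<close> sheet_leaf[of u y''] sheet_leaf(1)[of u2 y''] dist_sym[of u n] dist_sym[of u ?n'] o o2 y
    unfolding n_def by simp
  then have n2: "adj n u2" using n' by simp
  have leaf_ne: "leaf w a \<noteq> leaf w' b" if "outer w" "outer w'" "adj (W 0) a" "adj (W 0) b" "a \<noteq> b" for w w' a b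
    using branch_unique[of "leaf w a" a b] sheet_leaf[of w a] sheet_leaf[of w' b] that by auto
  have in3: "d (W 0) (leaf w a) \<le> 3" "sheet w a < 3" if "outer w" "adj (W 0) a" for w a
    using sheet_leaf[of w a] that by auto
  have nm: "n \<noteq> m" "n \<noteq> m'" "m \<noteq> m'"
    using copy_eqD(1)[of "sheet u y''" "leaf u y''" "sheet u y" "leaf u y"]
      copy_eqD(1)[of "sheet u y''" "leaf u y''" "sheet u1 y'" "leaf u1 y'"]
      copy_eqD(1)[of "sheet u y" "leaf u y" "sheet u1 y'" "leaf u1 y'"]
      leaf_ne o o1 y in3 unfolding n_def m_def m'_def by metis+
  have "d n u = 1" "d n u2 = 1" using n n2 dist_1_iff by blast+
  then have dm: "d n m = 2" "d n m' = 2"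
    using nb_dist[of u m n] nb_dist[of u2 m' n] adjm adj_sym nm by (auto simp: dist_0_iff)
  show False
  \<comment> \<open>Both \<open>m\<close> and \<open>m'\<close> are adjacent to \<open>u1\<close>
    and at distance 2 from \<open>n\<close>, so distance 3 would contradict
    \<open>unique_down\<close>. At distance 1, \<open>u'\<close> and \<open>u''\<close> share the
    leaf of \<open>n\<close> as well, a second common leaf.\<close>
  proof (cases "d n u1 = 3")
    case True
    then show False using unique_down[of n u1 2 m m'] dm adjm adj_sym nm by simp
  next
    case False
    then have "d n u1 = 1" using nb_dist[OF adjm(2), of n] dm by simp
    then have "adj n u1" using dist_1_iff by blast
    then have "leaf u1 y'' = leaf u y''"
      using sheet_leaf_eqI(2)[of u1 y'' "sheet u y''" "leaf u y''"] sheet_leaf[of u y''] o o1 y adj_sym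
      unfolding n_def by simp
    then have "antipodal u' u''"
      using shared_leaves_antipodal[of u' u'' y' y''] o y l l1[of y''] by simp
    then show False using na by simp
  qed
qed

text \<open>\<open>b_3 = 2\<close>: every leaf copy has exactly two outer neighbours. The partners
  over the three branches become the cube edges at the class of \<open>u\<close>.\<close>

lemma leaf_partner:
  assumes "outer u" "adj (W 0) y"
  obtains u' where "outer u'" "\<not> antipodal u u'" "leaf u' y = leaf u y"
proof -
  note sl = sheet_leaf[OF assms]
  have ex: "\<exists>b. b \<noteq> u \<and> b \<in> A" if "card A = 2" for A
  proof -
    obtain a b where "A = {a, b}" "a \<noteq> b" using \<open>card A = 2\<close> unfolding card_2_iff by auto
    then show ?thesis by (cases "a = u") auto
  qed
  have "card {w. outer w \<and> adj (copy (sheet u y) (leaf u y)) w} = 2" using leaf_outer_nbs sl by simp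
  from ex[OF this] obtain u' where u': "u' \<noteq> u" "outer u'" "adj (copy (sheet u y) (leaf u y)) u'" by blast
  have "\<not> antipodal u u'" using antipodal_common_nb[of u u'] u' sl adj_sym by blast
  moreover have "leaf u' y = leaf u y"
    using sheet_leaf_eqI(2)[of u' y "sheet u y" "leaf u y"] sl assms u' adj_sym by simp
  ultimately show ?thesis using that u' by blast
qed

text \<open>Representatives of both classes in the sheet of \<open>u\<close> are neighbours of the
  same leaf copy, which has only one outer neighbour besides \<open>u\<close>.\<close>

lemma leaf_partner_unique:
  assumes "outer u" "outer u'" "outer u''" "adj (W 0) y" "leaf u' y = leaf u y" "leaf u'' y = leaf u y"
    and "\<not> antipodal u u'" "\<not> antipodal u u''"
  shows "antipodal u' u''"
proof -
  note sl = sheet_leaf[OF assms(1,4)]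
  let ?m = "copy (sheet u y) (leaf u y)" and ?s = "sheet u y"
  obtain w' where w': "antipodal u' w'" "sheet w' y = ?s" using class_member[of u' y ?s] sl assms by blast
  obtain w'' where w'': "antipodal u'' w''" "sheet w'' y = ?s" using class_member[of u'' y ?s] sl assms by blast
  have o: "outer w'" "outer w''" using outer_antipodal w' w'' assms by blast+
  have "leaf w' y = leaf u y" "leaf w'' y = leaf u y"
    using leaf_antipodal(1)[of u' y w'] leaf_antipodal(1)[of u'' y w''] w' w'' assms by auto
  then have a: "adj ?m u" "adj ?m w'" "adj ?m w''"
    using sheet_leaf(4)[of w' y] sheet_leaf(4)[of w'' y] o w' w'' sl assms adj_sym by auto
  have "card {w. outer w \<and> adj ?m w} = 2" using leaf_outer_nbs sl by simp
  then obtain a b where ab: "{w. outer w \<and> adj ?m w} = {a, b}" by (auto simp: card_2_iff)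
  have "u \<in> {a, b}" "w' \<in> {a, b}" "w'' \<in> {a, b}" using ab a o assms by blast+
  moreover have "u \<noteq> w'" "u \<noteq> w''" using w' w'' assms antipodal_sym by blast+
  ultimately have "w' = w''" by blast
  then show ?thesis using w' w'' antipodal_trans antipodal_sym by blast
qed

end

section \<open>The cube of outer classes\<close>

locale foster_branches = foster_sheets adj W
  for adj :: "'v::finite \<Rightarrow> 'v \<Rightarrow> bool" and W +
  fixes Y :: "nat \<Rightarrow> 'v"
  assumes nb_W0: "nb (W 0) = {Y 0, Y 1, Y 2}"
begin

lemma adj_Y: "i < 3 \<Longrightarrow> adj (W 0) (Y i)"
proof -
  assume "i < 3"
  then have "Y i \<in> nb (W 0)" unfolding nb_W0 by (auto simp: numeral_eq_Suc less_Suc_eq)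
  then show ?thesis by simp
qed

lemma Y_distinct: "Y 0 \<noteq> Y 1" "Y 0 \<noteq> Y 2" "Y 1 \<noteq> Y 2"
proof -
  have "card {Y 0, Y 1, Y 2} = 3" using card_nb[of "W 0"] nb_W0 by simp
  then show "Y 0 \<noteq> Y 1" "Y 0 \<noteq> Y 2" "Y 1 \<noteq> Y 2" by (auto simp: card_insert_if split: if_splits)
qed

lemma Y_eq_iff: "i < 3 \<Longrightarrow> j < 3 \<Longrightarrow> Y i = Y j \<longleftrightarrow> i = j"
  using Y_distinct by (auto simp: numeral_eq_Suc less_Suc_eq)

text \<open>The sheets met on \<open>Y 0\<close>, \<open>Y 1\<close>, \<open>Y 2\<close> are a
  permutation of 0, 1, 2. The condition says that it is a cyclic shift, that is, an even
  permutation.\<close>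

definition twist :: "'v \<Rightarrow> bool" where
  "twist u \<longleftrightarrow> sheet u (Y 1) = (sheet u (Y 0) + 1) mod 3"

lemma sheets_distinct:
  assumes "outer u"
  shows "sheet u (Y 0) \<noteq> sheet u (Y 1)" "sheet u (Y 0) \<noteq> sheet u (Y 2)" "sheet u (Y 1) \<noteq> sheet u (Y 2)"
    "sheet u (Y 0) < 3" "sheet u (Y 1) < 3" "sheet u (Y 2) < 3"
  using sheet_inj[OF assms] adj_Y Y_distinct sheet_leaf(1)[OF assms] by auto

lemma less_3_cases: "n < 3 \<Longrightarrow> n = 0 \<or> n = 1 \<or> n = (2::nat)"
  by linarith

lemma sheet_twist:
  assumes "outer u" "i < 3"
  shows "sheet u (Y i) = (sheet u (Y 0) + (if twist u then i else 2 * i)) mod 3"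
proof -
  define a b c where abc: "a = sheet u (Y 0)" "b = sheet u (Y 1)" "c = sheet u (Y 2)"
  have ne: "a \<noteq> b" "a \<noteq> c" "b \<noteq> c" "a < 3" "b < 3" "c < 3"
    using sheets_distinct[OF assms(1)] by (simp_all only: abc not_False_eq_True)
  have t: "b = (a + 1) mod 3 \<Longrightarrow> c = (a + 2) mod 3"
    by (insert ne less_3_cases[OF ne(4)] less_3_cases[OF ne(5)] less_3_cases[OF ne(6)]; elim disjE; simp)
  have f: "b \<noteq> (a + 1) mod 3 \<Longrightarrow> b = (a + 2) mod 3 \<and> c = (a + 4) mod 3"
    by (insert ne less_3_cases[OF ne(4)] less_3_cases[OF ne(5)] less_3_cases[OF ne(6)]; elim disjE; simp)
  consider "i = 0" | "i = 1" | "i = 2" using assms(2) by linarith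
  then show ?thesis
  proof cases
    case 1 then show ?thesis using ne by (simp add: abc)
  next
    case 2 then show ?thesis using f by (simp add: abc twist_def)
  next
    case 3 then show ?thesis using t f by (simp add: abc twist_def)
  qed
qed

text \<open>Antipodes meet different sheets on every branch, whereas permutations of opposite parity
  agree on some branch: \<open>arith\<close> shows that they agree on branch 1 or 2 when they differ
  on branch 0.\<close>

lemma twist_antipodal:
  assumes "outer u" "antipodal u u'" shows "twist u' = twist u"
proof (cases "u = u'")
  case False
  have o': "outer u'" using outer_antipodal assms by blast
  have ne: "sheet u' (Y i) \<noteq> sheet u (Y i)" if "i < 3" for i
    using leaf_antipodal(2)[of u "Y i" u'] assms adj_Y that False by blast
  have arith: "(a + 1) mod 3 = (b + 2) mod 3 \<or> (a + 2) mod 3 = (b + 2 * 2) mod 3"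
    if "a < 3" "b < 3" "a \<noteq> b" for a b :: nat
    by (insert that less_3_cases[OF that(1)] less_3_cases[OF that(2)]; elim disjE; simp)
  have *: False if v: "outer v" "outer v'" "twist v" "\<not> twist v'" and n: "\<And>i. i < 3 \<Longrightarrow> sheet v (Y i) \<noteq> sheet v' (Y i)" for v v'
  proof -
    have "(sheet v (Y 0) + 1) mod 3 = (sheet v' (Y 0) + 2) mod 3 \<or>
        (sheet v (Y 0) + 2) mod 3 = (sheet v' (Y 0) + 2 * 2) mod 3"
      by (rule arith) (use n[of 0] sheets_distinct(4) v in auto)
    moreover have "sheet v (Y 1) = (sheet v (Y 0) + 1) mod 3" "sheet v' (Y 1) = (sheet v' (Y 0) + 2) mod 3"
      "sheet v (Y 2) = (sheet v (Y 0) + 2) mod 3" "sheet v' (Y 2) = (sheet v' (Y 0) + 2 * 2) mod 3"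
      using sheet_twist[OF v(1), of 1] sheet_twist[OF v(1), of 2] sheet_twist[OF v(2), of 1]
        sheet_twist[OF v(2), of 2] v by simp_all
    ultimately have "sheet v (Y 1) = sheet v' (Y 1) \<or> sheet v (Y 2) = sheet v' (Y 2)" by (simp only:)
    then show False using n[of 1] n[of 2] by auto
  qed
  have "\<And>i. i < 3 \<Longrightarrow> sheet u (Y i) \<noteq> sheet u' (Y i)" using ne by metis
  then show ?thesis using *[of u u'] *[of u' u] ne o' assms(1) by blast
qed simp

text \<open>Move \<open>u'\<close> within its class until both meet the common leaf in the same
  sheet. Equal parity would then force agreement on all branches, against
  \<open>shared_leaf_sheets\<close>.\<close>

lemma twist_alternates:
  assumes "outer u" "outer u'" "\<not> antipodal u u'" "i < 3" "leaf u (Y i) = leaf u' (Y i)"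
  shows "twist u' \<longleftrightarrow> \<not> twist u"
proof (rule ccontr)
  assume "\<not> ?thesis"
  then have e: "twist u' = twist u" by blast
  obtain u1 where u1: "antipodal u' u1" "sheet u1 (Y i) = sheet u (Y i)"
    using class_member[of u' "Y i" "sheet u (Y i)"] sheet_leaf(1)[of u "Y i"] adj_Y assms by blast
  have o1: "outer u1" and t1: "twist u1 = twist u"
    using outer_antipodal[of u' u1] twist_antipodal[of u' u1] u1 e assms by auto
  have l1: "leaf u1 (Y i) = leaf u (Y i)" using leaf_antipodal(1)[of u' "Y i" u1] u1 adj_Y assms by simp
  have ne: "u \<noteq> u1" using u1 assms antipodal_sym by blast
  have arith3: "a = b" if "(a + k) mod 3 = (b + k) mod 3" "a < 3" "b < 3" "k < 3" for a b k :: nat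
    by (insert that less_3_cases[OF that(2)] less_3_cases[OF that(3)] less_3_cases[OF that(4)]; elim disjE; simp)
  have arith: "a = b" if "(a + k) mod 3 = (b + k) mod 3" "a < 3" "b < 3" for a b k :: nat
    by (rule arith3[of a "k mod 3" b]) (use that in \<open>simp_all add: mod_add_right_eq\<close>)
  define k where "k j = (if twist u then j else 2 * j)" for j :: nat
  have k: "sheet u (Y j) = (sheet u (Y 0) + k j) mod 3" "sheet u1 (Y j) = (sheet u1 (Y 0) + k j) mod 3" if "j < 3" for j
    using sheet_twist[OF assms(1) that] sheet_twist[OF o1 that] unfolding t1 k_def by simp_all
  have "(sheet u1 (Y 0) + k i) mod 3 = (sheet u (Y 0) + k i) mod 3"
    using k[OF assms(4)] u1(2) by (simp only:)
  then have 0: "sheet u1 (Y 0) = sheet u (Y 0)"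
    by (rule arith) (rule sheets_distinct(4)[OF o1] sheets_distinct(4)[OF assms(1)])+
  have all: "sheet u1 (Y j) = sheet u (Y j)" if "j < 3" for j
    using k[OF that] unfolding 0 by (simp only:)
  obtain j :: nat where j: "j < 3" "j \<noteq> i" using that[of 0] that[of 1] by (cases i) auto
  have "Y i \<noteq> Y j" using Y_eq_iff[of i j] j assms by simp
  then show False
    using shared_leaf_sheets[of u u1 "Y i" "Y j"] o1 l1 ne u1 all[OF j(1)] adj_Y j assms by simp
qed

subsection \<open>Parents of leaves\<close>

definition parent :: "'v \<Rightarrow> 'v" where
  "parent v = (THE z. d (W 0) z = 2 \<and> adj z v)"

lemma parent_eqI:
  assumes "d (W 0) v = 3" "d (W 0) z = 2" "adj z v" shows "parent v = z"
  unfolding parent_def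
proof (rule the_equality)
  fix w assume "d (W 0) w = 2 \<and> adj w v"
  then show "w = z" using unique_down[of "W 0" v 2 w z] assms adj_sym by simp
qed (use assms in simp)

lemma parent_props:
  assumes "d (W 0) v = 3" shows "d (W 0) (parent v) = 2" "adj (parent v) v"
  using leaf_parent[OF assms] parent_eqI[OF assms] by metis+

lemma parent_branch:
  assumes "d (W 0) v = 3" "adj (W 0) y" "d y v = 2" shows "adj y (parent v)"
proof -
  obtain z where z: "adj z v" "d y z = 1" using dist_pred[of y v 1] assms(3) by auto
  have y1: "d (W 0) y = 1" using assms dist_1_iff by blast
  have "d (W 0) z = 2"
    using dist_triangle[of "W 0" z y] dist_adj_le[OF z(1), of "W 0"] z y1 assms by simp
  then show ?thesis using parent_eqI[OF assms(1) _ z(1)] z dist_1_iff by metis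
qed

lemma card_2_third: "card A = 2 \<Longrightarrow> a \<in> A \<Longrightarrow> b \<in> A \<Longrightarrow> c \<in> A \<Longrightarrow> a \<noteq> b \<Longrightarrow> c \<noteq> b \<Longrightarrow> a = c"
  by (auto simp: card_2_iff)

lemma card_up: "d u v = n \<Longrightarrow> card {z. adj v z \<and> d u z = Suc n} = up_number n"
  using up[of v u] by (simp only:)

text \<open>\<open>b_1 = 2\<close>: a branch has only two candidates for a parent, so two of them
  that differ from a third agree. In the same way \<open>b_2 = 2\<close> yields
  \<open>leaf_third\<close>.\<close>

lemma parent_third:
  assumes "adj (W 0) y" "outer u" "outer v" "outer w"
    and "parent (leaf u y) \<noteq> parent (leaf v y)" "parent (leaf w y) \<noteq> parent (leaf v y)"
  shows "parent (leaf u y) = parent (leaf w y)"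
proof -
  have "d (W 0) y = 1" using assms dist_1_iff by blast
  then have "card {z. adj y z \<and> d (W 0) z = 2} = 2" 
    using card_up[of "W 0" y 1] by (simp add: up_number_def numeral_2_eq_2)
  moreover have "parent (leaf a y) \<in> {z. adj y z \<and> d (W 0) z = 2}" if "outer a" for a
    using parent_props(1)[of "leaf a y"] parent_branch[of "leaf a y" y] sheet_leaf(2,3)[OF that assms(1)] assms(1)
    by simp
  ultimately show ?thesis using card_2_third[of _ "parent (leaf u y)" "parent (leaf v y)"] assms by blast
qed

lemma leaf_third:
  assumes "adj (W 0) y" "outer u" "outer v" "outer w" "leaf u y \<noteq> leaf v y" "leaf w y \<noteq> leaf v y"
    and "parent (leaf u y) = parent (leaf v y)" "parent (leaf w y) = parent (leaf v y)"
  shows "leaf u y = leaf w y"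
proof -
  let ?z = "parent (leaf v y)"
  have "d (W 0) ?z = 2" using parent_props sheet_leaf assms by simp
  then have "card {l. adj ?z l \<and> d (W 0) l = 3} = 2" 
    using card_up[of "W 0" ?z 2] by (simp add: up_number_def)
  moreover have "leaf u y \<in> {l. adj ?z l \<and> d (W 0) l = 3}" "leaf v y \<in> {l. adj ?z l \<and> d (W 0) l = 3}"
    "leaf w y \<in> {l. adj ?z l \<and> d (W 0) l = 3}"
    using parent_props(2)[of "leaf u y"] parent_props(2)[of "leaf v y"] parent_props(2)[of "leaf w y"]
      sheet_leaf(2)[of u y] sheet_leaf(2)[of v y] sheet_leaf(2)[of w y] assms by auto
  ultimately show ?thesis using card_2_third[of _ "leaf u y" "leaf v y"] assms by blast
qed

lemma partner_parent:
  assumes "outer u" "outer u'" "\<not> antipodal u u'" "adj (W 0) y" "adj (W 0) y'" "y \<noteq> y'" "leaf u y = leaf u' y"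
  shows "parent (leaf u y') \<noteq> parent (leaf u' y')"
proof
  assume e: "parent (leaf u y') = parent (leaf u' y')"
  show False
    using shared_leaf_parent[OF assms, of "parent (leaf u y')"] parent_props[of "leaf u y'"]
      parent_props[of "leaf u' y'"] sheet_leaf(2)[of u y'] sheet_leaf(2)[of u' y'] e assms by simp
qed

text \<open>A face of the cube: crossing direction \<open>j\<close> and afterwards \<open>i\<close>
  ends at a partner of \<open>qi\<close> in direction \<open>j\<close>. On branch \<open>yj\<close>
  the leaves of \<open>r\<close>, \<open>qi\<close> and \<open>qk\<close> have the same parent, and
  that of \<open>qk\<close> differs from the other two, so those coincide. The information about
  branch \<open>yk\<close> is kept for \<open>opposite\<close>.\<close>

lemma square:
  assumes y: "adj (W 0) yi" "adj (W 0) yj" "adj (W 0) yk" "yi \<noteq> yj" "yj \<noteq> yk" "yk \<noteq> yi"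
    and o: "outer p" "outer qi" "outer qj" "outer qk" "outer r"
    and na: "\<not> antipodal p qi" "\<not> antipodal p qj" "\<not> antipodal p qk" "\<not> antipodal qj r"
    and l: "leaf qi yi = leaf p yi" "leaf qj yj = leaf p yj" "leaf qk yk = leaf p yk" "leaf r yi = leaf qj yi"
  shows "leaf r yk \<noteq> leaf p yk" "parent (leaf r yk) = parent (leaf p yk)" "leaf r yj = leaf qi yj"
proof -
  note pp = partner_parent
  have pq: "parent (leaf p a) \<noteq> parent (leaf qi a)" if "a = yj \<or> a = yk" for a
    using pp[of p qi yi a] that y o na l by auto
  have pj: "parent (leaf p a) \<noteq> parent (leaf qj a)" if "a = yi \<or> a = yk" for a
    using pp[of p qj yj a] that y o na l by auto
  have pk: "parent (leaf p a) \<noteq> parent (leaf qk a)" if "a = yi \<or> a = yj" for a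
    using pp[of p qk yk a] that y o na l by auto
  have rj: "parent (leaf qj a) \<noteq> parent (leaf r a)" if "a = yj \<or> a = yk" for a
    using pp[of qj r yi a] that y o na l by auto
  show 2: "parent (leaf r yk) = parent (leaf p yk)"
    using parent_third[of yk r qj p] rj[of yk] pj[of yk] y o by simp
  have napr: "\<not> antipodal p r"
  proof
    assume "antipodal p r"
    then have "leaf r yi = leaf p yi" using leaf_antipodal(1) o y by blast
    then show False using pj[of yi] l by simp
  qed
  show 1: "leaf r yk \<noteq> leaf p yk"
    using no_triangle[of p qj r yj yi yk] o na y l by auto
  have rq: "parent (leaf r yj) = parent (leaf qi yj)"
    using parent_third[of yj r p qi] rj[of yj] pq[of yj] l y o by simp
  have kq: "parent (leaf qk yj) = parent (leaf qi yj)"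
    using parent_third[of yj qk p qi] pk[of yj] pq[of yj] y o by simp
  have naqk: "\<not> antipodal qi qk"
  proof
    assume "antipodal qi qk"
    then have "leaf qk yi = leaf qi yi" using leaf_antipodal(1) o y by blast
    then show False using pk[of yi] l by simp
  qed
  have c1: "leaf qk yj \<noteq> leaf qi yj"
    using no_triangle[of p qi qk yi yj yk] o na naqk y l by auto
  have c2: "leaf qk yj \<noteq> leaf r yj"
  proof
    assume e: "leaf qk yj = leaf r yj"
    show False
    proof (cases "antipodal qk r")
      case True
      then have "leaf r yk = leaf qk yk" using leaf_antipodal(1) o y by blast
      then show False using 1 l by simp
    next
      case False
      then show False using pp[of qk r yj yk] e 2 l y o by simp
    qed
  qed
  show "leaf r yj = leaf qi yj"
    by (rule leaf_third[OF y(2) o(5) o(4) o(2) c2[symmetric] c1[symmetric] trans[OF rq kq[symmetric]] kq[symmetric]])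
qed

text \<open>Closes the cube at its last corner \<open>t\<close>. On branch \<open>yj\<close> the
  leaves of \<open>t\<close> and of \<open>rj\<close> both have the parent of the leaf of
  \<open>p\<close> without being that leaf, and a parent has only two leaves.\<close>

lemma opposite:
  assumes y: "adj (W 0) yi" "adj (W 0) yj" "yi \<noteq> yj"
    and o: "outer p" "outer qj" "outer qk" "outer ri" "outer rj" "outer t"
    and na: "\<not> antipodal p qj" "\<not> antipodal p qk" "\<not> antipodal ri t"
    and l: "leaf qj yj = leaf p yj" "leaf ri yj = leaf qk yj" "leaf t yi = leaf ri yi"
    and ri: "leaf ri yi \<noteq> leaf p yi" "parent (leaf ri yi) = parent (leaf p yi)"
    and rj: "leaf rj yj \<noteq> leaf p yj" "parent (leaf rj yj) = parent (leaf p yj)"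
    and qk: "parent (leaf qk yj) \<noteq> parent (leaf p yj)"
  shows "leaf t yj = leaf rj yj"
proof -
  have "parent (leaf ri yj) \<noteq> parent (leaf t yj)"
    using partner_parent[of ri t yi yj] y o na l by simp
  then have tp: "parent (leaf t yj) = parent (leaf p yj)"
    using parent_third[of yj t qk p] qk l y o by auto
  have ne: "leaf t yj \<noteq> leaf p yj"
  proof
    assume e: "leaf t yj = leaf p yj"
    have "\<not> antipodal p t"
    proof
      assume "antipodal p t"
      then have "leaf t yi = leaf p yi" using leaf_antipodal(1) o y by blast
      then show False using l ri by simp
    qed
    then have "antipodal t qj" using leaf_partner_unique[of p t qj yj] e l y o na by simp
    then have "leaf qj yi = leaf t yi" using leaf_antipodal(1) o y by blast
    moreover have "parent (leaf p yi) \<noteq> parent (leaf qj yi)"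
      using partner_parent[of p qj yj yi] y o na l by simp
    ultimately show False using l ri by simp
  qed
  show ?thesis by (rule leaf_third[OF y(2) o(6,1,5) ne rj(1) tp rj(2)])
qed

end

text \<open>The corners \<open>p a b c\<close> represent the eight outer classes. An edge in
  direction \<open>i\<close> is the leaf \<open>l i u v\<close>, where \<open>u\<close>,
  \<open>v\<close> are the two coordinates that stay fixed. Parallel edges diagonally opposite in
  the cube have the same parent.\<close>

locale foster_cube = foster_branches adj W Y
  for adj :: "'v::finite \<Rightarrow> 'v \<Rightarrow> bool" and W Y +
  fixes p l :: "nat \<Rightarrow> nat \<Rightarrow> nat \<Rightarrow> 'v"
  assumes outer_p: "outer (p a b c)"
    and leaf_p: "leaf (p a b c) (Y 0) = l 0 b c" "leaf (p a b c) (Y 1) = l 1 a c" "leaf (p a b c) (Y 2) = l 2 a b"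
    and twist_p: "a < 2 \<Longrightarrow> b < 2 \<Longrightarrow> c < 2 \<Longrightarrow> twist (p a b c) \<longleftrightarrow> even (a + b + c)"
    and parent_l: "i < 3 \<Longrightarrow> parent (l i 1 1) = parent (l i 0 0)" "i < 3 \<Longrightarrow> parent (l i 0 1) = parent (l i 1 0)"
      "i < 3 \<Longrightarrow> parent (l i 1 0) \<noteq> parent (l i 0 0)"
    and l_distinct: "i < 3 \<Longrightarrow> l i 1 1 \<noteq> l i 0 0" "i < 3 \<Longrightarrow> l i 0 1 \<noteq> l i 1 0"

context foster_branches
begin

text \<open>On the third branch both partners lie below the parent that \<open>p\<close> avoids, and
  \<open>no_triangle\<close> keeps their leaves apart.\<close>

lemma partners_differ:
  assumes y: "adj (W 0) yi" "adj (W 0) yj" "adj (W 0) yk" "yi \<noteq> yj" "yj \<noteq> yk" "yk \<noteq> yi"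
    and o: "outer p" "outer qi" "outer qj" and na: "\<not> antipodal p qi" "\<not> antipodal p qj"
    and l: "leaf qi yi = leaf p yi" "leaf qj yj = leaf p yj"
  shows "leaf qi yk \<noteq> leaf qj yk" "parent (leaf qi yk) = parent (leaf qj yk)"
    "parent (leaf qi yk) \<noteq> parent (leaf p yk)"
proof -
  have i: "parent (leaf p a) \<noteq> parent (leaf qi a)" if "adj (W 0) a" "yi \<noteq> a" for a
    by (rule partner_parent[OF o(1,2) na(1) y(1) that l(1)[symmetric]])
  have j: "parent (leaf p a) \<noteq> parent (leaf qj a)" if "adj (W 0) a" "yj \<noteq> a" for a
    by (rule partner_parent[OF o(1,3) na(2) y(2) that l(2)[symmetric]])
  have "\<not> antipodal qj qi"
  proof
    assume "antipodal qj qi"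
    then have "leaf qi yj = leaf qj yj" using leaf_antipodal(1)[OF o(3) y(2)] by blast
    then show False using i[OF y(2,4)] l(2) by simp
  qed
  then show "leaf qi yk \<noteq> leaf qj yk"
    using no_triangle[OF o(1,3,2) na(2) _ y(2,3,1,5,6,4) l(2)[symmetric] _ l(1)] by (metis (no_types))
  show "parent (leaf qi yk) \<noteq> parent (leaf p yk)" using i[OF y(3) y(6)[symmetric]] by (rule not_sym)
  then show "parent (leaf qi yk) = parent (leaf qj yk)"
    by (rule parent_third[OF y(3) o(2,1,3)]) (rule not_sym[OF j[OF y(3,5)]])
qed

lemma ex_twisted: "\<exists>u. outer u \<and> twist u"
proof -
  have "card {u. outer u} = 24" using card_sphere(3)[of "W 0"] by (simp add: outer_def)
  then have "{u. outer u} \<noteq> {}" by (metis card.empty zero_neq_numeral)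
  then obtain u where u: "outer u" by blast
  have y: "adj (W 0) (Y 0)" by (rule adj_Y) simp
  obtain u' where u': "outer u'" "\<not> antipodal u u'" "leaf u' (Y 0) = leaf u (Y 0)"
    by (rule leaf_partner[OF u y])
  have "twist u' \<longleftrightarrow> \<not> twist u"
    by (rule twist_alternates[OF u u'(1,2) _ u'(3)[symmetric]]) simp
  then show ?thesis using u u' by blast
qed

lemma ex_cube: "\<exists>p l. foster_cube adj W Y p l"
proof -
  have y0: "adj (W 0) (Y 0)" and y1: "adj (W 0) (Y 1)" and y2: "adj (W 0) (Y 2)" by (rule adj_Y; simp)+
  note n = Y_distinct
  note n' = Y_distinct[THEN not_sym]
  \<comment> \<open>\<open>p\<close> is the corner 000, \<open>qi\<close> differs from it in
    coordinate \<open>i\<close> only, \<open>ri\<close> agrees with it in coordinate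
    \<open>i\<close> only, and \<open>t\<close> is 111. A twisted vertex at 000 matches the parity
    convention of the locale.\<close>
  obtain p where p: "outer p" "twist p" using ex_twisted by blast
  obtain q0 where q0: "outer q0" "\<not> antipodal p q0" "leaf q0 (Y 0) = leaf p (Y 0)" by (rule leaf_partner[OF p(1) y0])
  obtain q1 where q1: "outer q1" "\<not> antipodal p q1" "leaf q1 (Y 1) = leaf p (Y 1)" by (rule leaf_partner[OF p(1) y1])
  obtain q2 where q2: "outer q2" "\<not> antipodal p q2" "leaf q2 (Y 2) = leaf p (Y 2)" by (rule leaf_partner[OF p(1) y2])
  obtain r2 where r2: "outer r2" "\<not> antipodal q1 r2" "leaf r2 (Y 0) = leaf q1 (Y 0)" by (rule leaf_partner[OF q1(1) y0])
  obtain r1 where r1: "outer r1" "\<not> antipodal q2 r1" "leaf r1 (Y 0) = leaf q2 (Y 0)" by (rule leaf_partner[OF q2(1) y0])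
  obtain r0 where r0: "outer r0" "\<not> antipodal q2 r0" "leaf r0 (Y 1) = leaf q2 (Y 1)" by (rule leaf_partner[OF q2(1) y1])
  obtain t where t: "outer t" "\<not> antipodal r0 t" "leaf t (Y 0) = leaf r0 (Y 0)" by (rule leaf_partner[OF r0(1) y0])
  note s2 = square[OF y0 y1 y2 n(1,3) n'(2) p(1) q0(1) q1(1) q2(1) r2(1) q0(2) q1(2) q2(2) r2(2) q0(3) q1(3) q2(3) r2(3)]
  note s1 = square[OF y0 y2 y1 n(2) n'(3,1) p(1) q0(1) q2(1) q1(1) r1(1) q0(2) q2(2) q1(2) r1(2) q0(3) q2(3) q1(3) r1(3)]
  note s0 = square[OF y1 y2 y0 n(3) n'(2) n(1) p(1) q1(1) q2(1) q0(1) r0(1) q1(2) q2(2) q0(2) r0(2) q1(3) q2(3) q0(3) r0(3)]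
  note d0 = partners_differ[OF y1 y2 y0 n(3) n'(2) n(1) p(1) q1(1) q2(1) q1(2) q2(2) q1(3) q2(3)]
  note d1 = partners_differ[OF y0 y2 y1 n(2) n'(3,1) p(1) q0(1) q2(1) q0(2) q2(2) q0(3) q2(3)]
  note d2 = partners_differ[OF y0 y1 y2 n(1,3) n'(2) p(1) q0(1) q1(1) q0(2) q1(2) q0(3) q1(3)]
  have t1: "leaf t (Y 1) = leaf r1 (Y 1)"
    by (rule opposite[OF y0 y1 n(1) p(1) q1(1) q2(1) r0(1) r1(1) t(1) q1(2) q2(2) t(2) q1(3) r0(3) t(3) s0(1,2) s1(1,2)])
      (use d1(2,3) in \<open>simp only: not_False_eq_True\<close>)
  have t2: "leaf t (Y 2) = leaf r2 (Y 2)"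
    by (rule opposite[OF y0 y2 n(2) p(1) q2(1) q1(1) r0(1) r2(1) t(1) q2(2) q1(2) t(2) q2(3) s0(3) t(3) s0(1,2) s2(1,2)])
      (use d2(2,3) in \<open>simp only: not_False_eq_True\<close>)
  have tq: "\<not> twist q0" "\<not> twist q1" "\<not> twist q2"
    using twist_alternates[OF p(1) q0(1,2) _ q0(3)[symmetric]] twist_alternates[OF p(1) q1(1,2) _ q1(3)[symmetric]]
      twist_alternates[OF p(1) q2(1,2) _ q2(3)[symmetric]] p(2) by simp_all
  have tr: "twist r0" "twist r1" "twist r2"
    using twist_alternates[OF q2(1) r0(1,2) _ r0(3)[symmetric]] twist_alternates[OF q2(1) r1(1,2) _ r1(3)[symmetric]]
      twist_alternates[OF q1(1) r2(1,2) _ r2(3)[symmetric]] tq by simp_all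
  have tt: "\<not> twist t" using twist_alternates[OF r0(1) t(1,2) _ t(3)[symmetric]] tr by simp
  define P where "P a b c = (if a = 0 then if b = 0 then if c = 0 then p else q2 else if c = 0 then q1 else r0
    else if b = 0 then if c = 0 then q0 else r1 else if c = 0 then r2 else t)" for a b c :: nat
  define l0 where "l0 u v = (if u = 0 then if v = 0 then leaf p (Y 0) else leaf q2 (Y 0)
    else if v = 0 then leaf q1 (Y 0) else leaf r0 (Y 0))" for u v :: nat
  define l1 where "l1 u v = (if u = 0 then if v = 0 then leaf p (Y 1) else leaf q2 (Y 1)
    else if v = 0 then leaf q0 (Y 1) else leaf r1 (Y 1))" for u v :: nat
  define l2 where "l2 u v = (if u = 0 then if v = 0 then leaf p (Y 2) else leaf q1 (Y 2)
    else if v = 0 then leaf q0 (Y 2) else leaf r2 (Y 2))" for u v :: nat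
  define l where "l i = (if i = 0 then l0 else if i = 1 then l1 else l2)" for i :: nat
  have "foster_cube adj W Y P l"
  proof
    fix a b c :: nat
    show "outer (P a b c)" using p q0 q1 q2 r0 r1 r2 t by (simp only: P_def split: if_split) blast
    show "leaf (P a b c) (Y 0) = l 0 b c"
      by (cases "a = 0"; cases "b = 0"; cases "c = 0")
        (simp_all only: P_def l_def l0_def if_True if_False refl q0(3) r1(3) r2(3) t(3))
    show "leaf (P a b c) (Y 1) = l 1 a c"
      by (cases "a = 0"; cases "b = 0"; cases "c = 0")
        (simp_all only: P_def l_def l1_def if_True if_False one_neq_zero refl q1(3) r0(3) s2(3) t1)
    show "leaf (P a b c) (Y 2) = l 2 a b"
      by (cases "a = 0"; cases "b = 0"; cases "c = 0")
        (simp_all only: P_def l_def l2_def if_True if_False zero_neq_numeral[symmetric] numeral_eq_one_iff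
          semiring_norm refl q2(3) s1(3) s0(3) t2)
    show "twist (P a b c) \<longleftrightarrow> even (a + b + c)" if "a < 2" "b < 2" "c < 2"
    proof -
      have "a = 0 \<or> a = 1" "b = 0 \<or> b = 1" "c = 0 \<or> c = 1" using that by linarith+
      then show ?thesis using p(2) tq tr tt by (elim disjE) (simp_all add: P_def)
    qed
  next
    fix i :: nat assume "i < 3"
    then consider "i = 0" | "i = 1" | "i = 2" by linarith
    note i = this
    have l012: "l 0 = l0" "l (Suc 0) = l1" "l 2 = l2" by (simp_all add: l_def)
    note defs = l012 l0_def l1_def l2_def
    show "parent (l i 1 1) = parent (l i 0 0)"
      by (rule i) (simp_all add: defs s0(2) s1(2)[unfolded One_nat_def] s2(2))
    show "parent (l i 0 1) = parent (l i 1 0)"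
      by (rule i) (simp_all add: defs d0(2) d1(2)[unfolded One_nat_def] d2(2))
    show "parent (l i 1 0) \<noteq> parent (l i 0 0)"
      by (rule i) (simp_all add: defs d0(3) d1(3)[unfolded One_nat_def] d2(3))
    show "l i 1 1 \<noteq> l i 0 0"
      by (rule i) (simp_all add: defs s0(1) s1(1)[unfolded One_nat_def] s2(1))
    show "l i 0 1 \<noteq> l i 1 0"
      by (rule i) (simp_all add: defs d0(1)[THEN not_sym] d1(1)[THEN not_sym, unfolded One_nat_def] d2(1)[THEN not_sym])
  qed
  then show ?thesis by blast
qed

end

section \<open>The labelled Foster graph\<close>

text \<open>The vertices are numbered level by level, starting with the base vertex; the order within each
  level is one for which the seed vectors of the theorem work.\<close>

definition foster_nbs :: "nat list list" where
  "foster_nbs = [[1, 2, 3], [0, 4, 5], [0, 6, 7], [0, 8, 9], [1, 10, 11], [1, 12, 13], [2, 21, 20],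
   [2, 19, 18], [3, 14, 15], [3, 16, 17], [4, 22, 23], [4, 25, 24], [5, 26, 27], [5, 29, 28],
   [8, 30, 31], [8, 33, 32], [9, 34, 35], [9, 36, 37], [7, 39, 38], [7, 40, 41], [6, 43, 42],
   [6, 45, 44], [10, 54, 63], [10, 59, 67], [11, 57, 65], [11, 61, 68], [12, 55, 69],
   [12, 58, 64], [13, 56, 66], [13, 60, 62], [47, 55, 14], [53, 61, 14], [48, 56, 15],
   [51, 59, 15], [46, 58, 16], [52, 57, 16], [50, 54, 17], [49, 60, 17], [48, 18, 69],
   [52, 18, 63], [47, 19, 66], [50, 19, 65], [49, 20, 64], [53, 20, 67], [51, 21, 68],
   [46, 21, 62], [76, 45, 34], [70, 30, 40], [76, 38, 32], [70, 37, 42], [77, 36, 41],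
   [71, 44, 33], [71, 39, 35], [77, 31, 43], [72, 22, 36], [78, 30, 26], [72, 28, 32],
   [78, 35, 24], [73, 34, 27], [79, 23, 33], [79, 29, 37], [73, 31, 25], [74, 45, 29],
   [80, 22, 39], [80, 27, 42], [74, 41, 24], [81, 40, 28], [75, 23, 43], [81, 44, 25],
   [75, 26, 38], [82, 47, 49], [82, 51, 52], [83, 54, 56], [83, 58, 61], [84, 62, 65],
   [84, 67, 69], [85, 46, 48], [85, 50, 53], [86, 55, 57], [86, 59, 60], [87, 63, 64],
   [87, 66, 68], [88, 70, 71], [88, 72, 73], [88, 74, 75], [89, 76, 77], [89, 78, 79],
   [89, 80, 81], [82, 83, 84], [85, 86, 87]]"

context foster_cube
begin

definition X :: "nat \<Rightarrow> 'v" where "X s = W s"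
definition Yv :: "nat \<Rightarrow> nat \<Rightarrow> 'v" where "Yv i s = copy s (Y i)"
definition Zv :: "nat \<Rightarrow> nat \<Rightarrow> nat \<Rightarrow> 'v" where "Zv i a s = copy s (parent (l i a 0))"
definition Lv :: "nat \<Rightarrow> nat \<Rightarrow> nat \<Rightarrow> nat \<Rightarrow> 'v" where "Lv i u v s = copy s (l i u v)"
text \<open>The members of an outer class are told apart by the sheet in which they meet branch 0;
  \<open>class_member\<close> supplies one for each sheet.\<close>

definition Pv :: "nat \<Rightarrow> nat \<Rightarrow> nat \<Rightarrow> nat \<Rightarrow> 'v" where
  "Pv a b c s = (SOME u. antipodal (p a b c) u \<and> sheet u (Y 0) = s)"

text \<open>The increment modulo 3 of the sheet from one branch to the next: such a vertex meets
  branches 0, 1, 2 in sheets \<open>s\<close>, \<open>s + e\<close>,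
  \<open>s + 2 * e\<close>.\<close>

definition twist_step :: "nat \<Rightarrow> nat \<Rightarrow> nat \<Rightarrow> nat" where
  "twist_step a b c = (if even (a + b + c) then 1 else 2)"

lemma l_is_leaf:
  assumes "i < 3" shows "d (W 0) (l i u v) = 3" "d (Y i) (l i u v) = 2"
proof -
  have "\<exists>w. outer w \<and> l i u v = leaf w (Y i)"
    using less_3_cases[OF assms] outer_p leaf_p(1)[of 0 u v] leaf_p(2)[of u 0 v] leaf_p(3)[of u v 0] by metis
  then show "d (W 0) (l i u v) = 3" "d (Y i) (l i u v) = 2"
    using sheet_leaf(2,3) adj_Y[OF assms] by auto
qed

lemma parent_l_level: "i < 3 \<Longrightarrow> d (W 0) (parent (l i u v)) = 2"
  by (rule parent_props(1)[OF l_is_leaf(1)])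

lemma dist_Y: "i < 3 \<Longrightarrow> d (W 0) (Y i) = 1"
  using adj_Y dist_1_iff by blast

lemma nb_eqI:
  assumes "adj v a" "adj v b" "adj v c" "a \<noteq> b" "a \<noteq> c" "b \<noteq> c"
  shows "nb v = {a, b, c}"
proof -
  have "{a, b, c} \<subseteq> nb v" using assms by auto
  moreover have "card {a, b, c} = card (nb v)" using assms card_nb by auto
  ultimately show ?thesis using card_subset_eq[OF finite] by metis
qed

lemma copy_nb:
  assumes "nb v = {a, b, c}" "d (W 0) v \<le> 2" "s < 3"
  shows "nb (copy s v) = {copy s a, copy s b, copy s c}"
  using nb_copy[OF assms(2,3)] assms(1) by simp

lemma nb_X: "s < 3 \<Longrightarrow> nb (X s) = {Yv 0 s, Yv 1 s, Yv 2 s}"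
proof -
  assume s: "s < 3"
  have "copy s (W 0) = W s" using antipodal_W[of 0 s] s by (intro copy_eqI) auto
  then show ?thesis using copy_nb[OF nb_W0 _ s] by (simp add: X_def Yv_def)
qed

lemma nb_Yv:
  assumes "i < 3" "s < 3" shows "nb (Yv i s) = {X s, Zv i 0 s, Zv i 1 s}"
proof -
  have W: "copy s (W 0) = W s" using antipodal_W[of 0 s] assms by (intro copy_eqI) auto
  have "W 0 \<noteq> parent (l i u v)" for u v using parent_l_level[OF assms(1), of u v] by (metis dist_refl zero_neq_numeral)
  then have "nb (Y i) = {W 0, parent (l i 0 0), parent (l i 1 0)}"
    using parent_branch[OF l_is_leaf(1)[OF assms(1)] adj_Y[OF assms(1)] l_is_leaf(2)[OF assms(1)]]
      adj_sym[OF adj_Y[OF assms(1)]] parent_l(3)[OF assms(1)] by (intro nb_eqI) (auto dest: not_sym)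
  from copy_nb[OF this _ assms(2)] show ?thesis using dist_Y assms W by (simp add: X_def Yv_def Zv_def)
qed

lemma nb_Zv:
  assumes "i < 3" "s < 3"
  shows "nb (Zv i 0 s) = {Yv i s, Lv i 0 0 s, Lv i 1 1 s}" "nb (Zv i 1 s) = {Yv i s, Lv i 1 0 s, Lv i 0 1 s}"
proof -
  have ne: "Y i \<noteq> l i u v" for u v using dist_Y[OF assms(1)] l_is_leaf(1)[OF assms(1), of u v] by auto
  have Y: "adj (parent (l i u v)) (Y i)" for u v
    using parent_branch[OF l_is_leaf(1)[OF assms(1)] adj_Y[OF assms(1)] l_is_leaf(2)[OF assms(1)]] adj_sym by blast
  have a: "adj (parent (l i u v)) (l i u v)" for u v by (rule parent_props(2)[OF l_is_leaf(1)[OF assms(1)]])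
  have 0: "nb (parent (l i 0 0)) = {Y i, l i 0 0, l i 1 1}"
    using ne Y[of 0 0] a[of 0 0] a[of 1 1] parent_l(1)[OF assms(1)] l_distinct(1)[OF assms(1)]
    by (intro nb_eqI) (auto dest: not_sym)
  have 1: "nb (parent (l i 1 0)) = {Y i, l i 1 0, l i 0 1}"
    using ne Y[of 1 0] a[of 1 0] a[of 0 1] parent_l(2)[OF assms(1)] l_distinct(2)[OF assms(1)]
    by (intro nb_eqI) (auto dest: not_sym)
  show "nb (Zv i 0 s) = {Yv i s, Lv i 0 0 s, Lv i 1 1 s}" "nb (Zv i 1 s) = {Yv i s, Lv i 1 0 s, Lv i 0 1 s}"
    using copy_nb[OF 0 _ assms(2)] copy_nb[OF 1 _ assms(2)] parent_l_level[OF assms(1)]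
    by (simp_all add: Yv_def Zv_def Lv_def)
qed

lemma Pv_props:
  assumes "s < 3"
  shows "antipodal (p a b c) (Pv a b c s)" "sheet (Pv a b c s) (Y 0) = s" "outer (Pv a b c s)"
proof -
  obtain u where "antipodal (p a b c) u" "sheet u (Y 0) = s"
    by (rule class_member[OF outer_p adj_Y assms, of 0 a b c]) auto
  then have *: "antipodal (p a b c) (Pv a b c s) \<and> sheet (Pv a b c s) (Y 0) = s"
    unfolding Pv_def by (intro someI[where P = "\<lambda>u. antipodal (p a b c) u \<and> sheet u (Y 0) = s"] conjI)
  then show "antipodal (p a b c) (Pv a b c s)" "sheet (Pv a b c s) (Y 0) = s" by auto
  show "outer (Pv a b c s)" using * outer_antipodal[OF outer_p] by blast
qed

lemma adj_Pv:
  assumes "a < 2" "b < 2" "c < 2" "s < 3"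
  shows "adj (Pv a b c s) (Lv 0 b c s)" "adj (Pv a b c s) (Lv 1 a c ((s + twist_step a b c) mod 3))"
    "adj (Pv a b c s) (Lv 2 a b ((s + 2 * twist_step a b c) mod 3))"
proof -
  note P = Pv_props[OF assms(4), of a b c]
  have t: "twist (Pv a b c s) \<longleftrightarrow> even (a + b + c)"
    using twist_antipodal[OF outer_p P(1)] twist_p[OF assms(1-3)] by simp
  have sh: "sheet (Pv a b c s) (Y i) = (s + i * twist_step a b c) mod 3" if "i < 3" for i
    using sheet_twist[OF P(3) that] unfolding t P(2) twist_step_def by (simp add: mult.commute)
  have lf: "leaf (Pv a b c s) (Y i) = leaf (p a b c) (Y i)" if "i < 3" for i
    by (rule leaf_antipodal(1)[OF outer_p adj_Y[OF that] P(1)])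
  have adj: "adj (Pv a b c s) (copy ((s + i * twist_step a b c) mod 3) (leaf (p a b c) (Y i)))" if "i < 3" for i
    using sheet_leaf(4)[OF P(3) adj_Y[OF that]] unfolding sh[OF that] lf[OF that] .
  show "adj (Pv a b c s) (Lv 0 b c s)" using adj[of 0] assms(4) by (simp add: Lv_def leaf_p)
  show "adj (Pv a b c s) (Lv 1 a c ((s + twist_step a b c) mod 3))"
    using adj[of 1] by (simp add: Lv_def leaf_p[unfolded One_nat_def])
  show "adj (Pv a b c s) (Lv 2 a b ((s + 2 * twist_step a b c) mod 3))"
    using adj[of 2] by (simp add: Lv_def leaf_p)
qed

lemma Lv_distinct:
  assumes "i < 3" "j < 3" "i \<noteq> j" "s < 3" "t < 3"
  shows "Lv i u v s \<noteq> Lv j u' v' t"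
proof
  assume e: "Lv i u v s = Lv j u' v' t"
  have 3: "d (W 0) (l i u v) = 3" "d (W 0) (l j u' v') = 3" using l_is_leaf assms by auto
  have "l i u v = l j u' v'" by (rule copy_eqD(1)[OF e[unfolded Lv_def]]) (use 3 assms in simp_all)
  then have "Y i = Y j" using branch_unique[OF 3(1) adj_Y[OF assms(1)] adj_Y[OF assms(2)]]
      l_is_leaf(2)[OF assms(1), of u v] l_is_leaf(2)[OF assms(2), of u' v'] by simp
  then show False using Y_eq_iff assms by blast
qed

lemma nb_Pv:
  assumes "a < 2" "b < 2" "c < 2" "s < 3"
  shows "nb (Pv a b c s) =
    {Lv 0 b c s, Lv 1 a c ((s + twist_step a b c) mod 3), Lv 2 a b ((s + 2 * twist_step a b c) mod 3)}"
  by (rule nb_eqI[OF adj_Pv[OF assms]]; rule Lv_distinct) (use assms in simp_all)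

text \<open>Coordinate sums of different parity mean different twists, and the twist is constant on
  an antipodal class.\<close>

lemma Pv_distinct:
  assumes "i < 3" "leaf (p a b c) (Y i) = leaf (p a' b' c') (Y i)" "s < 3" "t < 3"
    and "a < 2" "b < 2" "c < 2" "a' < 2" "b' < 2" "c' < 2" "even (a + b + c) \<longleftrightarrow> odd (a' + b' + c')"
  shows "Pv a b c s \<noteq> Pv a' b' c' t"
proof
  assume e: "Pv a b c s = Pv a' b' c' t"
  have "twist (p a b c) = twist (p a' b' c')"
    using twist_antipodal[OF outer_p Pv_props(1)[OF assms(3), of a b c]]
      twist_antipodal[OF outer_p Pv_props(1)[OF assms(4), of a' b' c']] e by simp
  then show False using twist_p assms by blast
qed

lemma Lv_Pv_distinct: "i < 3 \<Longrightarrow> s < 3 \<Longrightarrow> t < 3 \<Longrightarrow> Zv i e s \<noteq> Pv a b c t"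
proof
  assume a: "i < 3" "s < 3" "t < 3" "Zv i e s = Pv a b c t"
  have "d (W s) (Zv i e s) = 2"
    using copy_props(2)[of "parent (l i e 0)" s] parent_l_level[OF a(1)] a by (simp add: Zv_def)
  moreover have "d (W s) (Pv a b c t) = 4" using outer_iff[OF a(2)] Pv_props(3)[OF a(3)] by blast
  ultimately show False using a by simp
qed

text \<open>Index of the parent of the leaf \<open>l i u v\<close>: leaves 00 and 11 are below
  \<open>Zv i 0\<close>, leaves 10 and 01 below \<open>Zv i 1\<close>.\<close>

definition bit_xor :: "nat \<Rightarrow> nat \<Rightarrow> nat" where "bit_xor u v = (if u = v then 0 else 1)"

lemma adj_Lv_Zv:
  assumes "i < 3" "u < 2" "v < 2" "s < 3" shows "adj (Lv i u v s) (Zv i (bit_xor u v) s)"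
proof -
  have uv: "u = 0 \<or> u = 1" "v = 0 \<or> v = 1" using assms by linarith+
  have "Lv i u v s \<in> nb (Zv i (bit_xor u v) s)"
    using uv nb_Zv[OF assms(1,4)] by (elim disjE) (simp_all add: bit_xor_def)
  then show ?thesis using adj_sym by simp
qed

lemma nb_Lv:
  assumes "u < 2" "v < 2" "s < 3"
  shows "nb (Lv 0 u v s) = {Zv 0 (bit_xor u v) s, Pv 0 u v s, Pv 1 u v s}"
    "nb (Lv 1 u v s) = {Zv 1 (bit_xor u v) s, Pv u 0 v ((s + 2 * twist_step u 0 v) mod 3), Pv u 1 v ((s + 2 * twist_step u 1 v) mod 3)}"
    "nb (Lv 2 u v s) = {Zv 2 (bit_xor u v) s, Pv u v 0 ((s + twist_step u v 0) mod 3), Pv u v 1 ((s + twist_step u v 1) mod 3)}"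
proof -
  \<comment> \<open>Reading the shifts from the leaf's side: subtracting \<open>e\<close> or
    \<open>2 * e\<close> modulo 3 is adding \<open>2 * e\<close> or \<open>e\<close>.\<close>
  have ret: "((s + 2 * e) mod 3 + e) mod 3 = s" "((s + e) mod 3 + 2 * e) mod 3 = s" for e
  proof -
    have "((s + 2 * e) mod 3 + e) mod 3 = (s + 3 * e) mod 3" by (simp add: mod_simps)
    moreover have "((s + e) mod 3 + 2 * e) mod 3 = (s + 3 * e) mod 3" by (simp add: mod_simps)
    moreover have "(s + 3 * e) mod 3 = s" using assms(3) by simp
    ultimately show "((s + 2 * e) mod 3 + e) mod 3 = s" "((s + e) mod 3 + 2 * e) mod 3 = s" by (simp_all only:)
  qed
  have m: "n mod 3 < 3" for n :: nat by simp
  show "nb (Lv 0 u v s) = {Zv 0 (bit_xor u v) s, Pv 0 u v s, Pv 1 u v s}"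
    by (rule nb_eqI[OF adj_Lv_Zv adj_sym[OF adj_Pv(1)] adj_sym[OF adj_Pv(1)] Lv_Pv_distinct Lv_Pv_distinct
          Pv_distinct[of 0]]) (use assms leaf_p in simp_all)
  have "adj (Lv 1 u v s) (Pv u k v ((s + 2 * twist_step u k v) mod 3))" if "k < 2" for k
    using adj_sym[OF adj_Pv(2)[OF assms(1) that assms(2) m, of "s + 2 * twist_step u k v"]] unfolding ret .
  then show "nb (Lv 1 u v s) = {Zv 1 (bit_xor u v) s, Pv u 0 v ((s + 2 * twist_step u 0 v) mod 3), Pv u 1 v ((s + 2 * twist_step u 1 v) mod 3)}"
    by (intro nb_eqI adj_Lv_Zv Lv_Pv_distinct Pv_distinct[of 1]) (use assms leaf_p in simp_all)
  have "adj (Lv 2 u v s) (Pv u v k ((s + twist_step u v k) mod 3))" if "k < 2" for k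
    using adj_sym[OF adj_Pv(3)[OF assms(1,2) that m, of "s + twist_step u v k"]] unfolding ret .
  then show "nb (Lv 2 u v s) = {Zv 2 (bit_xor u v) s, Pv u v 0 ((s + twist_step u v 0) mod 3), Pv u v 1 ((s + twist_step u v 1) mod 3)}"
    by (intro nb_eqI adj_Lv_Zv Lv_Pv_distinct Pv_distinct[of 2]) (use assms leaf_p in simp_all)
qed

text \<open>The tree of sheet 0 outward from its root, the 24 outer vertices, and the trees of
  sheets 1 and 2 from their leaves inward, as their roots are farthest from
  \<open>W 0\<close>.\<close>

definition vertices :: "'v list" where
  "vertices = [X 0, Yv 0 0, Yv 1 0, Yv 2 0, Zv 0 0 0, Zv 0 1 0, Zv 1 0 0, Zv 1 1 0, Zv 2 0 0, Zv 2 1 0,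
   Lv 0 0 0 0, Lv 0 1 1 0, Lv 0 1 0 0, Lv 0 0 1 0, Lv 2 0 0 0, Lv 2 1 1 0, Lv 2 1 0 0,
   Lv 2 0 1 0, Lv 1 0 1 0, Lv 1 1 0 0, Lv 1 1 1 0, Lv 1 0 0 0, Pv 0 0 0 0, Pv 1 0 0 0,
   Pv 1 1 1 0, Pv 0 1 1 0, Pv 0 1 0 0, Pv 1 1 0 0, Pv 1 0 1 0, Pv 0 0 1 0, Pv 0 0 0 1,
   Pv 0 0 1 2, Pv 1 1 1 2, Pv 1 1 0 1, Pv 1 0 0 2, Pv 1 0 1 1, Pv 0 1 0 2, Pv 0 1 1 1,
   Pv 0 1 1 2, Pv 0 0 1 1, Pv 1 0 0 1, Pv 1 1 0 2, Pv 1 1 1 1, Pv 1 0 1 2, Pv 0 1 0 1,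
   Pv 0 0 0 2, Lv 0 0 0 2, Lv 0 0 0 1, Lv 0 1 1 2, Lv 0 1 1 1, Lv 0 1 0 2, Lv 0 1 0 1,
   Lv 0 0 1 1, Lv 0 0 1 2, Lv 1 0 0 1, Lv 1 0 0 2, Lv 1 1 1 1, Lv 1 1 1 2, Lv 1 1 0 1,
   Lv 1 1 0 2, Lv 1 0 1 2, Lv 1 0 1 1, Lv 2 0 0 1, Lv 2 0 0 2, Lv 2 1 1 2, Lv 2 1 1 1,
   Lv 2 1 0 2, Lv 2 1 0 1, Lv 2 0 1 2, Lv 2 0 1 1, Zv 0 0 1, Zv 0 1 1, Zv 1 0 1, Zv 1 1 1,
   Zv 2 0 1, Zv 2 1 1, Zv 0 0 2, Zv 0 1 2, Zv 1 0 2, Zv 1 1 2, Zv 2 0 2, Zv 2 1 2, Yv 0 1,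
   Yv 1 1, Yv 2 1, Yv 0 2, Yv 1 2, Yv 2 2, X 1, X 2]"

lemma nb_vertices: "list_all2 (\<lambda>v ns. nb v = set (map ((!) vertices) ns)) vertices foster_nbs"
proof -
  note nbs = nb_X nb_Yv nb_Zv nb_Pv nb_Lv
  have bit: "bit_xor 0 0 = 0" "bit_xor 1 1 = 0" "bit_xor 0 1 = 1" "bit_xor 1 0 = 1"
    by (simp_all add: bit_xor_def)
  have step: "twist_step 0 0 0 = 1" "twist_step 0 1 1 = 1" "twist_step 1 0 1 = 1" "twist_step 1 1 0 = 1"
    "twist_step 1 0 0 = 2" "twist_step 0 1 0 = 2" "twist_step 0 0 1 = 2" "twist_step 1 1 1 = 2"
    by (simp_all add: twist_step_def)
  show ?thesis
    unfolding vertices_def foster_nbs_def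
    by (simp only: list_all2_Cons list_all2_Nil list.map list.set nth_Cons_numeral pred_numeral_simps nth_Cons_0
      nth_Cons_Suc) (simp add: nbs[unfolded One_nat_def] bit[unfolded One_nat_def] step[unfolded One_nat_def]
        numeral_2_eq_2[symmetric])
qed

lemma vertices_complete:
  assumes "CARD('v) = 90"
  shows "length vertices = 90" "distinct vertices" "set vertices = UNIV" "vertices ! 0 = W 0"
    "\<And>n. n < 90 \<Longrightarrow> nb (vertices ! n) = (!) vertices ` set (foster_nbs ! n)"
proof -
  show len: "length vertices = 90" and 0: "vertices ! 0 = W 0" by (simp_all add: vertices_def X_def)
  have "list_all (\<lambda>ns. list_all (\<lambda>m. m < 90) ns) foster_nbs" by (simp add: foster_nbs_def)
  then have lt: "m < 90" if "n < length foster_nbs" "m \<in> set (foster_nbs ! n)" for n m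
    using that unfolding list_all_iff by (metis nth_mem)
  have len': "length foster_nbs = 90" using list_all2_lengthD[OF nb_vertices] len by simp
  show nb: "nb (vertices ! n) = (!) vertices ` set (foster_nbs ! n)" if "n < 90" for n
    using list_all2_nthD[OF nb_vertices, of n] that len by simp
  \<comment> \<open>A list closed under adjacency and containing \<open>W 0\<close> exhausts a
    connected graph. Distinctness follows by counting: 90 entries cover 90 vertices.\<close>
  have closed: "w \<in> set vertices" if v: "v \<in> set vertices" "adj v w" for v w
  proof -
    obtain n where n: "n < 90" "v = vertices ! n" using v(1) len by (metis in_set_conv_nth)
    have "w \<in> (!) vertices ` set (foster_nbs ! n)" using nb[OF n(1)] v(2) n(2) by auto
    then obtain m where "m \<in> set (foster_nbs ! n)" "w = vertices ! m" by blast
    then show ?thesis using lt[of n m] n len len' by simp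
  qed
  have "w \<in> set vertices" for w
    using conn[of "W 0" w]
  proof (induction rule: rtranclp_induct)
    case base then show ?case using 0 len by (metis nth_mem zero_less_numeral)
  next
    case (step y z) then show ?case using closed by blast
  qed
  then show UN: "set vertices = UNIV" by blast
  show "distinct vertices" using len UN assms by (intro card_distinct) simp
qed

end

theorem foster_graph_labelling:
  fixes adj :: "'v::finite \<Rightarrow> 'v \<Rightarrow> bool" and x :: 'v
  assumes "foster_graph adj" "CARD('v) = 90"
  obtains vs where "length vs = 90" "distinct vs" "set vs = UNIV" "vs ! 0 = x"
    "\<And>n. n < 90 \<Longrightarrow> {z. adj (vs ! n) z} = (!) vs ` set (foster_nbs ! n)"
proof -
  interpret foster_graph adj by fact
  have "card {v. d x v = 8} = 2" by (rule card_sphere)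
  then obtain w1 w2 where w: "{v. d x v = 8} = {w1, w2}" "w1 \<noteq> w2" unfolding card_2_iff by auto
  then have 8: "d x w1 = 8" "d x w2 = 8" by auto
  define W where "W s = (if s = 0 then x else if s = 1 then w1 else w2)" for s :: nat
  have "antipodal w1 w2" using antipodal_trans[of w1 x w2] antipodal_sym[of x w1] 8 by (auto simp: antipodal_def)
  then have 12: "d w1 w2 = 8" using w(2) by (simp add: antipodal_def)
  interpret foster_sheets adj W
  proof
    fix s t :: nat assume "s < 3" "t < 3" "s \<noteq> t"
    then show "d (W s) (W t) = 8"
      using 8 12 dist_sym[of w1 x] dist_sym[of w2 x] dist_sym[of w2 w1] by (auto simp: W_def)
  qed
  have "card (nb x) = 3" by (rule card_nb)
  then obtain y0 y1 y2 where y: "nb x = {y0, y1, y2}" unfolding card_3_iff by auto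
  define Y where "Y i = (if i = 0 then y0 else if i = 1 then y1 else y2)" for i :: nat
  interpret foster_branches adj W Y
    by unfold_locales (simp add: Y_def W_def y)
  obtain p l where "foster_cube adj W Y p l" using ex_cube by blast
  then interpret foster_cube adj W Y p l .
  note c = vertices_complete[OF assms(2)]
  show ?thesis
    by (rule that[OF c(1-3)]) (use c(4,5) in \<open>simp_all add: W_def nb_def\<close>)
qed

section \<open>Linear combinations and the Hermitian form\<close>

lemma mv_sum: "A *v (\<Sum>i\<in>I. f i) = (\<Sum>i\<in>I. A *v f i)"
  for A :: "complex^'n::finite^'m::finite"
  by (induction I rule: infinite_finite_induct) (simp_all add: matrix_vector_right_distrib)

lemma mv_smult: "A *v (c *s u) = c *s (A *v u)" for A :: "complex^'n::finite^'m::finite"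
  by (simp add: matrix_vector_mult_def Finite_Cartesian_Product.vec_eq_iff sum_distrib_left mult.left_commute)

lemma mscale_mv: "mscale c A *v u = c *s (A *v u)"
  by (simp add: mscale_def matrix_vector_mult_def Finite_Cartesian_Product.vec_eq_iff sum_distrib_left mult.assoc)

lemma smult_sum: "c *s (\<Sum>i\<in>I. f i) = (\<Sum>i\<in>I. c *s f i)" for f :: "'a \<Rightarrow> complex^'n::finite"
  by (induction I rule: infinite_finite_induct) (simp_all add: vector_add_ldistrib)

lemma sum_smult: "(\<Sum>i\<in>I. c i) *s u = (\<Sum>i\<in>I. c i *s u)" for u :: "complex^'n::finite"
  by (induction I rule: infinite_finite_induct) (simp_all add: vector_sadd_rdistrib)

lemma sum_delta_smult:
  fixes f :: "nat \<Rightarrow> complex^'n::finite"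
  assumes "k < n" shows "(\<Sum>i<n. (if i = k then a else 0) *s f i) = a *s f k"
proof -
  have "(\<Sum>i<n. (if i = k then a else 0) *s f i) = (\<Sum>i<n. if i = k then a *s f i else 0)"
    by (rule sum.cong) auto
  then show ?thesis using assms by simp
qed

lemma herm_add_left: "herm (u + u') v = herm u v + herm u' v"
  by (simp add: herm_def distrib_right sum.distrib)

lemma herm_smult_left: "herm (c *s u) v = c * herm u v"
  by (simp add: herm_def sum_distrib_left mult.assoc)

lemma herm_0_left [simp]: "herm 0 v = 0"
  by (simp add: herm_def)

lemma herm_sum_left: "herm (\<Sum>i\<in>I. f i) v = (\<Sum>i\<in>I. herm (f i) v)"
  by (induction I rule: infinite_finite_induct) (simp_all add: herm_add_left)

lemma herm_0_right [simp]: "herm v 0 = 0"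
  by (simp add: herm_def)

lemma herm_add_right: "herm u (v + v') = herm u v + herm u v'"
  by (simp add: herm_def distrib_left sum.distrib)

lemma herm_sum_right: "herm v (\<Sum>i\<in>I. f i) = (\<Sum>i\<in>I. herm v (f i))"
  by (induction I rule: infinite_finite_induct) (simp_all add: herm_add_right)

lemma herm_smult_right: "herm u (c *s v) = cnj c * herm u v"
  by (simp add: herm_def sum_distrib_left mult.left_commute)

lemma herm_self: "herm u u = complex_of_real (\<Sum>y\<in>UNIV. (cmod (u $ y))\<^sup>2)"
  by (simp add: herm_def complex_mult_cnj cmod_power2)

lemma herm_self_eq_0 [simp]: "herm u u = 0 \<longleftrightarrow> u = 0"
proof
  assume "herm u u = 0"
  then have "(\<Sum>y\<in>UNIV. (cmod (u $ y))\<^sup>2) = 0" unfolding herm_self using of_real_eq_0_iff by blast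
  then show "u = 0" by (simp add: sum_nonneg_eq_0_iff Finite_Cartesian_Product.vec_eq_iff)
qed simp

section \<open>Adjoint matrices\<close>

definition adjoint_mat :: "complex^'v^'v::finite \<Rightarrow> complex^'v^'v" where
  "adjoint_mat M = (\<chi> i j. cnj (M $ j $ i))"

lemma herm_adjoint: "herm (M *v u) v = herm u (adjoint_mat M *v v)"
proof -
  have "herm (M *v u) v = (\<Sum>i\<in>UNIV. \<Sum>j\<in>UNIV. M $ i $ j * u $ j * cnj (v $ i))"
    by (simp add: herm_def matrix_vector_mult_def sum_distrib_right)
  also have "\<dots> = (\<Sum>j\<in>UNIV. \<Sum>i\<in>UNIV. M $ i $ j * u $ j * cnj (v $ i))" by (rule sum.swap)
  also have "\<dots> = herm u (adjoint_mat M *v v)"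
    by (simp add: herm_def matrix_vector_mult_def adjoint_mat_def sum_distrib_left mult_ac)
  finally show ?thesis .
qed

lemma adjoint_adjoint [simp]: "adjoint_mat (adjoint_mat M) = M"
  by (simp add: adjoint_mat_def)

lemma herm_adjoint': "herm u (M *v v) = herm (adjoint_mat M *v u) v"
  using herm_adjoint[of "adjoint_mat M" u v] by simp

lemma adjoint_mult: "adjoint_mat (M ** N) = adjoint_mat N ** adjoint_mat M"
  by (simp add: adjoint_mat_def matrix_matrix_mult_def Finite_Cartesian_Product.vec_eq_iff mult.commute)

lemma adjoint_add: "adjoint_mat (M + N) = adjoint_mat M + adjoint_mat N"
  by (simp add: adjoint_mat_def Finite_Cartesian_Product.vec_eq_iff)

lemma adjoint_mscale: "adjoint_mat (mscale c M) = mscale (cnj c) (adjoint_mat M)"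
  by (simp add: adjoint_mat_def mscale_def Finite_Cartesian_Product.vec_eq_iff)

lemma adjoint_one: "adjoint_mat (Finite_Cartesian_Product.mat 1) = Finite_Cartesian_Product.mat 1"
  by (auto simp: adjoint_mat_def Finite_Cartesian_Product.mat_def Finite_Cartesian_Product.vec_eq_iff)

section \<open>Spans and independence of indexed families\<close>

lemma span_family:
  fixes f :: "nat \<Rightarrow> complex^'v::finite"
  shows "vec.span (f ` {..<n}) = {\<Sum>i<n. c i *s f i | c. True}" (is "_ = ?R")
proof
  have "vec.subspace ?R"
    unfolding vec.subspace_def
  proof (intro conjI ballI allI)
    show "0 \<in> ?R" by (auto intro!: exI[of _ "\<lambda>_. 0"])
    fix u v assume "u \<in> ?R" "v \<in> ?R"
    then obtain c e where "u = (\<Sum>i<n. c i *s f i)" "v = (\<Sum>i<n. e i *s f i)" by auto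
    then have "u + v = (\<Sum>i<n. (c i + e i) *s f i)" by (simp add: sum.distrib vector_sadd_rdistrib)
    then show "u + v \<in> ?R" by (auto intro!: exI[of _ "\<lambda>i. c i + e i"])
  next
    fix a u assume "u \<in> ?R"
    then obtain c where "u = (\<Sum>i<n. c i *s f i)" by auto
    then have "a *s u = (\<Sum>i<n. (a * c i) *s f i)" by (simp add: smult_sum vector_smult_assoc)
    then show "a *s u \<in> ?R" by (auto intro!: exI[of _ "\<lambda>i. a * c i"])
  qed
  moreover have "f k \<in> ?R" if "k < n" for k
    using sum_delta_smult[OF that, of 1 f] by (auto intro!: exI[of _ "\<lambda>i. if i = k then 1 else 0"])
  ultimately show "vec.span (f ` {..<n}) \<subseteq> ?R" by (intro vec.span_minimal) auto
  show "?R \<subseteq> vec.span (f ` {..<n})"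
    by (auto intro!: vec.span_sum vec.span_scale intro: vec.span_base)
qed

lemma independent_family:
  fixes f :: "'a \<Rightarrow> complex^'v::finite"
  assumes fin: "finite I" and ind: "\<And>c. (\<Sum>i\<in>I. c i *s f i) = 0 \<Longrightarrow> \<forall>i\<in>I. c i = 0"
  shows "inj_on f I" "vec.independent (f ` I)"
proof -
  show inj: "inj_on f I"
  proof (rule inj_onI, rule ccontr)
    fix i j assume ij: "i \<in> I" "j \<in> I" "f i = f j" "i \<noteq> j"
    define c where "c k = (if k = i then 1 else if k = j then - 1 else 0 :: complex)" for k
    have "(\<Sum>k\<in>I. c k *s f k) = (\<Sum>k\<in>{i, j}. c k *s f k)"
      by (rule sum.mono_neutral_right) (use fin ij in \<open>auto simp: c_def\<close>)
    also have "\<dots> = 0" using ij by (simp add: c_def)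
    finally have "c i = 0" using ind ij by blast
    then show False by (simp add: c_def)
  qed
  show "vec.independent (f ` I)"
  proof (rule vec.independent_if_scalars_zero)
    show "finite (f ` I)" using fin by simp
    fix g u assume 0: "(\<Sum>u\<in>f ` I. g u *s u) = 0" and "u \<in> f ` I"
    then obtain i where i: "i \<in> I" "u = f i" by blast
    have "(\<Sum>i\<in>I. g (f i) *s f i) = 0" using 0 unfolding sum.reindex[OF inj] by (simp add: o_def)
    from ind[OF this] show "g u = 0" using i by blast
  qed
qed

lemma orthogonal_independent:
  fixes f :: "'a \<Rightarrow> complex^'v::finite"
  assumes "finite I" and orth: "\<And>i j. i \<in> I \<Longrightarrow> j \<in> I \<Longrightarrow> i \<noteq> j \<Longrightarrow> herm (f i) (f j) = 0"
    and nz: "\<And>i. i \<in> I \<Longrightarrow> f i \<noteq> 0" and 0: "(\<Sum>i\<in>I. c i *s f i) = 0"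
  shows "\<forall>i\<in>I. c i = 0"
proof
  fix k assume k: "k \<in> I"
  have "0 = herm (\<Sum>i\<in>I. c i *s f i) (f k)" using 0 by simp
  also have "\<dots> = (\<Sum>i\<in>I. if i = k then c k * herm (f k) (f k) else 0)"
    unfolding herm_sum_left herm_smult_left
  proof (rule sum.cong[OF refl])
    fix i assume i: "i \<in> I"
    show "c i * herm (f i) (f k) = (if i = k then c k * herm (f k) (f k) else 0)"
      using orth[OF i k] by (cases "i = k") simp_all
  qed
  also have "\<dots> = c k * herm (f k) (f k)" using assms(1) k by simp
  finally show "c k = 0" using nz[OF k] by simp
qed

lemma matrix_mult_add_left: "(M + M') ** N = M ** N + M' ** N" for M :: "complex^'v^'v::finite"
  by (simp add: matrix_matrix_mult_def Finite_Cartesian_Product.vec_eq_iff distrib_right sum.distrib)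

lemma matrix_mult_diff_left: "(M - M') ** N = M ** N - M' ** N" for M :: "complex^'v^'v::finite"
  by (simp add: matrix_matrix_mult_def Finite_Cartesian_Product.vec_eq_iff left_diff_distrib sum_subtractf)

lemma matrix_sum_mult: "(\<Sum>p\<in>I. F p) ** N = (\<Sum>p\<in>I. F p ** N)" for F :: "'a \<Rightarrow> complex^'v^'v::finite"
  by (induction I rule: infinite_finite_induct) (simp_all add: matrix_mult_add_left)

lemma matrix_mult_sum: "N ** (\<Sum>p\<in>I. F p) = (\<Sum>p\<in>I. N ** F p)" for F :: "'a \<Rightarrow> complex^'v^'v::finite"
  by (induction I rule: infinite_finite_induct) (simp_all add: matrix_add_ldistrib)

lemma mscale_mult: "mscale c M ** N = mscale c (M ** N)" for M N :: "complex^'v^'v::finite"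
  by (simp add: mscale_def matrix_matrix_mult_def Finite_Cartesian_Product.vec_eq_iff sum_distrib_left mult.assoc)

lemma mult_mscale: "N ** mscale c M = mscale c (N ** M)" for M N :: "complex^'v^'v::finite"
  by (simp add: mscale_def matrix_matrix_mult_def Finite_Cartesian_Product.vec_eq_iff sum_distrib_left mult.left_commute)

section \<open>The Terwilliger algebra\<close>

lemma subalgebra_hull: "subalgebra (subalgebra hull S)"
  by (rule hull_in) (auto simp: subalgebra_def)

locale terwilliger =
  fixes adj :: "'v::finite \<Rightarrow> 'v \<Rightarrow> bool" and x :: 'v
  assumes adj_commute: "adj y z \<longleftrightarrow> adj z y"
begin

abbreviation A :: "complex^'v^'v" where "A \<equiv> adjacency_matrix adj"
abbreviation E :: "nat \<Rightarrow> complex^'v^'v" where "E \<equiv> dual_idem adj x"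
abbreviation T :: "(complex^'v^'v) set" where "T \<equiv> terwilliger_algebra adj x"

lemma subalgebra_T: "subalgebra T"
  unfolding terwilliger_algebra_def by (rule subalgebra_hull)

lemma T_closed:
  shows T_one: "Finite_Cartesian_Product.mat 1 \<in> T"
    and T_add: "M \<in> T \<Longrightarrow> N \<in> T \<Longrightarrow> M + N \<in> T"
    and T_mult: "M \<in> T \<Longrightarrow> N \<in> T \<Longrightarrow> M ** N \<in> T"
    and T_mscale: "M \<in> T \<Longrightarrow> mscale c M \<in> T"
  using subalgebra_T by (auto simp: subalgebra_def)

lemma A_in_T: "A \<in> T"
  unfolding terwilliger_algebra_def by (rule hull_inc) simp

lemma E_in_T: "l \<le> gdiam adj \<Longrightarrow> E l \<in> T"
  unfolding terwilliger_algebra_def by (rule hull_inc) simp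

lemma T_induct [consumes 1, case_names A E one add mult mscale]:
  assumes "M \<in> T" "Q A" "\<And>l. l \<le> gdiam adj \<Longrightarrow> Q (E l)" "Q (Finite_Cartesian_Product.mat 1)"
    and "\<And>M N. Q M \<Longrightarrow> Q N \<Longrightarrow> Q (M + N)" "\<And>M N. Q M \<Longrightarrow> Q N \<Longrightarrow> Q (M ** N)"
    and "\<And>c M. Q M \<Longrightarrow> Q (mscale c M)"
  shows "Q M"
  using assms(1) unfolding terwilliger_algebra_def
  by (rule hull_induct) (use assms(2-) in \<open>auto simp: subalgebra_def\<close>)

lemma adjoint_A: "adjoint_mat A = A"
  using adj_commute by (auto simp: adjoint_mat_def adjacency_matrix_def Finite_Cartesian_Product.vec_eq_iff)

lemma adjoint_E: "adjoint_mat (E l) = E l"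
  by (auto simp: adjoint_mat_def dual_idem_def Finite_Cartesian_Product.vec_eq_iff)

text \<open>The generators are self-adjoint. Closure under adjoints allows operators of
  \<open>T\<close> to be moved across the Hermitian form, on which the orthogonality and
  irreducibility arguments rest.\<close>

lemma adjoint_in_T: "M \<in> T \<Longrightarrow> adjoint_mat M \<in> T"
  by (induction rule: T_induct)
    (simp_all add: adjoint_A adjoint_E adjoint_one adjoint_add adjoint_mult adjoint_mscale
      A_in_T E_in_T T_one T_add T_mult T_mscale)

lemma E_mv: "(E l *v u) $ y = (if gdist adj x y = l then u $ y else 0)"
proof -
  have "E l $ y $ z * u $ z = (if z = y then (if gdist adj x y = l then u $ y else 0) else 0)" for z
    by (simp add: dual_idem_def)
  then show ?thesis by (simp add: matrix_vector_mult_def)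
qed

end

section \<open>Families of modules with explicit bases\<close>

text \<open>Independence is required only inside one module and orthogonality only between seeds of
  the same type; the operators \<open>P\<close> propagate both to all basis vectors.\<close>

locale module_family = terwilliger adj x
  for adj :: "'v::finite \<Rightarrow> 'v \<Rightarrow> bool" and x +
  fixes m q :: nat and tp :: "nat \<Rightarrow> nat" and dm :: "nat \<Rightarrow> nat" and lev :: "nat \<Rightarrow> nat \<Rightarrow> nat"
    and B :: "nat \<Rightarrow> nat \<Rightarrow> nat \<Rightarrow> complex" and b :: "nat \<Rightarrow> nat \<Rightarrow> complex^'v"
    and P :: "nat \<Rightarrow> nat \<Rightarrow> complex^'v^'v"
  assumes tp_less: "w < m \<Longrightarrow> tp w < q"
    and tp_surj: "t < q \<Longrightarrow> \<exists>w<m. tp w = t"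
    and dm_pos: "t < q \<Longrightarrow> 0 < dm t"
    and A_b: "w < m \<Longrightarrow> j < dm (tp w) \<Longrightarrow> A *v b w j = (\<Sum>i<dm (tp w). B (tp w) i j *s b w i)"
    and E_b: "w < m \<Longrightarrow> i < dm (tp w) \<Longrightarrow> E l *v b w i = (if lev (tp w) i = l then b w i else 0)"
    and ind: "w < m \<Longrightarrow> (\<Sum>i<dm (tp w). c i *s b w i) = 0 \<Longrightarrow> i < dm (tp w) \<Longrightarrow> c i = 0"
    and P_T: "t < q \<Longrightarrow> i < dm t \<Longrightarrow> P t i \<in> T"
    and P_b: "w < m \<Longrightarrow> t < q \<Longrightarrow> i < dm t \<Longrightarrow> j < dm (tp w) \<Longrightarrow>
      P t i *v b w j = (if tp w = t \<and> j = 0 then b w i else 0)"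
    and P_adjoint: "t < q \<Longrightarrow> adjoint_mat (P t 0) = P t 0"
    and seeds: "w < m \<Longrightarrow> w' < m \<Longrightarrow> w \<noteq> w' \<Longrightarrow> tp w = tp w' \<Longrightarrow> herm (b w 0) (b w' 0) = 0"
    and total: "(\<Sum>w<m. dm (tp w)) = CARD('v)"
begin

definition W :: "nat \<Rightarrow> (complex^'v) set" where
  "W w = vec.span (b w ` {..<dm (tp w)})"

lemma W_eq: "W w = {\<Sum>i<dm (tp w). c i *s b w i | c. True}"
  unfolding W_def by (rule span_family)

lemma W_cases:
  assumes "u \<in> W w" obtains c where "u = (\<Sum>i<dm (tp w). c i *s b w i)"
  using assms unfolding W_eq by blast

lemma W_comb: "(\<Sum>i<dm (tp w). c i *s b w i) \<in> W w"
  unfolding W_eq by blast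

lemma b_in_W: "i < dm (tp w) \<Longrightarrow> b w i \<in> W w"
  unfolding W_def by (rule vec.span_base) simp

lemma subspace_W: "vec.subspace (W w)"
  unfolding W_def by simp

lemma dm_tp_pos: "w < m \<Longrightarrow> 0 < dm (tp w)"
  using dm_pos tp_less by blast

lemma b_nonzero:
  assumes "w < m" "i < dm (tp w)" shows "b w i \<noteq> 0"
proof
  assume 0: "b w i = 0"
  have "(\<Sum>j<dm (tp w). (if j = i then 1 else 0) *s b w j) = 0"
    unfolding sum_delta_smult[OF assms(2)] 0 by simp
  from ind[OF assms(1) this assms(2)] show False by simp
qed

lemma mv_comb: "M *v (\<Sum>i\<in>I. c i *s f i) = (\<Sum>i\<in>I. c i *s (M *v f i))"
  for M :: "complex^'n::finite^'k::finite"
  by (simp only: mv_sum mv_smult)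

text \<open>The coefficients depend on the type alone: true of the generators and preserved by the
  algebra operations. Both the isomorphisms and the upper bound for the dimension of
  \<open>T\<close> come from this.\<close>

lemma uniform_action:
  assumes "M \<in> T"
  shows "\<exists>C. \<forall>w<m. tp w = t \<longrightarrow> (\<forall>j<dm t. M *v b w j = (\<Sum>i<dm t. C i j *s b w i))"
  using assms
proof (induction rule: T_induct)
  case A
  have "A *v b w j = (\<Sum>i<dm t. B t i j *s b w i)" if "w < m" "tp w = t" "j < dm t" for w j
    using A_b[of w j] that by simp
  then show ?case by (intro exI[of _ "B t"] allI impI)
next
  case (E l)
  have "E l *v b w j = (\<Sum>i<dm t. (if i = j then if lev t j = l then 1 else 0 else 0) *s b w i)"
    if "w < m" "tp w = t" "j < dm t" for w j
    unfolding sum_delta_smult[OF that(3)] using E_b[of w j l] that by simp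
  then show ?case by (intro exI[of _ "\<lambda>i j. if i = j then if lev t j = l then 1 else 0 else 0"] allI impI)
next
  case one
  have "Finite_Cartesian_Product.mat 1 *v b w j = (\<Sum>i<dm t. (if i = j then 1 else 0) *s b w i)" if "w < m" "tp w = t" "j < dm t" for w j
    unfolding sum_delta_smult[OF that(3)] by simp
  then show ?case by (intro exI[of _ "\<lambda>i j. if i = j then 1 else 0"] allI impI)
next
  case (add M N)
  obtain C where "\<forall>w<m. tp w = t \<longrightarrow> (\<forall>j<dm t. M *v b w j = (\<Sum>i<dm t. C i j *s b w i))"
    using add(1) by (rule exE)
  note C = this[rule_format]
  obtain C' where "\<forall>w<m. tp w = t \<longrightarrow> (\<forall>j<dm t. N *v b w j = (\<Sum>i<dm t. C' i j *s b w i))"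
    using add(2) by (rule exE)
  note C' = this[rule_format]
  have "(M + N) *v b w j = (\<Sum>i<dm t. (C i j + C' i j) *s b w i)" if "w < m" "tp w = t" "j < dm t" for w j
    by (simp only: matrix_vector_mult_add_rdistrib C[OF that] C'[OF that] vector_sadd_rdistrib sum.distrib)
  then show ?case by (intro exI[of _ "\<lambda>i j. C i j + C' i j"] allI impI)
next
  case (mult M N)
  obtain C where "\<forall>w<m. tp w = t \<longrightarrow> (\<forall>j<dm t. M *v b w j = (\<Sum>i<dm t. C i j *s b w i))"
    using mult(1) by (rule exE)
  note C = this[rule_format]
  obtain C' where "\<forall>w<m. tp w = t \<longrightarrow> (\<forall>j<dm t. N *v b w j = (\<Sum>i<dm t. C' i j *s b w i))"
    using mult(2) by (rule exE)
  note C' = this[rule_format]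
  have "(M ** N) *v b w j = (\<Sum>i<dm t. (\<Sum>k<dm t. C' k j * C i k) *s b w i)"
    if "w < m" "tp w = t" "j < dm t" for w j
  proof -
    have "(M ** N) *v b w j = (\<Sum>k<dm t. C' k j *s (M *v b w k))"
      unfolding matrix_vector_mul_assoc[symmetric] C'[OF that] mv_comb ..
    also have "\<dots> = (\<Sum>k<dm t. \<Sum>i<dm t. (C' k j * C i k) *s b w i)"
      by (intro sum.cong refl) (simp add: C that smult_sum vector_smult_assoc)
    also have "\<dots> = (\<Sum>i<dm t. \<Sum>k<dm t. (C' k j * C i k) *s b w i)" by (rule sum.swap)
    finally show ?thesis by (simp only: sum_smult)
  qed
  then show ?case by (intro exI[of _ "\<lambda>i j. \<Sum>k<dm t. C' k j * C i k"] allI impI)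
next
  case (mscale c M)
  obtain C where "\<forall>w<m. tp w = t \<longrightarrow> (\<forall>j<dm t. M *v b w j = (\<Sum>i<dm t. C i j *s b w i))"
    using mscale by (rule exE)
  note C = this[rule_format]
  have "mscale c M *v b w j = (\<Sum>i<dm t. (c * C i j) *s b w i)" if "w < m" "tp w = t" "j < dm t" for w j
    by (simp only: mscale_mv C[OF that] smult_sum vector_smult_assoc)
  then show ?case by (intro exI[of _ "\<lambda>i j. c * C i j"] allI impI)
qed

lemma T_W:
  assumes "M \<in> T" "w < m" "u \<in> W w" shows "M *v u \<in> W w"
proof -
  obtain C where C: "\<forall>w'<m. tp w' = tp w \<longrightarrow> (\<forall>j<dm (tp w). M *v b w' j = (\<Sum>i<dm (tp w). C i j *s b w' i))"
    using uniform_action[OF assms(1)] by (rule exE)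
  obtain c where u: "u = (\<Sum>i<dm (tp w). c i *s b w i)" using assms(3) by (rule W_cases)
  have "M *v b w j \<in> W w" if "j < dm (tp w)" for j
    unfolding C[rule_format, OF assms(2) refl that] by (rule W_comb)
  then show ?thesis unfolding u mv_comb
    by (intro vec.subspace_sum[OF subspace_W] vec.subspace_scale[OF subspace_W]) simp
qed

lemma T_module_W: "w < m \<Longrightarrow> T_module T (W w)"
  unfolding T_module_def using subspace_W T_W by blast

text \<open>\<open>P (tp w) 0\<close> is self-adjoint and fixes the seed \<open>b w 0\<close>. Moved
  to the other side it either annihilates \<open>b w' j\<close> or meets another seed of the same
  type.\<close>

lemma seed_orthogonal:
  assumes w: "w < m" "w' < m" "w \<noteq> w'" and j: "j < dm (tp w')"
  shows "herm (b w 0) (b w' j) = 0"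
proof -
  let ?P = "P (tp w) 0"
  have t: "tp w < q" "0 < dm (tp w)" using tp_less dm_tp_pos w by auto
  have "herm (b w 0) (b w' j) = herm (?P *v b w 0) (b w' j)" using P_b[OF w(1) t t(2)] by simp
  also have "\<dots> = herm (b w 0) (?P *v b w' j)" unfolding herm_adjoint P_adjoint[OF t(1)] ..
  also have "\<dots> = 0" using P_b[OF w(2) t j] seeds[OF w] by auto
  finally show ?thesis .
qed

text \<open>Write \<open>b w i\<close> as the image of the seed under \<open>P (tp w) i\<close>. The
  adjoint, moved to \<open>u\<close>, stays in \<open>W w'\<close>, to which the seed is
  orthogonal.\<close>

lemma b_orthogonal:
  assumes w: "w < m" "w' < m" "w \<noteq> w'" and i: "i < dm (tp w)" and u: "u \<in> W w'"
  shows "herm (b w i) u = 0"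
proof -
  have t: "tp w < q" "0 < dm (tp w)" using tp_less dm_tp_pos w by auto
  have "adjoint_mat (P (tp w) i) *v u \<in> W w'" by (intro T_W adjoint_in_T P_T t i w u)
  then obtain c where c: "adjoint_mat (P (tp w) i) *v u = (\<Sum>j<dm (tp w'). c j *s b w' j)" by (rule W_cases)
  have "herm (b w i) u = herm (P (tp w) i *v b w 0) u" using P_b[OF w(1) t(1) i t(2)] by simp
  also have "\<dots> = (\<Sum>j<dm (tp w'). cnj (c j) * herm (b w 0) (b w' j))"
    unfolding herm_adjoint c herm_sum_right herm_smult_right ..
  also have "\<dots> = 0" using seed_orthogonal[OF w] by (intro sum.neutral) simp
  finally show ?thesis .
qed

lemma W_orthogonal:
  assumes "w < m" "w' < m" "w \<noteq> w'" "u \<in> W w" "u' \<in> W w'" shows "herm u u' = 0"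
proof -
  obtain c where "u = (\<Sum>i<dm (tp w). c i *s b w i)" using assms(4) by (rule W_cases)
  then have "herm u u' = (\<Sum>i<dm (tp w). c i * herm (b w i) u')" by (simp only: herm_sum_left herm_smult_left)
  also have "\<dots> = 0" using b_orthogonal[OF assms(1-3) _ assms(5)] by (intro sum.neutral) simp
  finally show ?thesis .
qed

text \<open>Orthogonality between modules and independence inside each make all the basis vectors
  independent, and by \<open>total\<close> there are as many of them as the dimension.\<close>

lemma basis_spans: "vec.span (\<Union>w<m. W w) = UNIV"
proof -
  define J where "J = (SIGMA w:{..<m}. {..<dm (tp w)})"
  define f where "f = (\<lambda>(w, i). b w i)"
  have fin: "finite J" unfolding J_def by simp
  have z: "\<forall>p\<in>J. c p = 0" if 0: "(\<Sum>p\<in>J. c p *s f p) = 0" for c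
  proof -
    define u where "u w = (\<Sum>i<dm (tp w). c (w, i) *s b w i)" for w
    have uW: "u w \<in> W w" for w unfolding u_def by (rule W_comb)
    have "(\<Sum>p\<in>J. c p *s f p) = (\<Sum>w<m. u w)"
      unfolding J_def f_def u_def by (subst sum.Sigma) (auto intro!: sum.cong)
    then have s: "(\<Sum>w<m. u w) = 0" using 0 by simp
    have "u w = 0" if w: "w < m" for w
    proof -
      have "0 = herm (\<Sum>w'<m. u w') (u w)" unfolding s by simp
      also have "\<dots> = (\<Sum>w'<m. if w' = w then herm (u w) (u w) else 0)"
        unfolding herm_sum_left
      proof (rule sum.cong[OF refl])
        fix w' assume "w' \<in> {..<m}"
        then show "herm (u w') (u w) = (if w' = w then herm (u w) (u w) else 0)"
          using W_orthogonal[of w' w "u w'" "u w"] w uW by (cases "w' = w") simp_all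
      qed
      also have "\<dots> = herm (u w) (u w)" using w by simp
      finally show ?thesis by simp
    qed
    then have "c (w, i) = 0" if "w < m" "i < dm (tp w)" for w i
      using ind[OF that(1) _ that(2), of "\<lambda>i. c (w, i)"] that unfolding u_def by blast
    then show ?thesis unfolding J_def by auto
  qed
  have *: "inj_on f J" "vec.independent (f ` J)"
    by (rule independent_family[OF fin], erule z)+
  have "card (f ` J) = CARD('v)" using card_image[OF *(1)] total unfolding J_def by simp
  moreover have "vec.dim (UNIV :: (complex^'v) set) = CARD('v)" by (rule vec_dim_card)
  ultimately have "vec.dim (UNIV :: (complex^'v) set) \<le> card (f ` J)" by linarith
  then have "UNIV \<subseteq> vec.span (f ` J)"
    using vec.card_ge_dim_independent[of "f ` J" "UNIV :: (complex^'v) set"] *(2) by simp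
  moreover have "f ` J \<subseteq> (\<Union>w<m. W w)" unfolding J_def f_def using b_in_W by auto
  ultimately show ?thesis using vec.span_mono by blast
qed

lemma operator_eqI:
  assumes "\<And>w j. w < m \<Longrightarrow> j < dm (tp w) \<Longrightarrow> M *v b w j = N *v b w j"
  shows "M = N"
proof -
  let ?S = "{u. M *v u = N *v u}"
  have sub: "vec.subspace ?S"
    unfolding vec.subspace_def by (simp add: matrix_vector_right_distrib mv_smult)
  have "W w \<subseteq> ?S" if "w < m" for w
    unfolding W_def by (rule vec.span_minimal[OF _ sub]) (use assms that in auto)
  then have "vec.span (\<Union>w<m. W w) \<subseteq> ?S" by (intro vec.span_minimal[OF _ sub]) blast
  then show ?thesis unfolding basis_spans matrix_eq by blast
qed

lemma dim_W_part:
  assumes "w < m" "I \<subseteq> {..<dm (tp w)}" shows "vec.dim (vec.span (b w ` I)) = card I"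
proof -
  have *: "inj_on (b w) {..<dm (tp w)}" "vec.independent (b w ` {..<dm (tp w)})"
    using independent_family[of "{..<dm (tp w)}" "b w"] ind[OF assms(1)] by auto
  have "vec.independent (b w ` I)" by (rule vec.independent_mono[OF *(2)]) (use assms in auto)
  then show ?thesis
    using card_image[OF inj_on_subset[OF *(1) assms(2)]] by (simp add: vec.dim_eq_card_independent)
qed

lemma dim_W: "w < m \<Longrightarrow> vec.dim (W w) = dm (tp w)"
  unfolding W_def using dim_W_part[of w "{..<dm (tp w)}"] by simp

lemma W_independent: "w < m \<Longrightarrow> inj_on (b w) {..<dm (tp w)} \<and> vec.independent (b w ` {..<dm (tp w)})"
  using independent_family[of "{..<dm (tp w)}" "b w"] ind by auto

subsection \<open>Irreducibility and isomorphism\<close>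

lemma P_mult: "t < q \<Longrightarrow> i < dm t \<Longrightarrow> P t i ** P t 0 = P t i"
proof (rule operator_eqI)
  fix w j assume a: "t < q" "i < dm t" "w < m" "j < dm (tp w)"
  have 0: "0 < dm t" using dm_pos a(1) .
  show "(P t i ** P t 0) *v b w j = P t i *v b w j"
    unfolding matrix_vector_mul_assoc[symmetric] P_b[OF a(3,1) 0 a(4)] P_b[OF a(3,1,2,4)]
    using P_b[OF a(3,1,2), of 0] 0 by auto
qed

lemma ex_herm_nonzero:
  assumes "u \<in> W w" "u \<noteq> 0" obtains k where "k < dm (tp w)" "herm u (b w k) \<noteq> 0"
proof -
  obtain c where u: "u = (\<Sum>i<dm (tp w). c i *s b w i)" using assms(1) by (rule W_cases)
  have "\<exists>k<dm (tp w). herm u (b w k) \<noteq> 0"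
  proof (rule ccontr)
    assume "\<not> ?thesis"
    then have "\<And>k. k < dm (tp w) \<Longrightarrow> herm u (b w k) = 0" by blast
    then have "herm u (\<Sum>i<dm (tp w). c i *s b w i) = 0"
      unfolding herm_sum_right herm_smult_right by (intro sum.neutral) simp
    then have "herm u u = 0" unfolding u[symmetric] .
    then show False using assms(2) by simp
  qed
  then show ?thesis using that by blast
qed

text \<open>Some basis vector \<open>b w k\<close> is not orthogonal to a given nonzero
  \<open>u\<close> in \<open>U\<close>. The adjoint of \<open>P (tp w) k\<close> maps
  \<open>u\<close> to a multiple of the seed, nonzero because its product with the seed is
  \<open>herm u (b w k)\<close>. From the seed the operators \<open>P\<close> recover the whole
  basis.\<close>

lemma submodule_full:
  assumes w: "w < m" and U: "T_module T U" "U \<noteq> {0}" "U \<subseteq> W w"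
  shows "U = W w"
proof -
  have t: "tp w < q" "0 < dm (tp w)" using tp_less dm_tp_pos w by auto
  have sub: "vec.subspace U" and act: "\<And>M u. M \<in> T \<Longrightarrow> u \<in> U \<Longrightarrow> M *v u \<in> U"
    using U(1) unfolding T_module_def by auto
  have "0 \<in> U" by (rule vec.subspace_0[OF sub])
  then obtain u where u: "u \<in> U" "u \<noteq> 0" using U(2) by auto
  have "u \<in> W w" using u U(3) by blast
  then obtain k where k: "k < dm (tp w)" "herm u (b w k) \<noteq> 0" using u(2) by (rule ex_herm_nonzero)
  let ?Q = "adjoint_mat (P (tp w) k)"
  have QU: "?Q *v u \<in> U" by (intro act adjoint_in_T P_T t k u)
  have "?Q = P (tp w) 0 ** ?Q"
    using arg_cong[OF P_mult[OF t(1) k(1)], of adjoint_mat] unfolding adjoint_mult P_adjoint[OF t(1)] by (rule sym)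
  then have eq: "?Q *v u = P (tp w) 0 *v (?Q *v u)" by (metis matrix_vector_mul_assoc)
  have "?Q *v u \<in> W w" using QU U(3) by blast
  then obtain c where c: "?Q *v u = (\<Sum>i<dm (tp w). c i *s b w i)" by (rule W_cases)
  have "P (tp w) 0 *v (?Q *v u) = (\<Sum>i<dm (tp w). (if i = 0 then c 0 else 0) *s b w i)"
    unfolding c mv_comb
  proof (rule sum.cong[OF refl])
    fix i assume "i \<in> {..<dm (tp w)}"
    then have "i < dm (tp w)" by simp
    from P_b[OF w t this] show "c i *s (P (tp w) 0 *v b w i) = (if i = 0 then c 0 else 0) *s b w i" by simp
  qed
  then have Qu: "?Q *v u = c 0 *s b w 0" using eq sum_delta_smult[OF t(2)] by simp
  have "c 0 * herm (b w 0) (b w 0) = herm (?Q *v u) (b w 0)" unfolding Qu herm_smult_left ..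
  also have "\<dots> = herm u (P (tp w) k *v b w 0)" by (simp add: herm_adjoint)
  also have "\<dots> = herm u (b w k)" using P_b[OF w t(1) k(1) t(2)] by simp
  finally have "c 0 \<noteq> 0" using k(2) by auto
  moreover have "(1 / c 0) *s (?Q *v u) \<in> U" by (rule vec.subspace_scale[OF sub QU])
  ultimately have "b w 0 \<in> U" unfolding Qu vector_smult_assoc by simp
  then have "b w i \<in> U" if "i < dm (tp w)" for i
    using act[OF P_T[OF t(1) that], of "b w 0"] P_b[OF w t(1) that t(2)] by simp
  then have "W w \<subseteq> U" unfolding W_def by (intro vec.span_minimal[OF _ sub]) auto
  then show ?thesis using U(3) by blast
qed

lemma irreducible_W: "w < m \<Longrightarrow> irreducible_T_module T (W w)"
  unfolding irreducible_T_module_def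
  using T_module_W submodule_full b_in_W[OF dm_tp_pos] b_nonzero[OF _ dm_tp_pos] by blast

lemma isomorphic_if:
  assumes w: "w < m" "w' < m" "tp w = tp w'" shows "T_isomorphic T (W w) (W w')"
proof -
  define n where "n = dm (tp w)"
  have n': "dm (tp w') = n" unfolding n_def w(3) ..
  define coef where "coef u = (SOME c. u = (\<Sum>i<n. c i *s b w i))" for u
  define f where "f u = (\<Sum>i<n. coef u i *s b w' i)" for u
  have coef: "coef u i = c i" if "u = (\<Sum>i<n. c i *s b w i)" "i < n" for u c i
  proof -
    have "u = (\<Sum>i<n. coef u i *s b w i)" unfolding coef_def by (rule someI[where x = c]) (rule that)
    then have "(\<Sum>i<n. (coef u i - c i) *s b w i) = 0"
      using that(1) by (simp add: vector_sub_rdistrib sum_subtractf)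
    from ind[OF w(1), folded n_def, OF this that(2)] show ?thesis by simp
  qed
  have f: "f (\<Sum>i<n. c i *s b w i) = (\<Sum>i<n. c i *s b w' i)" for c
    unfolding f_def by (intro sum.cong refl) (simp add: coef[OF refl])
  note Wc = W_cases[of _ w, folded n_def]
  have "bij_betw f (W w) (W w')"
    unfolding bij_betw_def
  proof
    show "inj_on f (W w)"
    proof (rule inj_onI)
      fix u v assume uv: "u \<in> W w" "v \<in> W w" "f u = f v"
      obtain c where c: "u = (\<Sum>i<n. c i *s b w i)" using uv(1) by (rule Wc)
      obtain e where e: "v = (\<Sum>i<n. e i *s b w i)" using uv(2) by (rule Wc)
      have 0: "(\<Sum>i<n. (c i - e i) *s b w' i) = 0"
        using uv(3) unfolding c e f by (simp add: vector_sub_rdistrib sum_subtractf)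
      have "c i - e i = 0" if "i < n" for i by (rule ind[OF w(2), unfolded n', OF 0 that])
      then show "u = v" unfolding c e by (intro sum.cong refl) simp
    qed
    show "f ` W w = W w'"
      unfolding W_eq[of w] W_eq[of w'] n_def[symmetric] n' by (auto simp: f image_iff) (use f in metis)
  qed
  moreover have "f (u + v) = f u + f v" if uv: "u \<in> W w" "v \<in> W w" for u v
  proof -
    obtain c where c: "u = (\<Sum>i<n. c i *s b w i)" using uv(1) by (rule Wc)
    obtain e where e: "v = (\<Sum>i<n. e i *s b w i)" using uv(2) by (rule Wc)
    have "u + v = (\<Sum>i<n. (c i + e i) *s b w i)" unfolding c e by (simp only: vector_sadd_rdistrib sum.distrib)
    then have "f (u + v) = (\<Sum>i<n. (c i + e i) *s b w' i)" by (simp only: f)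
    then show ?thesis unfolding c e f by (simp only: vector_sadd_rdistrib sum.distrib)
  qed
  moreover have "f (a *s u) = a *s f u" if u: "u \<in> W w" for a u
  proof -
    obtain c where c: "u = (\<Sum>i<n. c i *s b w i)" using u by (rule Wc)
    have "a *s u = (\<Sum>i<n. (a * c i) *s b w i)" unfolding c by (simp only: smult_sum vector_smult_assoc)
    then have "f (a *s u) = (\<Sum>i<n. (a * c i) *s b w' i)" by (simp only: f)
    then show ?thesis unfolding c f by (simp only: smult_sum vector_smult_assoc)
  qed
  moreover have "f (M *v u) = M *v f u" if M: "M \<in> T" and u: "u \<in> W w" for M u
  proof -
    obtain c where c: "u = (\<Sum>i<n. c i *s b w i)" using u by (rule Wc)
    obtain C where "\<forall>w'<m. tp w' = tp w \<longrightarrow> (\<forall>j<dm (tp w). M *v b w' j = (\<Sum>i<dm (tp w). C i j *s b w' i))"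
      using uniform_action[OF M] by (rule exE)
    note C = this[rule_format, folded n_def]
    have *: "M *v (\<Sum>i<n. c i *s b v i) = (\<Sum>i<n. (\<Sum>j<n. c j * C i j) *s b v i)" if "v < m" "tp v = tp w" for v
    proof -
      have "M *v (\<Sum>i<n. c i *s b v i) = (\<Sum>j<n. \<Sum>i<n. (c j * C i j) *s b v i)"
        unfolding mv_comb by (intro sum.cong refl) (simp add: C that smult_sum vector_smult_assoc)
      also have "\<dots> = (\<Sum>i<n. \<Sum>j<n. (c j * C i j) *s b v i)" by (rule sum.swap)
      finally show ?thesis by (simp only: sum_smult)
    qed
    show ?thesis unfolding c f *[OF w(1) refl] *[OF w(2) w(3)[symmetric]] ..
  qed
  ultimately show ?thesis unfolding T_isomorphic_def by blast
qed

text \<open>\<open>P (tp w) 0\<close> fixes the seed of \<open>W w\<close> and annihilates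
  \<open>W w'\<close>, so an isomorphism would send the seed to 0.\<close>

lemma not_isomorphic_if:
  assumes w: "w < m" "w' < m" "tp w \<noteq> tp w'" shows "\<not> T_isomorphic T (W w) (W w')"
proof
  assume "T_isomorphic T (W w) (W w')"
  then obtain f where f: "bij_betw f (W w) (W w')"
    "\<And>a u. u \<in> W w \<Longrightarrow> f (a *s u) = a *s f u" "\<And>M u. M \<in> T \<Longrightarrow> u \<in> W w \<Longrightarrow> f (M *v u) = M *v f u"
    unfolding T_isomorphic_def by blast
  have t: "tp w < q" "0 < dm (tp w)" using tp_less dm_tp_pos w by auto
  let ?P = "P (tp w) 0"
  have b0: "b w 0 \<in> W w" by (rule b_in_W[OF t(2)])
  have "f (b w 0) \<in> W w'" using f(1) b0 by (auto simp: bij_betw_def)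
  then obtain c where c: "f (b w 0) = (\<Sum>i<dm (tp w'). c i *s b w' i)" by (rule W_cases)
  have "f (b w 0) = f (?P *v b w 0)" using P_b[OF w(1) t t(2)] by simp
  also have "\<dots> = ?P *v f (b w 0)" by (rule f(3)[OF P_T[OF t] b0])
  also have "\<dots> = 0" unfolding c mv_comb using P_b[OF w(2) t] w(3) by (intro sum.neutral) simp
  finally have "f (b w 0) = 0" .
  moreover have "f 0 = 0" using f(2)[OF b0, of 0] by simp
  ultimately have "b w 0 = 0"
    using f(1) b0 vec.subspace_0[OF subspace_W, of w] unfolding bij_betw_def inj_on_def by metis
  then show False using b_nonzero[OF w(1) t(2)] by blast
qed

lemma isomorphic_iff: "w < m \<Longrightarrow> w' < m \<Longrightarrow> T_isomorphic T (W w) (W w') \<longleftrightarrow> tp w = tp w'"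
  using isomorphic_if not_isomorphic_if by blast

lemma orthogonal_decomposition_W: "orthogonal_decomposition T (map W [0..<m])"
  unfolding orthogonal_decomposition_def
proof (intro conjI ballI allI impI)
  fix V assume "V \<in> set (map W [0..<m])"
  then show "irreducible_T_module T V" using irreducible_W by auto
next
  fix i j u v assume "i < length (map W [0..<m])" "j < length (map W [0..<m])" "i \<noteq> j"
    "u \<in> map W [0..<m] ! i" "v \<in> map W [0..<m] ! j"
  then show "herm u v = 0" using W_orthogonal[of i j u v] by simp
next
  have "\<Union> (set (map W [0..<m])) = (\<Union>w<m. W w)" by auto
  then show "vec.span (\<Union> (set (map W [0..<m]))) = UNIV" using basis_spans by (simp only:)
qed

end

context module_family
begin

subsection \<open>Dual parts\<close>

lemma dual_part_W:
  assumes w: "w < m"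
  shows "dual_part adj x l (W w) = vec.span (b w ` {i. i < dm (tp w) \<and> lev (tp w) i = l})" (is "_ = vec.span (_ ` ?I)")
proof
  show "dual_part adj x l (W w) \<subseteq> vec.span (b w ` ?I)"
  proof
    fix v assume "v \<in> dual_part adj x l (W w)"
    then obtain u where u: "u \<in> W w" "v = E l *v u" unfolding dual_part_def by blast
    obtain c where c: "u = (\<Sum>i<dm (tp w). c i *s b w i)" using u(1) by (rule W_cases)
    have "c i *s (E l *v b w i) \<in> vec.span (b w ` ?I)" if "i < dm (tp w)" for i
    proof (cases "lev (tp w) i = l")
      case True
      then show ?thesis using E_b[OF w that, of l] that by (auto intro!: vec.span_scale intro: vec.span_base)
    next
      case False
      then show ?thesis using E_b[OF w that, of l] by (simp add: vec.span_zero)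
    qed
    then show "v \<in> vec.span (b w ` ?I)" unfolding u(2) c mv_comb by (intro vec.span_sum) simp
  qed
  show "vec.span (b w ` ?I) \<subseteq> dual_part adj x l (W w)"
  proof
    fix u assume u: "u \<in> vec.span (b w ` ?I)"
    have "vec.subspace {u. E l *v u = u}"
      unfolding vec.subspace_def by (simp add: matrix_vector_right_distrib mv_smult)
    moreover have "b w ` ?I \<subseteq> {u. E l *v u = u}" using E_b[OF w] by auto
    ultimately have "E l *v u = u" using u vec.span_minimal[of "b w ` ?I" "{u. E l *v u = u}"] by blast
    moreover have "u \<in> W w" unfolding W_def using u vec.span_mono[of "b w ` ?I" "b w ` {..<dm (tp w)}"] by auto
    ultimately show "u \<in> dual_part adj x l (W w)" unfolding dual_part_def by (metis image_eqI)
  qed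
qed

lemma dim_dual_part: "w < m \<Longrightarrow> vec.dim (dual_part adj x l (W w)) = card {i. i < dm (tp w) \<and> lev (tp w) i = l}"
  unfolding dual_part_W by (rule dim_W_part) auto

lemma dual_part_zero_iff:
  assumes "w < m" shows "dual_part adj x l (W w) \<noteq> {0} \<longleftrightarrow> l \<in> lev (tp w) ` {..<dm (tp w)}"
proof
  assume a: "dual_part adj x l (W w) \<noteq> {0}"
  show "l \<in> lev (tp w) ` {..<dm (tp w)}"
  proof (rule ccontr)
    assume "l \<notin> lev (tp w) ` {..<dm (tp w)}"
    then have e: "{i. i < dm (tp w) \<and> lev (tp w) i = l} = {}" by auto
    show False using a unfolding dual_part_W[OF assms] e image_empty vec.span_empty by blast
  qed
next
  assume "l \<in> lev (tp w) ` {..<dm (tp w)}"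
  then obtain i where i: "i < dm (tp w)" "lev (tp w) i = l" by auto
  have "b w i \<in> dual_part adj x l (W w)"
    unfolding dual_part_W[OF assms] by (rule vec.span_base) (use i in auto)
  then show "dual_part adj x l (W w) \<noteq> {0}" using b_nonzero[OF assms i(1)] by blast
qed

lemma endpoint_W:
  assumes "w < m" "\<And>i. i < dm (tp w) \<Longrightarrow> lev (tp w) 0 \<le> lev (tp w) i"
  shows "endpoint adj x (W w) = lev (tp w) 0"
  unfolding endpoint_def dual_part_zero_iff[OF assms(1)]
  by (rule Least_equality) (use dm_tp_pos[OF assms(1)] assms(2) in auto)

lemma diameter_W:
  assumes "w < m" "\<And>i. i < dm (tp w) \<Longrightarrow> lev (tp w) i \<le> gdiam adj"
  shows "module_diameter adj x (W w) = card (lev (tp w) ` {..<dm (tp w)}) - 1"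
proof -
  have "{i. i \<le> gdiam adj \<and> dual_part adj x i (W w) \<noteq> {0}} = lev (tp w) ` {..<dm (tp w)}"
    unfolding dual_part_zero_iff[OF assms(1)] using assms(2) by auto
  then show ?thesis unfolding module_diameter_def by (simp only:)
qed

lemma pure_b:
  assumes "w < m" "i < dm (tp w)" shows "pure_vector adj x (lev (tp w) i) (b w i)"
proof -
  have "b w i = E (lev (tp w) i) *v b w i" using E_b[OF assms] by simp
  then show ?thesis unfolding pure_vector_def dual_part_def using b_nonzero[OF assms] by blast
qed

subsection \<open>Dimension of the Terwilliger algebra\<close>

text \<open>The adjoint of \<open>P_mult\<close> shows that \<open>P t 0\<close> absorbs
  \<open>adjoint_mat (P t j)\<close> from the left, so on a module the image is a multiple of the
  seed. Pairing with the seed gives the factor.\<close>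

lemma adjoint_P_action:
  assumes w: "w < m" and t: "t < q" "j < dm t" and u: "u \<in> W w"
  shows "adjoint_mat (P t j) *v u =
    (if tp w = t then (herm u (b w j) / herm (b w 0) (b w 0)) *s b w 0 else 0)"
proof -
  let ?Q = "adjoint_mat (P t j)"
  have 0: "0 < dm t" "0 < dm (tp w)" using dm_pos t dm_tp_pos w by auto
  have "?Q = P t 0 ** ?Q"
    using arg_cong[OF P_mult[OF t], of adjoint_mat] unfolding adjoint_mult P_adjoint[OF t(1)] by (rule sym)
  then have eq: "?Q *v u = P t 0 *v (?Q *v u)" by (metis matrix_vector_mul_assoc)
  have "?Q *v u \<in> W w" by (intro T_W adjoint_in_T P_T t w u)
  then obtain c where c: "?Q *v u = (\<Sum>i<dm (tp w). c i *s b w i)" by (rule W_cases)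
  have "P t 0 *v (?Q *v u) = (\<Sum>i<dm (tp w). (if i = 0 then if tp w = t then c 0 else 0 else 0) *s b w i)"
    unfolding c mv_comb
  proof (rule sum.cong[OF refl])
    fix i assume "i \<in> {..<dm (tp w)}"
    then have "i < dm (tp w)" by simp
    from P_b[OF w t(1) 0(1) this]
    show "c i *s (P t 0 *v b w i) = (if i = 0 then if tp w = t then c 0 else 0 else 0) *s b w i" by simp
  qed
  then have Qu: "?Q *v u = (if tp w = t then c 0 else 0) *s b w 0"
    using eq sum_delta_smult[OF 0(2), of _ "b w"] by simp
  show ?thesis
  proof (cases "tp w = t")
    case True
    have "c 0 * herm (b w 0) (b w 0) = herm (?Q *v u) (b w 0)" unfolding Qu herm_smult_left using True by simp
    also have "\<dots> = herm u (P t j *v b w 0)" by (simp add: herm_adjoint)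
    also have "\<dots> = herm u (b w j)" using P_b[OF w t 0(2)] True by simp
    finally have "c 0 = herm u (b w j) / herm (b w 0) (b w 0)"
      using b_nonzero[OF w 0(2)] by (simp add: field_simps)
    then show ?thesis using Qu True by simp
  next
    case False
    then show ?thesis using Qu by simp
  qed
qed

definition unit_index :: "(nat \<times> nat \<times> nat) set" where
  "unit_index = (SIGMA t:{..<q}. {..<dm t} \<times> {..<dm t})"

definition unit_op :: "nat \<times> nat \<times> nat \<Rightarrow> complex^'v^'v" where
  "unit_op p = (case p of (t, i, j) \<Rightarrow> P t i ** adjoint_mat (P t j))"

lemma card_unit_index: "card unit_index = (\<Sum>t<q. (dm t)\<^sup>2)"
  unfolding unit_index_def by (simp add: power2_eq_square card_cartesian_product)

lemma finite_unit_index: "finite unit_index"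
  unfolding unit_index_def by simp

lemma unit_op_in_T: "p \<in> unit_index \<Longrightarrow> unit_op p \<in> T"
  unfolding unit_index_def unit_op_def by (auto intro!: T_mult adjoint_in_T P_T)

lemma unit_op_action:
  assumes w: "w < m" and t: "t < q" "i < dm t" "j < dm t" and u: "u \<in> W w"
  shows "unit_op (t, i, j) *v u = (if tp w = t then (herm u (b w j) / herm (b w 0) (b w 0)) *s b w i else 0)"
proof -
  have "unit_op (t, i, j) *v u = P t i *v (adjoint_mat (P t j) *v u)"
    unfolding unit_op_def by (simp add: matrix_vector_mul_assoc)
  then show ?thesis unfolding adjoint_P_action[OF w t(1,3) u]
    using P_b[OF w t(1,2) dm_tp_pos[OF w]] by (simp add: mv_smult)
qed

lemma mv_matrix_sum: "(\<Sum>p\<in>I. F p) *v u = (\<Sum>p\<in>I. F p *v u)" for F :: "'a \<Rightarrow> complex^'v^'v"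
  by (induction I rule: infinite_finite_induct) (simp_all add: matrix_vector_mult_add_rdistrib)

lemma unit_op_coefficients:
  assumes "(\<Sum>p\<in>unit_index. mscale (a p) (unit_op p)) = 0"
  shows "\<forall>p\<in>unit_index. a p = 0"
proof -
  have "a (t, i, j) = 0" if t: "t < q" "i < dm t" "j < dm t" for t i j
  proof -
    obtain w where w: "w < m" "tp w = t" using tp_surj[OF t(1)] by blast
    define g where "g = herm (b w 0) (b w 0)"
    have g: "g \<noteq> 0" unfolding g_def using b_nonzero[OF w(1) dm_tp_pos[OF w(1)]] by simp
    \<comment> \<open>With these conjugated coefficients the \<open>i\<close>-th coordinate of the
      image of \<open>u\<close> is \<open>herm u u / g\<close>, so a vanishing combination forces
      \<open>u = 0\<close>.\<close>
    define u where "u = (\<Sum>j<dm t. cnj (a (t, i, j)) *s b w j)"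
    have uW: "u \<in> W w" unfolding u_def using W_comb[of "\<lambda>j. cnj (a (t, i, j))" w] w(2) by simp
    have "0 = (\<Sum>p\<in>unit_index. mscale (a p) (unit_op p)) *v u" unfolding assms by simp
    also have "\<dots> = (\<Sum>p\<in>unit_index. a p *s (unit_op p *v u))" unfolding mv_matrix_sum mscale_mv ..
    also have "\<dots> = (\<Sum>p\<in>{t} \<times> {..<dm t} \<times> {..<dm t}. a p *s (unit_op p *v u))"
    proof (rule sum.mono_neutral_right[OF finite_unit_index])
      show "{t} \<times> {..<dm t} \<times> {..<dm t} \<subseteq> unit_index" unfolding unit_index_def using t by auto
      show "\<forall>p\<in>unit_index - {t} \<times> {..<dm t} \<times> {..<dm t}. a p *s (unit_op p *v u) = 0"
      proof
        fix p assume p: "p \<in> unit_index - {t} \<times> {..<dm t} \<times> {..<dm t}"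
        obtain t' k l where pk: "p = (t', k, l)" by (cases p)
        have "t' < q" "k < dm t'" "l < dm t'" "tp w \<noteq> t'"
          using p w(2) unfolding pk unit_index_def by auto
        then show "a p *s (unit_op p *v u) = 0" unfolding pk using unit_op_action[OF w(1) _ _ _ uW] by simp
      qed
    qed
    also have "\<dots> = (\<Sum>k<dm t. \<Sum>l<dm t. a (t, k, l) *s (unit_op (t, k, l) *v u))"
      unfolding sum.cartesian_product' by simp
    also have "\<dots> = (\<Sum>k<dm t. (\<Sum>l<dm t. a (t, k, l) * (herm u (b w l) / g)) *s b w k)"
    proof (rule sum.cong[OF refl])
      fix k assume "k \<in> {..<dm t}"
      then have k: "k < dm t" by simp
      have h: "a (t, k, l) *s (unit_op (t, k, l) *v u) = (a (t, k, l) * (herm u (b w l) / g)) *s b w k" if "l < dm t" for l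
        unfolding unit_op_action[OF w(1) t(1) k that uW] g_def using w(2) by (simp add: vector_smult_assoc)
      show "(\<Sum>l<dm t. a (t, k, l) *s (unit_op (t, k, l) *v u)) =
          (\<Sum>l<dm t. a (t, k, l) * (herm u (b w l) / g)) *s b w k"
        unfolding sum_smult by (rule sum.cong[OF refl], rule h) simp
    qed
    finally have z: "(\<Sum>k<dm (tp w). (\<Sum>l<dm t. a (t, k, l) * (herm u (b w l) / g)) *s b w k) = 0"
      unfolding w(2) by (rule sym)
    have "(\<Sum>l<dm t. a (t, i, l) * (herm u (b w l) / g)) = 0"
      by (rule ind[OF w(1) z, of i]) (use t(2) w(2) in simp)
    then have "(\<Sum>l<dm t. a (t, i, l) * herm u (b w l)) / g = 0"
      by (simp add: sum_divide_distrib)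
    then have "(\<Sum>l<dm t. a (t, i, l) * herm u (b w l)) = 0" using g by simp
    moreover have "herm u u = (\<Sum>l<dm t. a (t, i, l) * herm u (b w l))"
      by (subst (2) u_def) (simp add: herm_sum_right herm_smult_right)
    ultimately have "u = 0" by simp
    then have "(\<Sum>j<dm (tp w). cnj (a (t, i, j)) *s b w j) = 0" unfolding u_def w(2) .
    from ind[OF w(1) this, of j] show ?thesis using t(3) w(2) by simp
  qed
  then show ?thesis unfolding unit_index_def by auto
qed

text \<open>A positive definite substitute for the identity. Without inverting Gram matrices it is
  not visible that \<open>M\<close> is a combination of the \<open>unit_op\<close>, but for
  \<open>M ** Kop\<close> it is.\<close>

definition Kop :: "complex^'v^'v" where
  "Kop = (\<Sum>p\<in>(SIGMA t:{..<q}. {..<dm t}). case p of (t, i) \<Rightarrow> unit_op (t, i, i))"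

lemma herm_unit_op: "herm (unit_op (t, i, i) *v u) u = herm (adjoint_mat (P t i) *v u) (adjoint_mat (P t i) *v u)"
  by (simp only: unit_op_def prod.case matrix_vector_mul_assoc[symmetric] herm_adjoint adjoint_adjoint)

text \<open>\<open>herm (Kop *v u) u\<close> is the sum of the squared norms of the vectors
  \<open>adjoint_mat (P t i) *v u\<close>. If they all vanish, \<open>u\<close> is orthogonal to
  every basis vector.\<close>

lemma Kop_kernel:
  assumes "Kop *v u = 0" shows "u = 0"
proof -
  let ?I = "SIGMA t:{..<q}. {..<dm t}"
  define G where "G p = (case p of (t, i) \<Rightarrow> \<Sum>y\<in>UNIV. (cmod ((adjoint_mat (P t i) *v u) $ y))\<^sup>2)" for p
  have "0 = herm (Kop *v u) u" unfolding assms by simp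
  also have "\<dots> = (\<Sum>p\<in>?I. case p of (t, i) \<Rightarrow> herm (adjoint_mat (P t i) *v u) (adjoint_mat (P t i) *v u))"
    unfolding Kop_def mv_matrix_sum herm_sum_left
    by (intro sum.cong refl) (auto simp only: herm_unit_op prod.case split: prod.split)
  also have "\<dots> = complex_of_real (\<Sum>p\<in>?I. G p)"
    unfolding of_real_sum G_def by (intro sum.cong refl) (auto simp only: herm_self prod.case split: prod.split)
  finally have "complex_of_real (\<Sum>p\<in>?I. G p) = 0" by (rule sym)
  then have "(\<Sum>p\<in>?I. G p) = 0" by (simp only: of_real_eq_0_iff)
  moreover have nn: "0 \<le> G p" for p unfolding G_def by (cases p) (simp add: sum_nonneg)
  moreover have "finite ?I" by simp
  ultimately have G0: "\<forall>p\<in>?I. G p = 0" by (simp only: sum_nonneg_eq_0_iff)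
  have Q0: "adjoint_mat (P t i) *v u = 0" if t: "t < q" "i < dm t" for t i
  proof -
    have "(t, i) \<in> ?I" using t by simp
    then have "G (t, i) = 0" using G0 by blast
    then have "herm (adjoint_mat (P t i) *v u) (adjoint_mat (P t i) *v u) = 0" unfolding herm_self G_def by simp
    then show ?thesis by (simp only: herm_self_eq_0)
  qed
  have b0: "herm u (b w i) = 0" if "w < m" "i < dm (tp w)" for w i
  proof -
    have t: "tp w < q" "0 < dm (tp w)" using tp_less dm_tp_pos that by auto
    have "herm u (b w i) = herm u (P (tp w) i *v b w 0)" using P_b[OF that(1) t(1) that(2) t(2)] by simp
    also have "\<dots> = 0" unfolding herm_adjoint' Q0[OF t(1) that(2)] by simp
    finally show ?thesis .
  qed
  have sub: "vec.subspace {v. herm u v = 0}"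
    unfolding vec.subspace_def by (simp add: herm_add_right herm_smult_right)
  have "W w \<subseteq> {v. herm u v = 0}" if "w < m" for w
    unfolding W_def by (rule vec.span_minimal[OF _ sub]) (use b0 that in auto)
  then have "vec.span (\<Union>w<m. W w) \<subseteq> {v. herm u v = 0}" by (intro vec.span_minimal[OF _ sub]) blast
  then have "herm u u = 0" unfolding basis_spans by blast
  then show ?thesis by simp
qed

lemma Kop_cancel:
  fixes M :: "complex^'v^'v"
  assumes "M ** Kop = 0" shows "M = 0"
proof -
  have "adjoint_mat Kop = Kop"
  proof -
    have "adjoint_mat (\<Sum>p\<in>I. F p) = (\<Sum>p\<in>I. adjoint_mat (F p))" for I and F :: "nat \<times> nat \<Rightarrow> complex^'v^'v"
      by (induction I rule: infinite_finite_induct)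
        (simp_all add: adjoint_add, simp_all add: adjoint_mat_def Finite_Cartesian_Product.vec_eq_iff)
    then show ?thesis unfolding Kop_def by (auto simp: unit_op_def adjoint_mult intro!: sum.cong)
  qed
  then have "Kop ** adjoint_mat M = adjoint_mat (M ** Kop)" by (simp add: adjoint_mult)
  also have "\<dots> = 0" unfolding assms by (simp add: adjoint_mat_def Finite_Cartesian_Product.vec_eq_iff)
  finally have "Kop *v (adjoint_mat M *v v) = 0" for v by (simp add: matrix_vector_mul_assoc)
  then have "adjoint_mat M *v v = 0" for v using Kop_kernel by blast
  then have "adjoint_mat M = 0" by (simp add: matrix_eq)
  then have "adjoint_mat (adjoint_mat M) = 0" by (simp add: adjoint_mat_def Finite_Cartesian_Product.vec_eq_iff)
  then show ?thesis by simp
qed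

text \<open>By \<open>uniform_action\<close>, \<open>M ** P t i\<close> is a combination of the
  operators \<open>P t k\<close> of the same type; multiplying by \<open>adjoint_mat (P t i)\<close>
  turns it into one of \<open>unit_op\<close>s.\<close>

lemma mult_Kop_in_span:
  assumes M: "M \<in> T" shows "M ** Kop \<in> cmat.span (unit_op ` unit_index)"
proof -
  have "M ** unit_op (t, i, i) \<in> cmat.span (unit_op ` unit_index)" if t: "t < q" "i < dm t" for t i
  proof -
    obtain C where C: "\<forall>w<m. tp w = t \<longrightarrow> (\<forall>j<dm t. M *v b w j = (\<Sum>i<dm t. C i j *s b w i))"
      using uniform_action[OF M] by (rule exE)
    have "M ** P t i = (\<Sum>k<dm t. mscale (C k i) (P t k))"
    proof (rule operator_eqI)
      fix w j assume w: "w < m" "j < dm (tp w)"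
      have l: "(M ** P t i) *v b w j = M *v (if tp w = t \<and> j = 0 then b w i else 0)"
        unfolding matrix_vector_mul_assoc[symmetric] P_b[OF w(1) t w(2)] ..
      have r: "(\<Sum>k<dm t. mscale (C k i) (P t k)) *v b w j =
          (\<Sum>k<dm t. C k i *s (if tp w = t \<and> j = 0 then b w k else 0))"
        unfolding mv_matrix_sum mscale_mv by (intro sum.cong refl) (use P_b[OF w(1) t(1) _ w(2)] in simp)
      show "(M ** P t i) *v b w j = (\<Sum>k<dm t. mscale (C k i) (P t k)) *v b w j"
      proof (cases "tp w = t \<and> j = 0")
        case True
        then show ?thesis unfolding l r using C[rule_format, OF w(1) _ t(2)] by simp
      next
        case False
        then show ?thesis unfolding l r by (simp only: if_False) simp
      qed
    qed
    then have "M ** unit_op (t, i, i) = (\<Sum>k<dm t. mscale (C k i) (unit_op (t, k, i)))"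
      unfolding unit_op_def by (simp add: matrix_mul_assoc matrix_sum_mult mscale_mult)
    also have "\<dots> \<in> cmat.span (unit_op ` unit_index)"
      by (intro cmat.span_sum cmat.span_scale cmat.span_base imageI) (use t in \<open>simp add: unit_index_def\<close>)
    finally show ?thesis .
  qed
  then show ?thesis unfolding Kop_def matrix_mult_sum by (intro cmat.span_sum) auto
qed

text \<open>An element of \<open>T\<close> outside the span of the \<open>unit_op\<close>s would,
  together with them, form an independent set. Right multiplication by \<open>Kop\<close> maps this
  set injectively to an independent set inside the span, one element too large.\<close>

lemma dim_T: "cmat.dim T = (\<Sum>t<q. (dm t)\<^sup>2)"
proof -
  let ?S = "unit_op ` unit_index"
  have inj: "inj_on unit_op unit_index"
  proof (rule inj_onI, rule ccontr)
    fix p r assume pr: "p \<in> unit_index" "r \<in> unit_index" "unit_op p = unit_op r" "p \<noteq> r"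
    define a where "a k = (if k = p then 1 else if k = r then - 1 else 0 :: complex)" for k
    have "(\<Sum>k\<in>unit_index. mscale (a k) (unit_op k)) = (\<Sum>k\<in>{p, r}. mscale (a k) (unit_op k))"
      by (rule sum.mono_neutral_right[OF finite_unit_index]) (use pr in \<open>auto simp: a_def mscale_def Finite_Cartesian_Product.vec_eq_iff\<close>)
    also have "\<dots> = 0" using pr by (simp add: a_def mscale_def Finite_Cartesian_Product.vec_eq_iff)
    finally have "a p = 0" using unit_op_coefficients pr(1) by blast
    then show False by (simp add: a_def)
  qed
  have ind: "cmat.independent ?S"
  proof (rule cmat.independent_if_scalars_zero)
    show "finite ?S" using finite_unit_index by simp
    fix g u assume 0: "(\<Sum>u\<in>?S. mscale (g u) u) = 0" and "u \<in> ?S"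
    then obtain p where p: "p \<in> unit_index" "u = unit_op p" by blast
    have "(\<Sum>p\<in>unit_index. mscale (g (unit_op p)) (unit_op p)) = 0"
      using 0 unfolding sum.reindex[OF inj] by (simp add: o_def)
    from unit_op_coefficients[OF this] show "g u = 0" using p by blast
  qed
  have sub: "T \<subseteq> cmat.span ?S"
  proof
    fix M assume M: "M \<in> T"
    show "M \<in> cmat.span ?S"
    proof (rule ccontr)
      assume nM: "M \<notin> cmat.span ?S"
      let ?S' = "insert M ?S"
      have ind': "cmat.independent ?S'" by (rule cmat.independent_insertI[OF nM ind])
      have fin: "finite ?S'" using finite_unit_index by simp
      have "M \<notin> ?S"
      proof
        assume "M \<in> ?S"
        then have "M \<in> cmat.span ?S" by (rule cmat.span_base)
        with nM show False ..
      qed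
      then have card: "card ?S' = Suc (card ?S)"
        by (intro card_insert_disjoint finite_imageI finite_unit_index)
      let ?g = "\<lambda>N. N ** Kop"
      have ginj: "inj_on ?g ?S'"
      proof (rule inj_onI)
        fix N N' :: "complex^'v^'v"
        assume "N ** Kop = N' ** Kop"
        then have "(N - N') ** Kop = 0" by (simp only: matrix_mult_diff_left diff_self)
        then have "N - N' = 0" by (rule Kop_cancel)
        then show "N = N'" by (simp only: right_minus_eq)
      qed
      have "cmat.independent (?g ` ?S')"
      proof (rule cmat.independent_if_scalars_zero)
        show "finite (?g ` ?S')" using fin by simp
        fix h u assume 0: "(\<Sum>u\<in>?g ` ?S'. mscale (h u) u) = 0" and "u \<in> ?g ` ?S'"
        then obtain N where N: "N \<in> ?S'" "u = N ** Kop" by blast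
        have "(\<Sum>N\<in>?S'. mscale (h (N ** Kop)) N) ** Kop = 0"
          using 0 unfolding sum.reindex[OF ginj] matrix_sum_mult mscale_mult by (simp only: o_def)
        then have "(\<Sum>N\<in>?S'. mscale (h (N ** Kop)) N) = 0" by (rule Kop_cancel)
        from cmat.independentD[OF ind' fin subset_refl this N(1)] show "h u = 0" using N(2) by simp
      qed
      moreover have "?g ` ?S' \<subseteq> cmat.span ?S"
      proof (rule image_subsetI)
        fix N assume "N \<in> ?S'"
        then have "N \<in> T" using M unit_op_in_T by auto
        then show "N ** Kop \<in> cmat.span ?S" by (rule mult_Kop_in_span)
      qed
      ultimately have "card (?g ` ?S') \<le> card ?S"
        using cmat.independent_span_bound[OF finite_imageI[OF finite_unit_index]] by metis
      then have "card ?S' \<le> card ?S" unfolding card_image[OF ginj] .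
      then show False unfolding card by simp
    qed
  qed
  have "?S \<subseteq> T" using unit_op_in_T by blast
  from cmat.dim_unique[OF this sub ind refl] show ?thesis using card_image[OF inj] card_unit_index by simp
qed

end

section \<open>The spectrum\<close>

text \<open>Every type matrix comes with a full set of eigenvectors for distinct real eigenvalues.
  Transported to all modules they give as many eigenvectors of \<open>A\<close> as there are
  vertices.\<close>

locale module_family_spectrum = module_family adj x m q tp dm lev B b P
  for adj :: "'v::finite \<Rightarrow> 'v \<Rightarrow> bool" and x m q tp dm lev B b P +
  fixes ev :: "nat \<Rightarrow> nat \<Rightarrow> complex" and f :: "nat \<Rightarrow> nat \<Rightarrow> nat \<Rightarrow> complex"
  assumes ev_real: "t < q \<Longrightarrow> k < dm t \<Longrightarrow> cnj (ev t k) = ev t k"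
    and ev_inj: "t < q \<Longrightarrow> inj_on (ev t) {..<dm t}"
    and f_eigen: "t < q \<Longrightarrow> k < dm t \<Longrightarrow> i < dm t \<Longrightarrow> (\<Sum>j<dm t. B t i j * f t k j) = ev t k * f t k i"
    and f_nonzero: "t < q \<Longrightarrow> k < dm t \<Longrightarrow> \<exists>i<dm t. f t k i \<noteq> 0"
begin

definition evec :: "nat \<times> nat \<Rightarrow> complex^'v" where
  "evec p = (case p of (w, k) \<Rightarrow> \<Sum>i<dm (tp w). f (tp w) k i *s b w i)"

definition eval_of :: "nat \<times> nat \<Rightarrow> complex" where
  "eval_of p = (case p of (w, k) \<Rightarrow> ev (tp w) k)"

definition eindex :: "(nat \<times> nat) set" where
  "eindex = (SIGMA w:{..<m}. {..<dm (tp w)})"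

lemma finite_eindex: "finite eindex"
  unfolding eindex_def by simp

lemma A_evec:
  assumes "p \<in> eindex" shows "A *v evec p = eval_of p *s evec p"
proof -
  obtain w k where p: "p = (w, k)" "w < m" "k < dm (tp w)" using assms unfolding eindex_def by auto
  let ?n = "dm (tp w)"
  have t: "tp w < q" using tp_less p by simp
  have "A *v evec p = (\<Sum>j<?n. \<Sum>i<?n. (f (tp w) k j * B (tp w) i j) *s b w i)"
    unfolding evec_def p(1) prod.case mv_comb
    by (intro sum.cong refl) (simp add: A_b[OF p(2)] smult_sum vector_smult_assoc)
  also have "\<dots> = (\<Sum>i<?n. \<Sum>j<?n. (f (tp w) k j * B (tp w) i j) *s b w i)" by (rule sum.swap)
  also have "\<dots> = (\<Sum>i<?n. (\<Sum>j<?n. B (tp w) i j * f (tp w) k j) *s b w i)"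
    by (simp only: sum_smult mult.commute)
  also have "\<dots> = (\<Sum>i<?n. (ev (tp w) k * f (tp w) k i) *s b w i)"
    by (intro sum.cong refl) (simp add: f_eigen[OF t p(3)])
  also have "\<dots> = eval_of p *s evec p"
    unfolding evec_def eval_of_def p(1) prod.case smult_sum vector_smult_assoc ..
  finally show ?thesis .
qed

lemma evec_nonzero: assumes "p \<in> eindex" shows "evec p \<noteq> 0"
proof
  obtain w k where p: "p = (w, k)" "w < m" "k < dm (tp w)" using assms unfolding eindex_def by auto
  assume "evec p = 0"
  then have 0: "(\<Sum>i<dm (tp w). f (tp w) k i *s b w i) = 0" unfolding evec_def p(1) by simp
  obtain i where "i < dm (tp w)" "f (tp w) k i \<noteq> 0" using f_nonzero[OF tp_less[OF p(2)] p(3)] by blast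
  then show False using ind[OF p(2) 0] by blast
qed

text \<open>In different modules by orthogonality of the modules; in the same module because
  \<open>A\<close> is self-adjoint and the two eigenvalues are distinct and real.\<close>

lemma evec_orthogonal:
  assumes "p \<in> eindex" "r \<in> eindex" "p \<noteq> r" shows "herm (evec p) (evec r) = 0"
proof -
  obtain w k where p: "p = (w, k)" "w < m" "k < dm (tp w)" using assms(1) unfolding eindex_def by auto
  obtain w' k' where r: "r = (w', k')" "w' < m" "k' < dm (tp w')" using assms(2) unfolding eindex_def by auto
  show ?thesis
  proof (cases "w = w'")
    case False
    then show ?thesis unfolding evec_def p(1) r(1) prod.case
      by (intro W_orthogonal[OF p(2) r(2)] W_comb)
  next
    case True
    have t: "tp w < q" using tp_less p by simp
    have ne: "eval_of p \<noteq> eval_of r"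
      using ev_inj[OF t] assms(3) p r True unfolding eval_of_def inj_on_def by auto
    have rl: "cnj (eval_of r) = eval_of r" unfolding eval_of_def r(1) using ev_real[OF tp_less[OF r(2)] r(3)] by simp
    have "eval_of p * herm (evec p) (evec r) = herm (A *v evec p) (evec r)"
      unfolding A_evec[OF assms(1)] herm_smult_left ..
    also have "\<dots> = herm (evec p) (A *v evec r)" unfolding herm_adjoint adjoint_A ..
    also have "\<dots> = eval_of r * herm (evec p) (evec r)" unfolding A_evec[OF assms(2)] herm_smult_right rl ..
    finally show ?thesis using ne by simp
  qed
qed

lemma evec_coefficients: "(\<Sum>p\<in>eindex. c p *s evec p) = 0 \<Longrightarrow> \<forall>p\<in>eindex. c p = 0"
  by (rule orthogonal_independent[OF finite_eindex evec_orthogonal evec_nonzero])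

lemma evec_independent: "inj_on evec eindex" "vec.independent (evec ` eindex)"
  by (rule independent_family[OF finite_eindex], erule evec_coefficients)+

lemma evec_span: "vec.span (evec ` eindex) = UNIV"
proof -
  have "card (evec ` eindex) = CARD('v)"
    using card_image[OF evec_independent(1)] total unfolding eindex_def by simp
  moreover have "vec.dim (UNIV :: (complex^'v) set) = CARD('v)" by (rule vec_dim_card)
  ultimately have "vec.dim (UNIV :: (complex^'v) set) \<le> card (evec ` eindex)" by linarith
  then show ?thesis
    using vec.card_ge_dim_independent[of "evec ` eindex" "UNIV :: (complex^'v) set"] evec_independent(2) by blast
qed

lemma eigenspace_span:
  "eigenspace A \<theta> = vec.span (evec ` {p \<in> eindex. eval_of p = \<theta>})" (is "_ = vec.span (_ ` ?I)")
proof
  have "vec.subspace (eigenspace A \<theta>)"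
    unfolding vec.subspace_def eigenspace_def
    by (simp add: matrix_vector_right_distrib mv_smult vector_add_ldistrib vector_smult_assoc mult.commute)
  then show "vec.span (evec ` ?I) \<subseteq> eigenspace A \<theta>"
    by (rule vec.span_minimal[rotated]) (use A_evec in \<open>auto simp: eigenspace_def\<close>)
  show "eigenspace A \<theta> \<subseteq> vec.span (evec ` ?I)"
  proof
    fix u assume "u \<in> eigenspace A \<theta>"
    then have Au: "A *v u = \<theta> *s u" unfolding eigenspace_def by simp
    have "u \<in> vec.span (evec ` eindex)" unfolding evec_span by simp
    then obtain g where g: "u = (\<Sum>v\<in>evec ` eindex. g v *s v)"
      unfolding vec.span_finite[OF finite_imageI[OF finite_eindex]] by blast
    define c where "c p = g (evec p)" for p
    have u: "u = (\<Sum>p\<in>eindex. c p *s evec p)"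
      unfolding g c_def sum.reindex[OF evec_independent(1)] by (simp add: o_def)
    have "(\<Sum>p\<in>eindex. (c p * eval_of p) *s evec p) = A *v u"
      unfolding u mv_comb by (intro sum.cong refl) (simp add: A_evec vector_smult_assoc)
    also have "\<dots> = (\<Sum>p\<in>eindex. (\<theta> * c p) *s evec p)"
      unfolding Au by (simp only: u smult_sum vector_smult_assoc)
    finally have "(\<Sum>p\<in>eindex. (c p * eval_of p - \<theta> * c p) *s evec p) = 0"
      by (simp add: vector_sub_rdistrib sum_subtractf)
    then have z: "\<forall>p\<in>eindex. c p * eval_of p - \<theta> * c p = 0" by (rule evec_coefficients)
    have "c p *s evec p \<in> vec.span (evec ` ?I)" if "p \<in> eindex" for p
    proof (cases "eval_of p = \<theta>")
      case True
      then show ?thesis using that by (intro vec.span_scale vec.span_base) blast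
    next
      case False
      have "c p * (eval_of p - \<theta>) = 0" using z that by (simp add: algebra_simps)
      then have "c p = 0" using False by simp
      then show ?thesis by (simp add: vec.span_zero)
    qed
    then show "u \<in> vec.span (evec ` ?I)" unfolding u by (intro vec.span_sum)
  qed
qed

lemma dim_eigenspace: "vec.dim (eigenspace A \<theta>) = card {p \<in> eindex. eval_of p = \<theta>}"
proof -
  let ?I = "{p \<in> eindex. eval_of p = \<theta>}"
  have "vec.independent (evec ` ?I)" by (rule vec.independent_mono[OF evec_independent(2)]) blast
  moreover have "inj_on evec ?I" by (rule inj_on_subset[OF evec_independent(1)]) blast
  ultimately show ?thesis unfolding eigenspace_span by (simp add: vec.dim_eq_card_independent card_image)
qed

lemma eigenspace_nonzero: "eigenspace A \<theta> \<noteq> {0} \<longleftrightarrow> \<theta> \<in> eval_of ` eindex"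
proof
  assume "eigenspace A \<theta> \<noteq> {0}"
  then have "{p \<in> eindex. eval_of p = \<theta>} \<noteq> {}" unfolding eigenspace_span by (metis image_empty vec.span_empty)
  then show "\<theta> \<in> eval_of ` eindex" by blast
next
  assume "\<theta> \<in> eval_of ` eindex"
  then obtain p where "p \<in> eindex" "eval_of p = \<theta>" by blast
  then have "evec p \<in> eigenspace A \<theta>" "evec p \<noteq> 0"
    using A_evec evec_nonzero by (auto simp: eigenspace_def)
  then show "eigenspace A \<theta> \<noteq> {0}" by blast
qed

end

section \<open>Tables\<close>

text \<open>Type-level data: the levels of the basis vectors, the matrices representing the adjacency matrix, and
  each basis vector as a combination of the vectors \<open>E l *v pw k \<nu>\<close> (pairs of a coefficient and \<open>k\<close>),
  to be divided by the entry of \<open>type_dens\<close>.\<close>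

definition type_levels :: "nat list list" where
  "type_levels = [[0, 1, 2, 3, 4, 5, 6, 7, 8], [1, 2, 3, 4, 5, 6, 7], [2, 3, 4, 4, 5, 5, 6], [3,
      4, 4, 5],
    [3, 4, 5, 5, 6], [4], [4, 5], [4, 5, 6, 7], [5, 6, 7, 8]]"

definition type_mats :: "int list list list" where
  "type_mats = [[[0, 3, 0, 0, 0, 0, 0, 0, 0], [1, 0, 2, 0, 0, 0, 0, 0, 0], [0, 1, 0, 2, 0, 0, 0,
      0, 0], [0, 0, 1, 0, 2, 0, 0, 0, 0], [0, 0, 0, 1, 0, 2, 0, 0, 0], [0, 0, 0, 0, 2, 0, 1, 0,
      0], [0, 0, 0, 0, 0, 2, 0, 1, 0], [0, 0, 0, 0, 0, 0, 2, 0, 1], [0, 0, 0, 0, 0, 0, 0, 3, 0]],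
    [[0, 2, 0, 0, 0, 0, 0], [1, 0, 2, 0, 0, 0, 0], [0, 1, 0, 2, 0, 0, 0], [0, 0, 1, 0, 1, 0, 0],
      [0, 0, 0, 1, 0, 2, 0], [0, 0, 0, 0, 1, 0, 2], [0, 0, 0, 0, 0, 1, 0]],
    [[0, 2, 0, 0, 0, 0, 0], [1, 0, 2, 0, 0, 0, 0], [0, 1, 0, 0, 2, 0, 0], [0, 0, 0, 0, 1, 2, 0],
      [0, 0, 1, 1, 0, 0, 0], [0, 0, 0, 1, 0, 0, 2], [0, 0, 0, 0, 0, 1, 0]],
    [[0, 2, 6, 0], [1, 0, 0, - 2], [0, 0, 0, 1], [0, 1, 5, 0]],
    [[0, 2, 0, 0, 0], [1, 0, 3, 19, 0], [0, 1, 0, 0, - 5], [0, 0, 0, 0, 1], [0, 0, 1, 7, 0]],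
    [[0]], [[0, 1], [1, 0]], [[0, 3, 0, 0], [1, 0, 2, 0], [0, 1, 0, 2], [0, 0, 1, 0]],
    [[0, 2, 0, 0], [1, 0, 2, 0], [0, 1, 0, 3], [0, 0, 1, 0]]]"

definition type_words :: "(int \<times> nat) list list list" where
  "type_words = [[[(1, 0)], [(1, 1)], [(1, 2)], [(1, 3)], [(1, 4)], [(1, 5)], [(1, 6)], [(1, 7)],
      [(1, 8)]],
    [[(1, 0)], [(1, 1)], [(1, 2)], [(1, 3)], [(1, 4)], [(1, 5)], [(1, 6)]],
    [[(1, 0)], [(1, 1)], [(1, 2)], [(1, 4), (- 6, 2)], [(1, 3)], [(1, 5), (- 7, 3)], [(1, 6)]],
    [[(1, 0)], [(1, 1)], [(1, 3)], [(1, 2)]], [[(1, 0)], [(1, 1)], [(1, 2)], [(1, 4)], [(1, 3)]],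
    [[(1, 0)]], [[(1, 0)], [(1, 1)]], [[(1, 0)], [(1, 1)], [(1, 2)], [(1, 3)]],
    [[(1, 0)], [(1, 1)], [(1, 2)], [(1, 3)]]]"

text \<open>In the first type \<open>E l *v pw l\<close> applied to the seed counts geodesics from
  the base vertex: the entries are the products \<open>c_1 ... c_l\<close>.\<close>

definition type_dens :: "int list list" where
  "type_dens = [[1, 1, 1, 1, 1, 2, 4, 8, 24], replicate 7 1, replicate 7 1, replicate 4 1, replicate 5 1,
    replicate 1 1, replicate 2 1, replicate 4 1, replicate 4 1]"

text \<open>For each type, a polynomial (constant coefficient first) in a self-adjoint element of the Terwilliger
  algebra supported on the endpoint level \<open>r\<close>.  Its value is a nonzero multiple, the last entry, of
  the projection onto the seeds of that type: the polynomial vanishes at the eigenvalues which the element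
  has on the level-\<open>r\<close> parts of the other types.\<close>

datatype gen_op = A_op | E_op nat

definition separators :: "(nat \<times> gen_op list list \<times> int list \<times> int) list" where
  "separators = [(0, [], [1], 1), (1, [[E_op 1, A_op, A_op, E_op 1]], [- 5, 1], - 3),
    (2, [[E_op 2, A_op, A_op, A_op, A_op, E_op 2]], [520, - 46, 1], 216),
    (3, [[E_op 3, A_op, A_op, A_op, A_op, E_op 3]], [123200, - 28480, 2316, - 80, 1], 19712),
    (3, [[E_op 3, A_op, A_op, A_op, A_op, E_op 3]], [73920, - 22016, 2036, - 76, 1], - 8640),
    (4, [[E_op 4, A_op, A_op, E_op 4], [E_op 4, A_op, E_op 3, A_op, E_op 4]], [- 107520, 348224,
      - 462064, 331439, - 142664, 38499, - 6560, 685, - 40, 1], - 107520),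
    (4, [[E_op 4, A_op, A_op, E_op 4], [E_op 4, A_op, E_op 3, A_op, E_op 4]], [0, 107520,
      - 240704, 221360, - 110079, 32585, - 5914, 646, - 39, 1], 5376),
    (4, [[E_op 4, A_op, A_op, E_op 4], [E_op 4, A_op, E_op 3, A_op, E_op 4]], [0, 35840, - 104128,
      119312, - 70709, 23985, - 4838, 574, - 37, 1], - 1920),
    (5, [[E_op 5, A_op, A_op, A_op, A_op, E_op 5]], [- 474059520, 1732570128, - 1759203264,
      585187683, - 92005636, 7888811, - 389016, 10977, - 164, 1], 484041600)]"

text \<open>Eigenvalues and eigenvectors, the pair \<open>(a, b)\<close> standing for \<open>a + b * sqrt 6\<close>.\<close>

definition type_evs :: "(int \<times> int) list list" where
  "type_evs = [[(3, 0), (0, 1), (2, 0), (1, 0), (0, 0), (- 1, 0), (- 2, 0), (0, - 1), (- 3, 0)],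
    [(0, 1), (2, 0), (1, 0), (0, 0), (- 1, 0), (- 2, 0), (0, - 1)],
    [(0, 1), (2, 0), (1, 0), (0, 0), (- 1, 0), (- 2, 0), (0, - 1)],
    [(2, 0), (1, 0), (- 1, 0), (- 2, 0)], [(0, 1), (1, 0), (0, 0), (- 1, 0), (0, - 1)], [(0, 0)],
    [(1, 0), (- 1, 0)], [(0, 1), (1, 0), (- 1, 0), (0, - 1)], [(0, 1), (1, 0), (- 1, 0), (0, - 1)]]"

definition type_evecs :: "(int \<times> int) list list list" where
  "type_evecs = [[[(1, 0), (1, 0), (1, 0), (1, 0), (1, 0), (1, 0), (1, 0), (1, 0), (1, 0)],
      [(- 24, 0), (0, - 8), (- 12, 0), (0, - 2), (0, 0), (0, 1), (6, 0), (0, 4), (12, 0)], [(12,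
      0), (8, 0), (2, 0), (- 2, 0), (- 3, 0), (- 2, 0), (2, 0), (8, 0), (12, 0)], [(- 6, 0), (- 2,
      0), (2, 0), (2, 0), (0, 0), (- 1, 0), (- 1, 0), (1, 0), (3, 0)], [(4, 0), (0, 0), (- 2, 0),
      (0, 0), (1, 0), (0, 0), (- 2, 0), (0, 0), (4, 0)], [(- 6, 0), (2, 0), (2, 0), (- 2, 0), (0,
      0), (1, 0), (- 1, 0), (- 1, 0), (3, 0)], [(12, 0), (- 8, 0), (2, 0), (2, 0), (- 3, 0), (2,
      0), (2, 0), (- 8, 0), (12, 0)], [(- 24, 0), (0, 8), (- 12, 0), (0, 2), (0, 0), (0, - 1), (6, 0), (0, - 4), (12, 0)], [(1, 0), (- 1, 0), (1, 0), (- 1, 0), (1, 0), (- 1, 0), (1, 0), (- 1, 0), (1, 0)]],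
    [[(8, 0), (0, 4), (8, 0), (0, 2), (4, 0), (0, 1), (1, 0)], [(- 4, 0), (- 4, 0), (- 2, 0), (0,
      0), (2, 0), (2, 0), (1, 0)], [(8, 0), (4, 0), (- 2, 0), (- 3, 0), (- 1, 0), (1, 0), (1, 0)],
      [(- 4, 0), (0, 0), (2, 0), (0, 0), (- 2, 0), (0, 0), (1, 0)], [(8, 0), (- 4, 0), (- 2, 0),
      (3, 0), (- 1, 0), (- 1, 0), (1, 0)], [(- 4, 0), (4, 0), (- 2, 0), (0, 0), (2, 0), (- 2, 0), (1, 0)], [(8, 0), (0, - 4), (8, 0), (0, - 2), (4, 0), (0, - 1), (1, 0)]],
    [[(8, 0), (0, 4), (8, 0), (4, 0), (0, 2), (0, 1), (1, 0)], [(- 4, 0), (- 4, 0), (- 2, 0), (2,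
      0), (0, 0), (2, 0), (1, 0)], [(8, 0), (4, 0), (- 2, 0), (- 1, 0), (- 3, 0), (1, 0), (1, 0)],
      [(- 4, 0), (0, 0), (2, 0), (- 2, 0), (0, 0), (0, 0), (1, 0)], [(8, 0), (- 4, 0), (- 2, 0),
      (- 1, 0), (3, 0), (- 1, 0), (1, 0)], [(- 4, 0), (4, 0), (- 2, 0), (2, 0), (0, 0), (- 2, 0), (1, 0)], [(8, 0), (0, - 4), (8, 0), (4, 0), (0, - 2), (0, - 1), (1, 0)]],
    [[(2, 0), (- 1, 0), (1, 0), (2, 0)], [(- 2, 0), (- 4, 0), (1, 0), (1, 0)], [(- 2, 0), (4, 0),
      (- 1, 0), (1, 0)], [(2, 0), (1, 0), (- 1, 0), (2, 0)]],
    [[(0, 8), (24, 0), (0, - 1), (0, 1), (6, 0)], [(- 2, 0), (- 1, 0), (- 6, 0), (1, 0), (1, 0)],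
      [(2, 0), (0, 0), (- 7, 0), (1, 0), (0, 0)], [(2, 0), (- 1, 0), (6, 0), (- 1, 0), (1, 0)],
      [(0, - 8), (24, 0), (0, 1), (0, - 1), (6, 0)]],
    [[(1, 0)]], [[(1, 0), (1, 0)], [(- 1, 0), (1, 0)]],
    [[(0, 2), (4, 0), (0, 1), (1, 0)], [(- 3, 0), (- 1, 0), (1, 0), (1, 0)], [(3, 0), (- 1, 0),
      (- 1, 0), (1, 0)], [(0, - 2), (4, 0), (0, - 1), (1, 0)]],
    [[(0, 1), (3, 0), (0, 1), (1, 0)], [(- 4, 0), (- 2, 0), (1, 0), (1, 0)], [(4, 0), (- 2, 0),
      (- 1, 0), (1, 0)], [(0, - 1), (3, 0), (0, - 1), (1, 0)]]]"

text \<open>The 19 modules, with the coordinates of each basis vector on its level.\<close>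

definition module_types :: "nat list" where
  "module_types = [0, 1, 1, 2, 2, 2, 3, 3, 3, 4, 4, 4, 5, 6, 6, 6, 7, 7, 8]"

definition module_slices :: "int list list list" where
  "module_slices = [[[1], [1, 1, 1], [1, 1, 1, 1, 1, 1], [1, 1, 1, 1, 1, 1, 1, 1, 1, 1, 1, 1], [1,
      1, 1, 1, 1, 1, 1, 1, 1, 1, 1, 1, 1, 1, 1, 1, 1, 1, 1, 1, 1, 1, 1, 1], [1, 1, 1, 1, 1, 1, 1,
      1, 1, 1, 1, 1, 1, 1, 1, 1, 1, 1, 1, 1, 1, 1, 1, 1], [1, 1, 1, 1, 1, 1, 1, 1, 1, 1, 1, 1],
      [1, 1, 1, 1, 1, 1], [1, 1]],
    [[1, - 1, 0], [1, 1, - 1, - 1, 0, 0], [1, 1, 1, 1, 0, 0, 0, 0, - 1, - 1, - 1, - 1], [1, 1, 1,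
      1, 1, 1, 1, 1, 0, 0, 0, 0, 0, 0, 0, 0, - 1, - 1, - 1, - 1, - 1, - 1, - 1, - 1], [- 1, - 1,
      - 1, - 1, - 1, - 1, - 1, - 1, 1, 1, 1, 1, 1, 1, 1, 1, 0, 0, 0, 0, 0, 0, 0, 0], [- 2, - 2, 2, 2, 0, 0, - 2, - 2, 2, 2, 0, 0], [- 4, 4, 0, - 4, 4, 0]],
    [[1, 1, - 2], [1, 1, 1, 1, - 2, - 2], [1, 1, 1, 1, - 2, - 2, - 2, - 2, 1, 1, 1, 1], [1, 1, 1,
      1, 1, 1, 1, 1, - 2, - 2, - 2, - 2, - 2, - 2, - 2, - 2, 1, 1, 1, 1, 1, 1, 1, 1], [- 1, - 1,
      - 1, - 1, - 1, - 1, - 1, - 1, - 1, - 1, - 1, - 1, - 1, - 1, - 1, - 1, 2, 2, 2, 2, 2, 2, 2, 2], [- 2, - 2, - 2, - 2, 4, 4, - 2, - 2, - 2, - 2, 4, 4], [- 4, - 4, 8, - 4, - 4, 8]],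
    [[1, - 1, 0, 0, 0, 0], [1, 1, - 1, - 1, 0, 0, 0, 0, 0, 0, 0, 0], [1, 1, 1, 1, - 1, - 1, - 1,
      - 1, 0, 0, 0, 0, 0, 0, 0, 0, 0, 0, 0, 0, 0, 0, 0, 0], [0, 0, 0, 0, 0, 0, 0, 0, - 1, 1, - 1,
      1, - 1, 1, 1, - 1, - 1, 1, - 1, 1, - 1, 1, 1, - 1], [0, 0, 0, 0, 0, 0, 0, 0, 1, - 1, - 1, 1,
      - 1, 1, - 1, 1, - 1, 1, - 1, 1, - 1, 1, 1, - 1], [- 2, - 2, - 2, - 2, 2, 2, 2, 2, 0, 0, 0, 0, 0, 0, 0, 0, 0, 0, 0, 0, 0, 0, 0, 0], [- 4, 4, 0, 0, 0, 0, - 4, 4, 0, 0, 0, 0]],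
    [[0, 0, 1, - 1, 0, 0], [0, 0, 0, 0, 0, 0, 0, 0, - 1, - 1, 1, 1], [0, 0, 0, 0, 0, 0, 0, 0, 0,
      0, 0, 0, 0, 0, 0, 0, - 1, - 1, - 1, - 1, 1, 1, 1, 1], [- 1, 1, - 1, 1, - 1, 1, - 1, 1, - 1,
      1, - 1, 1, 1, - 1, - 1, 1, 0, 0, 0, 0, 0, 0, 0, 0], [1, - 1, - 1, 1, - 1, 1, - 1, 1, 0, 0,
      0, 0, 0, 0, 0, 0, 1, - 1, 1, - 1, - 1, 1, 1, - 1], [0, 0, 0, 0, 0, 0, 0, 0, - 2, - 2, - 2, - 2, 2, 2, 2, 2, 0, 0, 0, 0, 0, 0, 0, 0], [0, 0, - 4, 4, 0, 0, 0, 0, - 4, 4, 0, 0]],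
    [[0, 0, 0, 0, 1, - 1], [0, 0, 0, 0, 1, 1, - 1, - 1, 0, 0, 0, 0], [0, 0, 0, 0, 0, 0, 0, 0, 1,
      1, 1, 1, - 1, - 1, - 1, - 1, 0, 0, 0, 0, 0, 0, 0, 0], [- 1, 1, - 1, 1, 1, - 1, 1, - 1, 0, 0,
      0, 0, 0, 0, 0, 0, 1, - 1, 1, - 1, - 1, 1, 1, - 1], [- 1, 1, 1, - 1, - 1, 1, - 1, 1, - 1, 1,
      1, - 1, - 1, 1, - 1, 1, 0, 0, 0, 0, 0, 0, 0, 0], [0, 0, 0, 0, 0, 0, 0, 0, 0, 0, 0, 0, 0, 0, 0, 0, - 2, - 2, - 2, - 2, 2, 2, 2, 2], [0, 0, 0, 0, - 4, 4, 0, 0, 0, 0, - 4, 4]],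
    [[0, 0, 0, 0, 1, - 1, - 1, 1, 1, - 1, - 1, 1], [0, 0, 0, 0, 0, 0, 0, 0, 1, 1, - 1, - 1, - 1,
      - 1, 1, 1, 1, 1, - 1, - 1, - 1, - 1, 1, 1], [2, - 2, - 2, 2, 2, - 2, - 2, 2, 3, 3, - 3, - 3, - 3, - 3, 3, 3, 3, 3, - 3, - 3, - 3, - 3, 3, 3], [0, 0, 0, 0, 0, 0, 0, 0, 1, 1, - 1, - 1, - 1, - 1, 1, 1, 1, 1, - 1, - 1, - 1, - 1, 1, 1]],
    [[2, - 2, 0, 0, 1, - 1, 1, - 1, - 1, 1, - 1, 1], [2, 2, - 2, - 2, 0, 0, 0, 0, 1, 1, - 1, - 1,
      1, 1, - 1, - 1, - 1, - 1, 1, 1, - 1, - 1, 1, 1], [6, 6, - 6, - 6, 0, 0, 0, 0, 5, 1, - 5, - 1, 5, 1, - 1, - 5, - 5, - 1, 5, 1, - 5, - 1, 1, 5], [2, 2, - 2, - 2, 0, 0, 0, 0, 1, 1, - 1, - 1, 1, 1, - 1, - 1, 1, 1, - 1, - 1, 1, 1, - 1, - 1]],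
    [[0, 0, 2, - 2, - 1, 1, - 1, 1, - 1, 1, - 1, 1], [0, 0, 0, 0, 2, 2, - 2, - 2, - 1, - 1, 1, 1,
      - 1, - 1, 1, 1, - 1, - 1, 1, 1, - 1, - 1, 1, 1], [0, 0, 0, 0, 6, 6, - 6, - 6, - 1, - 5, 1, 5, - 1, - 5, 5, 1, - 1, - 5, 1, 5, - 1, - 5, 5, 1], [0, 0, 0, 0, 2, 2, - 2, - 2, 1, 1, - 1, - 1, 1, 1, - 1, - 1, - 1, - 1, 1, 1, - 1, - 1, 1, 1]],
    [[0, 0, 0, 0, 1, - 1, - 1, 1, - 1, 1, 1, - 1], [0, 0, 0, 0, 0, 0, 0, 0, 1, 1, - 1, - 1, - 1,
      - 1, 1, 1, - 1, - 1, 1, 1, 1, 1, - 1, - 1], [- 2, 2, - 2, 2, 2, - 2, - 2, 2, 1, 1, - 1, - 1,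
      - 1, - 1, 1, 1, - 1, - 1, 1, 1, 1, 1, - 1, - 1], [- 14, 14, - 14, 14, 14, - 14, - 14, 14, 5, 5, - 5, - 5, - 5, - 5, 5, 5, - 5, - 5, 5, 5, 5, 5, - 5, - 5], [4, - 4, 0, 0, 0, 0, - 4, 4, 0, 0, 0, 0]],
    [[1, - 1, - 1, 1, - 1, 1, - 1, 1, 0, 0, 0, 0], [1, 1, - 1, - 1, - 1, - 1, 1, 1, - 1, - 1, 1,
      1, - 1, - 1, 1, 1, 0, 0, 0, 0, 0, 0, 0, 0], [- 1, - 1, 1, 1, 1, 1, - 1, - 1, 2, - 2, 2, - 2,
      - 2, 2, 2, - 2, 1, 1, - 1, - 1, 1, 1, - 1, - 1], [- 5, - 5, 5, 5, 5, 5, - 5, - 5, 14, - 14, 14, - 14, - 14, 14, 14, - 14, 5, 5, - 5, - 5, 5, 5, - 5, - 5], [0, 0, 4, - 4, 0, 0, 0, 0, - 4, 4, 0, 0]],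
    [[1, - 1, 1, - 1, 0, 0, 0, 0, 1, - 1, 1, - 1], [1, 1, - 1, - 1, 1, 1, - 1, - 1, 0, 0, 0, 0, 0,
      0, 0, 0, 1, 1, - 1, - 1, 1, 1, - 1, - 1], [- 1, - 1, 1, 1, - 1, - 1, 1, 1, 1, 1, - 1, - 1,
      1, 1, - 1, - 1, - 2, 2, 2, - 2, - 2, 2, - 2, 2], [- 5, - 5, 5, 5, - 5, - 5, 5, 5, 5, 5, - 5, - 5, 5, 5, - 5, - 5, - 14, 14, 14, - 14, - 14, 14, - 14, 14], [0, 0, 0, 0, - 4, 4, 0, 0, 0, 0, 4, - 4]],
    [[1, - 1, - 1, 1, - 1, 1, 1, - 1, 1, - 1, - 1, 1, - 1, 1, - 1, 1, 1, - 1, - 1, 1, - 1, 1, - 1, 1]],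
    [[1, - 1, 1, - 1, 1, - 1, 1, - 1, - 1, 1, - 1, 1, 1, - 1, - 1, 1, 0, 0, 0, 0, 0, 0, 0, 0], [1,
      - 1, - 1, 1, - 1, 1, - 1, 1, 0, 0, 0, 0, 0, 0, 0, 0, - 1, 1, - 1, 1, 1, - 1, - 1, 1]],
    [[- 1, 1, - 1, 1, 1, - 1, 1, - 1, 1, - 1, 1, - 1, 1, - 1, - 1, 1, - 2, 2, - 2, 2, 0, 0, 0, 0],
      [1, - 1, - 1, 1, 1, - 1, 1, - 1, - 2, 2, 2, - 2, 0, 0, 0, 0, - 1, 1, - 1, 1, - 1, 1, 1, - 1]],
    [[1, - 1, 1, - 1, - 1, 1, - 1, 1, 1, - 1, 1, - 1, 1, - 1, - 1, 1, 0, 0, 0, 0, - 2, 2, 2, - 2],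
      [- 1, 1, 1, - 1, - 1, 1, - 1, 1, 0, 0, 0, 0, 2, - 2, 2, - 2, - 1, 1, - 1, 1, - 1, 1, 1, - 1]],
    [[1, - 1, - 1, 1, - 1, 1, 1, - 1, - 1, 1, 1, - 1, 1, - 1, 1, - 1, 0, 0, 0, 0, 0, 0, 0, 0], [1,
      - 1, 1, - 1, 1, - 1, - 1, 1, 2, - 2, 2, - 2, 2, - 2, - 2, 2, - 1, 1, 1, - 1, 1, - 1, 1, - 1], [- 2, - 2, 4, 4, - 2, - 2, 2, 2, - 4, - 4, 2, 2], [- 4, 8, - 4, 4, - 8, 4]],
    [[1, - 1, - 1, 1, - 1, 1, 1, - 1, 1, - 1, - 1, 1, - 1, 1, - 1, 1, - 2, 2, 2, - 2, 2, - 2, 2,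
      - 2], [- 3, 3, - 3, 3, - 3, 3, 3, - 3, 0, 0, 0, 0, 0, 0, 0, 0, - 3, 3, 3, - 3, 3, - 3, 3,
      - 3], [6, 6, 0, 0, - 6, - 6, - 6, - 6, 0, 0, 6, 6], [12, 0, - 12, - 12, 0, 12]],
    [[1, - 1, 1, - 1, 1, - 1, - 1, 1, - 1, 1, - 1, 1, - 1, 1, 1, - 1, - 1, 1, 1, - 1, 1, - 1, 1,
      - 1], [- 2, - 2, - 2, - 2, - 2, - 2, 2, 2, 2, 2, 2, 2], [- 4, - 4, - 4, 4, 4, 4], [- 12,
      12]]]"

text \<open>Positions, within the levels below and above, of the neighbours of each vertex.\<close>

definition down_nbs :: "nat list list list" where
  "down_nbs = [[[]], [[0], [0], [0]], [[0], [0], [1], [1], [2], [2]],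
    [[0], [0], [1], [1], [4], [4], [5], [5], [3], [3], [2], [2]],
    [[0], [0], [1], [1], [2], [2], [3], [3], [4], [4], [5], [5], [6], [6], [7], [7], [8], [8],
      [9], [9], [10], [10], [11], [11]],
    [[23, 12], [8, 18], [16, 10], [15, 20], [14, 19], [22, 11], [17, 13], [9, 21], [0, 14], [8,
      4], [6, 10], [13, 2], [12, 5], [1, 11], [7, 15], [9, 3], [23, 7], [0, 17], [5, 20], [19, 2],
      [18, 6], [1, 21], [22, 3], [4, 16]],
    [[1, 3], [5, 6], [8, 10], [12, 15], [16, 19], [21, 23], [0, 2], [4, 7], [9, 11], [13, 14],
      [17, 18], [20, 22]],
    [[0, 1], [2, 3], [4, 5], [6, 7], [8, 9], [10, 11]], [[0, 1, 2], [3, 4, 5]]]"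

definition up_nbs :: "nat list list list" where
  "up_nbs = [[[0, 1, 2]], [[0, 1], [2, 3], [4, 5]], [[0, 1], [2, 3], [11, 10], [9, 8], [4, 5], [6,
      7]],
    [[0, 1], [3, 2], [4, 5], [7, 6], [8, 9], [11, 10], [12, 13], [14, 15], [17, 16], [18, 19],
      [21, 20], [23, 22]],
    [[8, 17], [13, 21], [11, 19], [15, 22], [9, 23], [12, 18], [10, 20], [14, 16], [1, 9], [7,
      15], [2, 10], [5, 13], [0, 12], [6, 11], [4, 8], [3, 14], [2, 23], [6, 17], [1, 20], [4,
      19], [3, 18], [7, 21], [5, 22], [0, 16]],
    [[6], [0], [6], [0], [7], [1], [1], [7], [2], [8], [2], [8], [3], [9], [9], [3], [4], [10],
      [10], [4], [11], [5], [11], [5]],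
    [[0], [0], [1], [1], [2], [2], [3], [3], [4], [4], [5], [5]], [[0], [0], [0], [1], [1], [1]],
    [[], []]]"

subsection \<open>Checks on types\<close>

text \<open>These functions are recursive rather than built from \<open>map\<close> and \<open>foldr\<close>, as evaluation by
  simplification would expand the bodies of the abstractions symbolically.\<close>

fun scal :: "int \<Rightarrow> int list \<Rightarrow> int list" where
  "scal a [] = []"
| "scal a (c # cs) = a * c # scal a cs"

fun list_plus :: "int list \<Rightarrow> int list \<Rightarrow> int list" where
  "list_plus (a # as) (c # cs) = (a + c) # list_plus as cs"
| "list_plus _ _ = []"

fun dot :: "int list \<Rightarrow> int list \<Rightarrow> int" where
  "dot (a # as) (c # cs) = a * c + dot as cs"
| "dot _ _ = 0"

fun mat_app :: "int list list \<Rightarrow> int list \<Rightarrow> int list" where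
  "mat_app [] c = []"
| "mat_app (r # M) c = dot r c # mat_app M c"

fun level_mask :: "nat list \<Rightarrow> nat \<Rightarrow> int list \<Rightarrow> int list" where
  "level_mask (l' # ls) l (a # c) = (if l' = l then a else 0) # level_mask ls l c"
| "level_mask _ _ _ = []"

fun coord_op :: "nat list \<Rightarrow> int list list \<Rightarrow> gen_op \<Rightarrow> int list \<Rightarrow> int list" where
  "coord_op ls M A_op c = mat_app M c"
| "coord_op ls M (E_op l) c = level_mask ls l c"

fun coord_word :: "nat list \<Rightarrow> int list list \<Rightarrow> gen_op list \<Rightarrow> int list \<Rightarrow> int list" where
  "coord_word ls M [] c = c"
| "coord_word ls M (g # w) c = coord_op ls M g (coord_word ls M w c)"

fun coord_sum :: "nat list \<Rightarrow> int list list \<Rightarrow> gen_op list list \<Rightarrow> int list \<Rightarrow> int list" where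
  "coord_sum ls M [] c = scal 0 c"
| "coord_sum ls M (w # ws) c = list_plus (coord_word ls M w c) (coord_sum ls M ws c)"

text \<open>Horner scheme for a polynomial in the sum of the words \<open>ws\<close>. Here
  \<open>scal 0 c\<close> is the zero vector of the right length.\<close>

fun coord_poly :: "nat list \<Rightarrow> int list list \<Rightarrow> gen_op list list \<Rightarrow> int list \<Rightarrow> int list \<Rightarrow> int list" where
  "coord_poly ls M ws [] c = scal 0 c"
| "coord_poly ls M ws (a # cs) c = list_plus (scal a c) (coord_sum ls M ws (coord_poly ls M ws cs c))"

definition unit_list :: "nat \<Rightarrow> nat \<Rightarrow> int list" where
  "unit_list n j = map (\<lambda>i. if i = j then 1 else 0) [0..<n]"

text \<open>Basis vectors off level \<open>r\<close> are exempt, since the projection begins by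
  applying \<open>E r\<close>.\<close>

definition separator_ok :: "nat \<Rightarrow> nat \<Rightarrow> nat \<Rightarrow> bool" where
  "separator_ok t t' j \<longleftrightarrow> (case separators ! t of (r, ws, cs, dn) \<Rightarrow>
     let ls = type_levels ! t' in
     ls ! j \<noteq> r \<or> coord_poly ls (type_mats ! t') ws cs (unit_list (length ls) j) =
       (if t = t' \<and> j = 0 then scal dn (unit_list (length ls) 0) else replicate (length ls) 0))"

text \<open>Each polynomial is a product of factors coming from the other types. On level 4, for
  instance, the element has the values 8, 5, 7, 0, 1, 3 on types I, II, V, VI, VII, VIII, and the
  characteristic polynomials \<open>x^2 - 9x + 16\<close> and \<open>x^2 - 7x + 8\<close> on types
  III and IV; leaving out the factor of VI, VII or VIII yields the polynomial for that type.\<close>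

lemma separators_ok_0: "list_all (\<lambda>t. list_all (\<lambda>t'. list_all (separator_ok t t') [0..<length (type_levels ! t')]) [0..<9]) [0..<5]"
  by code_simp

lemma separators_ok_5: "list_all (\<lambda>t. list_all (\<lambda>t'. list_all (separator_ok t t') [0..<length (type_levels ! t')]) [0..<9]) [5..<9]"
  by code_simp

text \<open>Palindromic words give self-adjoint matrices; beginning, and hence also ending, with
  \<open>E_op r\<close> confines them to level \<open>r\<close>.\<close>

definition separator_wf :: "nat \<Rightarrow> bool" where
  "separator_wf t \<longleftrightarrow> (case separators ! t of (r, ws, cs, dn) \<Rightarrow> dn \<noteq> 0 \<and> r \<le> 8 \<and> r = type_levels ! t ! 0 \<and>
     list_all (\<lambda>w. rev w = w \<and> hd w = E_op r \<and> w \<noteq> [] \<and>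
       list_all (\<lambda>g. case g of A_op \<Rightarrow> True | E_op l \<Rightarrow> l \<le> 8) w) ws)"

lemma separators_wf: "list_all separator_wf [0..<9]"
  by code_simp

fun mat_pow :: "int list list \<Rightarrow> nat \<Rightarrow> int list \<Rightarrow> int list" where
  "mat_pow M 0 c = c"
| "mat_pow M (Suc k) c = mat_app M (mat_pow M k c)"

fun word_comb :: "nat list \<Rightarrow> int list list \<Rightarrow> nat \<Rightarrow> (int \<times> nat) list \<Rightarrow> int list \<Rightarrow> int list" where
  "word_comb ls M l [] c = scal 0 c"
| "word_comb ls M l ((a, k) # ws) c = list_plus (scal a (level_mask ls l (mat_pow M k c))) (word_comb ls M l ws c)"

definition word_ok :: "nat \<Rightarrow> nat \<Rightarrow> bool" where
  "word_ok t i \<longleftrightarrow> (let ls = type_levels ! t; n = length ls; dn = type_dens ! t ! i in dn \<noteq> 0 \<and>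
     word_comb ls (type_mats ! t) (ls ! i) (type_words ! t ! i) (unit_list n 0) = scal dn (unit_list n i))"

lemma words_ok: "list_all (\<lambda>t. list_all (word_ok t) [0..<length (type_levels ! t)]) [0..<9]"
  by code_simp

definition type_wf :: "nat \<Rightarrow> bool" where
  "type_wf t \<longleftrightarrow> (let ls = type_levels ! t; n = length ls in n > 0 \<and> length (type_mats ! t) = n \<and>
     list_all (\<lambda>row. length row = n) (type_mats ! t) \<and> list_all (\<lambda>l. l \<le> 8 \<and> ls ! 0 \<le> l) ls \<and> sorted ls \<and>
     length (type_evs ! t) = n \<and> distinct (type_evs ! t) \<and> list_all (\<lambda>k. k = 0 \<or> ls ! k \<noteq> ls ! 0) [0..<n])"

lemma types_wf: "list_all type_wf [0..<9]"
  by code_simp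

definition pair_mult :: "int \<times> int \<Rightarrow> int \<times> int \<Rightarrow> int \<times> int" where
  "pair_mult p r = (fst p * fst r + 6 * (snd p * snd r), fst p * snd r + snd p * fst r)"

text \<open>The type matrices are integral, so they act separately on the rational part and on the
  coefficient of \<open>sqrt 6\<close>.\<close>

definition evec_ok :: "nat \<Rightarrow> nat \<Rightarrow> bool" where
  "evec_ok t k \<longleftrightarrow> (let v = type_evecs ! t ! k; e = type_evs ! t ! k; n = length (type_levels ! t) in
     length v = n \<and> list_ex (\<lambda>p. p \<noteq> (0, 0)) v \<and>
     map (\<lambda>row. (dot row (map fst v), dot row (map snd v))) (type_mats ! t) =
       map (pair_mult e) v)"

lemma evecs_ok: "list_all (\<lambda>t. list_all (evec_ok t) [0..<length (type_levels ! t)]) [0..<9]"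
  by code_simp

subsection \<open>Checks on modules\<close>

definition level_sizes :: "nat list" where
  "level_sizes = [1, 3, 6, 12, 24, 24, 12, 6, 2]"

fun gather :: "int list \<Rightarrow> nat list \<Rightarrow> int" where
  "gather s [] = 0"
| "gather s (p # ps) = s ! p + gather s ps"

text \<open>\<open>A\<close> changes the level by exactly one. An entry on level \<open>l'\<close>
  is the sum over the neighbours of that vertex on level \<open>l\<close>, hence the table of the
  target level is read.\<close>

definition A_slice :: "nat \<Rightarrow> nat \<Rightarrow> int list \<Rightarrow> int list" where
  "A_slice l' l s =
     (if l' = Suc l then map (\<lambda>ps. gather s ps) (down_nbs ! l')
      else if Suc l' = l then map (\<lambda>ps. gather s ps) (up_nbs ! l')
      else replicate (level_sizes ! l') 0)"

text \<open>Zero coefficients are skipped only to shorten the evaluation; the value is the part on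
  level \<open>l\<close> of the linear combination.\<close>

fun slice_comb :: "nat \<Rightarrow> nat \<Rightarrow> nat list \<Rightarrow> int list \<Rightarrow> int list list \<Rightarrow> int list" where
  "slice_comb sz l (l' # ls) (a # c) (s # ss) =
     (if l' = l \<and> a \<noteq> 0 then list_plus (scal a s) (slice_comb sz l ls c ss) else slice_comb sz l ls c ss)"
| "slice_comb sz l _ _ _ = replicate sz 0"

definition module_ok :: "nat \<Rightarrow> bool" where
  "module_ok w \<longleftrightarrow> (let t = module_types ! w; ls = type_levels ! t; ss = module_slices ! w in t < 9 \<and> length ss = length ls \<and>
     list_all2 (\<lambda>l s. length s = level_sizes ! l) ls ss \<and>
     list_all (\<lambda>j. list_all (\<lambda>l'. A_slice l' (ls ! j) (ss ! j) =
         slice_comb (level_sizes ! l') l' ls (map (\<lambda>row. row ! j) (type_mats ! t)) ss) [0..<9]) [0..<length ls])"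

lemma modules_ok: "list_all module_ok [0..<19]"
  by code_simp

text \<open>Vectors on different levels are independent of each other, and no level carries more
  than two basis vectors of a module: a single one must be nonzero, two must have a nonzero 2 by 2
  minor.\<close>

definition independent_ok :: "nat \<Rightarrow> nat \<Rightarrow> bool" where
  "independent_ok w i \<longleftrightarrow> (let ls = type_levels ! (module_types ! w); ss = module_slices ! w; l = ls ! i; s = ss ! i;
       ks = [0..<level_sizes ! l] in
     (case filter (\<lambda>j. ls ! j = l \<and> j \<noteq> i) [0..<length ls] of
       [] \<Rightarrow> list_ex (\<lambda>p. s ! p \<noteq> 0) ks
     | [j] \<Rightarrow> list_ex (\<lambda>p. list_ex (\<lambda>r. s ! p * (ss ! j) ! r \<noteq> s ! r * (ss ! j) ! p) ks) ks
     | _ \<Rightarrow> False))"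

lemma independents_ok: "list_all (\<lambda>w. list_all (independent_ok w) [0..<length (type_levels ! (module_types ! w))]) [0..<19]"
  by code_simp

lemma seeds_ok: "list_all (\<lambda>w. list_all (\<lambda>w'. w = w' \<or> module_types ! w \<noteq> module_types ! w' \<or>
    dot (module_slices ! w ! 0) (module_slices ! w' ! 0) = 0) [0..<19]) [0..<19]"
  by code_simp

lemma types_realised: "list_all (\<lambda>t. list_ex (\<lambda>w. module_types ! w = t) [0..<19]) [0..<9]"
  by code_simp

section \<open>Slice vectors\<close>

text \<open>Partial sums of \<open>level_sizes\<close>; the closing 90 serves \<open>Suc l\<close>
  at the last level.\<close>

definition level_offsets :: "nat list" where
  "level_offsets = [0, 1, 4, 10, 22, 46, 70, 82, 88, 90]"

definition level_list :: "nat list" where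
  "level_list =
   [0, 1, 1, 1, 2, 2, 2, 2, 2, 2, 3, 3, 3, 3, 3, 3, 3, 3, 3, 3, 3, 3, 4, 4, 4, 4, 4, 4, 4, 4, 4,
    4, 4, 4, 4, 4, 4, 4, 4, 4, 4, 4, 4, 4, 4, 4, 5, 5, 5, 5, 5, 5, 5, 5, 5, 5, 5, 5, 5, 5, 5, 5,
    5, 5, 5, 5, 5, 5, 5, 5, 6, 6, 6, 6, 6, 6, 6, 6, 6, 6, 6, 6, 7, 7, 7, 7, 7, 7, 8, 8]"

definition pos_list :: "nat list" where
  "pos_list =
   [0, 0, 1, 2, 0, 1, 2, 3, 4, 5, 0, 1, 2, 3, 4, 5, 6, 7, 8, 9, 10, 11, 0, 1, 2, 3, 4, 5, 6, 7,
    8, 9, 10, 11, 12, 13, 14, 15, 16, 17, 18, 19, 20, 21, 22, 23, 0, 1, 2, 3, 4, 5, 6, 7, 8, 9,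
    10, 11, 12, 13, 14, 15, 16, 17, 18, 19, 20, 21, 22, 23, 0, 1, 2, 3, 4, 5, 6, 7, 8, 9, 10, 11,
    0, 1, 2, 3, 4, 5, 0, 1]"

fun positions_from :: "nat \<Rightarrow> nat list \<Rightarrow> nat list \<Rightarrow> bool" where
  "positions_from n (l # ls) (k # ks) \<longleftrightarrow>
     l < 9 \<and> k < level_sizes ! l \<and> level_offsets ! l + k = n \<and> positions_from (Suc n) ls ks"
| "positions_from n [] [] \<longleftrightarrow> True"
| "positions_from _ _ _ \<longleftrightarrow> False"

lemma positions_ok: "positions_from 0 level_list pos_list" "length level_list = 90"
  by code_simp+

lemma offsets_ok: "list_all (\<lambda>l. level_offsets ! l + level_sizes ! l = level_offsets ! Suc l \<and> level_offsets ! Suc l \<le> 90) [0..<9]"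
  "sorted level_offsets"
  by code_simp+

definition same_set :: "nat list \<Rightarrow> nat list \<Rightarrow> bool" where
  "same_set a b \<longleftrightarrow> set a = set b"

text \<open>At \<open>l = 0\<close> and \<open>l = 8\<close> the adjacent level does not exist, and
  the emptiness conditions keep the truncated \<open>l - 1\<close> and the overrunning
  \<open>Suc l\<close> harmless. Nonempty \<open>ds\<close> elsewhere means that every vertex has a
  neighbour one level below, which bounds distances from above.\<close>

fun rows_ok :: "nat \<Rightarrow> nat list list \<Rightarrow> nat list list \<Rightarrow> nat list list \<Rightarrow> bool" where
  "rows_ok l (ds # D) (us # U) (ns # N) \<longleftrightarrow> distinct ds \<and> distinct us \<and>
     (l = 0 \<or> ds \<noteq> []) \<and> (l = 0 \<longrightarrow> ds = []) \<and> (l = 8 \<longrightarrow> us = []) \<and>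
     list_all (\<lambda>p. p < level_sizes ! (l - 1)) ds \<and> list_all (\<lambda>p. p < level_sizes ! Suc l) us \<and>
     same_set ns (map ((+) (level_offsets ! (l - 1))) ds @ map ((+) (level_offsets ! Suc l)) us) \<and> rows_ok l D U N"
| "rows_ok l [] [] [] \<longleftrightarrow> True"
| "rows_ok _ _ _ _ \<longleftrightarrow> False"

definition level_rows_ok :: "nat \<Rightarrow> bool" where
  "level_rows_ok l \<longleftrightarrow> length (down_nbs ! l) = level_sizes ! l \<and> length (up_nbs ! l) = level_sizes ! l \<and>
     rows_ok l (down_nbs ! l) (up_nbs ! l) (take (level_sizes ! l) (drop (level_offsets ! l) foster_nbs))"

lemma nbs_ok: "list_all level_rows_ok [0..<9]" "length foster_nbs = 90"
  by code_simp+

section \<open>From evaluated checks to indexed facts\<close>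

lemma positions_from_nth:
  "positions_from n ls ks \<Longrightarrow> i < length ls \<Longrightarrow>
    ls ! i < 9 \<and> ks ! i < level_sizes ! (ls ! i) \<and> level_offsets ! (ls ! i) + ks ! i = n + i"
  by (induction n ls ks arbitrary: i rule: positions_from.induct) (auto simp: nth_Cons split: nat.splits)

lemma rows_ok_nth:
  "rows_ok l D U N \<Longrightarrow> k < length D \<Longrightarrow> distinct (D ! k) \<and> distinct (U ! k) \<and>
     (l = 0 \<or> D ! k \<noteq> []) \<and> (l = 0 \<longrightarrow> D ! k = []) \<and> (l = 8 \<longrightarrow> U ! k = []) \<and>
     (\<forall>p\<in>set (D ! k). p < level_sizes ! (l - 1)) \<and> (\<forall>p\<in>set (U ! k). p < level_sizes ! Suc l) \<and>
     set (N ! k) = (+) (level_offsets ! (l - 1)) ` set (D ! k) \<union> (+) (level_offsets ! Suc l) ` set (U ! k)"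
proof (induction l D U N arbitrary: k rule: rows_ok.induct)
  case (1 l ds D us U ns N)
  then show ?case by (cases k) (simp_all add: same_set_def list_all_iff)
qed auto

lemma words_first: "list_all (\<lambda>t. type_words ! t ! 0 = [(1, 0)] \<and> type_dens ! t ! 0 = 1) [0..<9]"
  by code_simp

lemma total_ok: "sum_list (map (\<lambda>w. length (type_levels ! (module_types ! w))) [0..<19]) = 90"
  by code_simp

lemma list_all_upt: "list_all Q [0..<n] \<longleftrightarrow> (\<forall>i<n. Q i)"
  by (auto simp: list_all_iff)

lemma length_scal [simp]: "length (scal a c) = length c"
  by (induction c) auto

lemma nth_scal: "i < length c \<Longrightarrow> scal a c ! i = a * c ! i"
  by (induction c arbitrary: i) (auto simp: nth_Cons split: nat.splits)

lemma length_list_plus [simp]: "length (list_plus c e) = min (length c) (length e)"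
  by (induction c e rule: list_plus.induct) auto

lemma nth_list_plus: "i < length c \<Longrightarrow> i < length e \<Longrightarrow> list_plus c e ! i = c ! i + e ! i"
  by (induction c e arbitrary: i rule: list_plus.induct) (auto simp: nth_Cons split: nat.splits)

lemma dot_sum: "length r = length c \<Longrightarrow> dot r c = (\<Sum>i<length c. r ! i * c ! i)"
  by (induction r c rule: dot.induct) (auto simp: sum.lessThan_Suc_shift simp del: sum.lessThan_Suc)

lemma length_mat_app [simp]: "length (mat_app M c) = length M"
  by (induction M) auto

lemma nth_mat_app: "i < length M \<Longrightarrow> mat_app M c ! i = dot (M ! i) c"
  by (induction M arbitrary: i) (auto simp: nth_Cons split: nat.splits)

lemma length_level_mask [simp]: "length (level_mask ls l c) = min (length ls) (length c)"
  by (induction ls l c rule: level_mask.induct) auto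

lemma nth_level_mask:
  "i < length ls \<Longrightarrow> i < length c \<Longrightarrow> level_mask ls l c ! i = (if ls ! i = l then c ! i else 0)"
  by (induction ls l c arbitrary: i rule: level_mask.induct) (auto simp: nth_Cons split: nat.splits)

lemma length_unit_list [simp]: "length (unit_list n j) = n"
  by (simp add: unit_list_def)

lemma nth_unit_list: "i < n \<Longrightarrow> unit_list n j ! i = (if i = j then 1 else 0)"
  by (simp add: unit_list_def)

lemma gather_sum: "distinct ps \<Longrightarrow> gather s ps = (\<Sum>p\<in>set ps. s ! p)"
  by (induction ps) auto

lemma slice_comb_nth:
  assumes "length c = length ls" "length ss = length ls" "k < sz"
    and "\<And>i. i < length ls \<Longrightarrow> ls ! i = l \<Longrightarrow> length (ss ! i) = sz"
  shows "length (slice_comb sz l ls c ss) = sz \<and>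
    slice_comb sz l ls c ss ! k = (\<Sum>i<length ls. if ls ! i = l then c ! i * ss ! i ! k else 0)"
  using assms
proof (induction sz l ls c ss rule: slice_comb.induct)
  case (1 sz l l' ls a c s ss)
  have IH: "length (slice_comb sz l ls c ss) = sz \<and>
      slice_comb sz l ls c ss ! k = (\<Sum>i<length ls. if ls ! i = l then c ! i * ss ! i ! k else 0)"
    by (cases "l' = l \<and> a \<noteq> 0"; rule "1.IH") (use "1.prems" "1.prems"(4)[of "Suc _"] in auto)
  have shift: "(\<Sum>i<length (l' # ls). if (l' # ls) ! i = l then (a # c) ! i * (s # ss) ! i ! k else 0) =
      (if l' = l then a * s ! k else 0) + (\<Sum>i<length ls. if ls ! i = l then c ! i * ss ! i ! k else 0)"
    by (simp add: sum.lessThan_Suc_shift del: sum.lessThan_Suc cong: if_cong)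
  have s: "l' = l \<Longrightarrow> length s = sz" using "1.prems"(4)[of 0] by simp
  show ?case
  proof (cases "l' = l \<and> a \<noteq> 0")
    case True
    then have ls: "length s = sz" using s by blast
    have eq: "slice_comb sz l (l' # ls) (a # c) (s # ss) = list_plus (scal a s) (slice_comb sz l ls c ss)"
      using True by simp
    have nth: "list_plus (scal a s) (slice_comb sz l ls c ss) ! k = a * s ! k + slice_comb sz l ls c ss ! k"
      using IH ls "1.prems"(3) by (simp add: nth_list_plus nth_scal del: slice_comb.simps)
    show ?thesis unfolding eq nth shift using IH ls True by (simp del: slice_comb.simps)
  next
    case False
    then have eq: "slice_comb sz l (l' # ls) (a # c) (s # ss) = slice_comb sz l ls c ss" by auto
    have z: "(if l' = l then a * s ! k else 0) = 0" using False by auto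
    show ?thesis unfolding eq shift z add_0 by (rule IH)
  qed
qed auto

section \<open>The labelled graph by levels and positions\<close>

locale labelled_foster = foster_graph adj
  for adj :: "'v::finite \<Rightarrow> 'v \<Rightarrow> bool" +
  fixes x :: 'v and vs :: "'v list"
  assumes length_vs: "length vs = 90" and distinct_vs: "distinct vs" and set_vs: "set vs = UNIV"
    and vs_0: "vs ! 0 = x"
    and nbs_vs: "n < 90 \<Longrightarrow> {z. adj (vs ! n) z} = (!) vs ` set (foster_nbs ! n)"
    and diam: "gdiam adj = 8"
begin

definition index_of :: "'v \<Rightarrow> nat" where
  "index_of y = (THE n. n < 90 \<and> vs ! n = y)"

definition lv :: "'v \<Rightarrow> nat" where "lv y = level_list ! index_of y"
definition ps :: "'v \<Rightarrow> nat" where "ps y = pos_list ! index_of y"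
definition vx :: "nat \<Rightarrow> nat \<Rightarrow> 'v" where "vx l k = vs ! (level_offsets ! l + k)"

lemma index_of_nth: "n < 90 \<Longrightarrow> index_of (vs ! n) = n"
  unfolding index_of_def
proof (rule the_equality)
  fix m assume "n < 90" "m < 90 \<and> vs ! m = vs ! n"
  then show "m = n" using nth_eq_iff_index_eq[OF distinct_vs, of m n] length_vs by simp
qed simp

lemma index_of: "index_of y < 90" "vs ! index_of y = y"
proof -
  obtain n where "n < 90" "vs ! n = y" using set_vs length_vs by (metis UNIV_I in_set_conv_nth)
  then show "index_of y < 90" "vs ! index_of y = y" using index_of_nth by auto
qed

lemma lv_ps: "lv y < 9" "ps y < level_sizes ! lv y" "vx (lv y) (ps y) = y"
  using positions_from_nth[OF positions_ok(1), of "index_of y"] positions_ok(2) index_of[of y]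
  unfolding lv_def ps_def vx_def by auto

lemma offset_less: assumes "l < 9" "k < level_sizes ! l" shows "level_offsets ! l + k < 90"
  using offsets_ok(1)[unfolded list_all_upt, rule_format, OF assms(1)] assms(2) by linarith

lemma offset_unique:
  assumes "l < 9" "k < level_sizes ! l" "l' < 9" "k' < level_sizes ! l'"
    "level_offsets ! l + k = level_offsets ! l' + k'"
  shows "l = l'"
proof -
  have F: False if a: "l < l'" "l' < 9" "l < 9" "k < level_sizes ! l" "level_offsets ! l + k = level_offsets ! l' + k'" for l l' k k'
  proof -
    have "level_offsets ! Suc l \<le> level_offsets ! l'"
      by (rule sorted_nth_mono[OF offsets_ok(2)]) (use a in \<open>simp_all add: level_offsets_def\<close>)
    moreover have "level_offsets ! l + level_sizes ! l = level_offsets ! Suc l"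
      using offsets_ok(1)[unfolded list_all_upt, rule_format, OF a(3)] by blast
    ultimately show False using a(4,5) by linarith
  qed
  show ?thesis
    by (rule linorder_cases[of l l']) (use F[OF _ assms(3,1,2,5)] F[OF _ assms(1,3,4) assms(5)[symmetric]] in auto)
qed

lemma lv_vx: assumes "l < 9" "k < level_sizes ! l" shows "lv (vx l k) = l" "ps (vx l k) = k"
proof -
  let ?n = "level_offsets ! l + k"
  have n: "?n < 90" by (rule offset_less[OF assms])
  have i: "index_of (vx l k) = ?n" unfolding vx_def by (rule index_of_nth[OF n])
  have p: "level_list ! ?n < 9" "pos_list ! ?n < level_sizes ! (level_list ! ?n)"
      "level_offsets ! (level_list ! ?n) + pos_list ! ?n = ?n"
    using positions_from_nth[OF positions_ok(1), of ?n] positions_ok(2) n by simp_all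
  have "level_list ! ?n = l" by (rule offset_unique[OF p(1,2) assms p(3)])
  then show "lv (vx l k) = l" "ps (vx l k) = k" using p(3) unfolding lv_def ps_def i by simp_all
qed

lemma nbs_facts:
  assumes "l < 9" "k < level_sizes ! l"
  shows "distinct (down_nbs ! l ! k)" "distinct (up_nbs ! l ! k)" "l = 0 \<or> down_nbs ! l ! k \<noteq> []"
    "l = 0 \<Longrightarrow> down_nbs ! l ! k = []" "l = 8 \<Longrightarrow> up_nbs ! l ! k = []"
    "\<And>p. p \<in> set (down_nbs ! l ! k) \<Longrightarrow> p < level_sizes ! (l - 1)"
    "\<And>p. p \<in> set (up_nbs ! l ! k) \<Longrightarrow> p < level_sizes ! Suc l"
    "set (foster_nbs ! (level_offsets ! l + k)) = (+) (level_offsets ! (l - 1)) ` set (down_nbs ! l ! k) \<union>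
      (+) (level_offsets ! Suc l) ` set (up_nbs ! l ! k)"
    "length (down_nbs ! l) = level_sizes ! l" "length (up_nbs ! l) = level_sizes ! l"
proof -
  have r: "length (down_nbs ! l) = level_sizes ! l" "length (up_nbs ! l) = level_sizes ! l"
    "rows_ok l (down_nbs ! l) (up_nbs ! l) (take (level_sizes ! l) (drop (level_offsets ! l) foster_nbs))"
    using nbs_ok(1)[unfolded list_all_upt, rule_format, OF assms(1)] unfolding level_rows_ok_def by blast+
  have k: "k < length (down_nbs ! l)" using assms(2) r(1) by simp
  have t: "take (level_sizes ! l) (drop (level_offsets ! l) foster_nbs) ! k = foster_nbs ! (level_offsets ! l + k)"
    using assms(2) offset_less[OF assms] nbs_ok(2) by simp
  note h = rows_ok_nth[OF r(3) k, unfolded t]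
  show "distinct (down_nbs ! l ! k)" "distinct (up_nbs ! l ! k)" "l = 0 \<or> down_nbs ! l ! k \<noteq> []"
    "l = 0 \<Longrightarrow> down_nbs ! l ! k = []" "l = 8 \<Longrightarrow> up_nbs ! l ! k = []"
    "\<And>p. p \<in> set (down_nbs ! l ! k) \<Longrightarrow> p < level_sizes ! (l - 1)"
    "\<And>p. p \<in> set (up_nbs ! l ! k) \<Longrightarrow> p < level_sizes ! Suc l"
    "set (foster_nbs ! (level_offsets ! l + k)) = (+) (level_offsets ! (l - 1)) ` set (down_nbs ! l ! k) \<union>
      (+) (level_offsets ! Suc l) ` set (up_nbs ! l ! k)"
    using h by blast+
  show "length (down_nbs ! l) = level_sizes ! l" "length (up_nbs ! l) = level_sizes ! l" by (rule r)+
qed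

lemma adj_vx:
  assumes "l < 9" "k < level_sizes ! l"
  shows "{z. adj (vx l k) z} = vx (l - 1) ` set (down_nbs ! l ! k) \<union> vx (Suc l) ` set (up_nbs ! l ! k)"
proof -
  have "level_offsets ! l + k < 90" by (rule offset_less[OF assms])
  from nbs_vs[OF this] show ?thesis unfolding nbs_facts(8)[OF assms] image_Un image_image vx_def by (simp add: vx_def)
qed

text \<open>An edge changes \<open>lv\<close> by exactly one and \<open>lv x = 0\<close>, so
  \<open>lv\<close> is at most the distance. Every vertex off level 0 has a neighbour one level
  below, which gives the converse.\<close>

lemma gdist_lv: "gdist adj x y = lv y"
proof -
  have nbl: "lv z = lv y - 1 \<and> lv y \<noteq> 0 \<or> lv z = Suc (lv y)" if "adj y z" for y z
  proof -
    note l = lv_ps(1,2)[of y]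
    have "z \<in> vx (lv y - 1) ` set (down_nbs ! lv y ! ps y) \<union> vx (Suc (lv y)) ` set (up_nbs ! lv y ! ps y)"
      using adj_vx[OF l] that lv_ps(3)[of y] by auto
    then show ?thesis
    proof
      assume "z \<in> vx (lv y - 1) ` set (down_nbs ! lv y ! ps y)"
      then obtain p where p: "p \<in> set (down_nbs ! lv y ! ps y)" "z = vx (lv y - 1) p" by auto
      have "lv y \<noteq> 0"
      proof
        assume 0: "lv y = 0"
        show False using nbs_facts(4)[OF l 0] p(1) by simp
      qed
      then show ?thesis using lv_vx(1)[of "lv y - 1" p] nbs_facts(6)[OF l p(1)] p(2) l by simp
    next
      assume "z \<in> vx (Suc (lv y)) ` set (up_nbs ! lv y ! ps y)"
      then obtain p where p: "p \<in> set (up_nbs ! lv y ! ps y)" "z = vx (Suc (lv y)) p" by auto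
      have "lv y \<noteq> 8"
      proof
        assume 8: "lv y = 8"
        show False using nbs_facts(5)[OF l 8] p(1) by simp
      qed
      then show ?thesis using lv_vx(1)[of "Suc (lv y)" p] nbs_facts(7)[OF l p(1)] p(2) l by simp
    qed
  qed
  have x0: "lv x = 0" using lv_vx(1)[of 0 0] vs_0 by (simp add: vx_def level_offsets_def level_sizes_def)
  have le: "lv y \<le> n" if "d x y = n" for n y using that
  proof (induction n arbitrary: y)
    case 0
    then show ?case using x0 dist_0_iff by simp
  next
    case (Suc n)
    obtain z where "adj z y" "d x z = n" using Suc.prems by (rule dist_pred)
    then show ?case using Suc.IH[of z] nbl[of z y] by auto
  qed
  have ge: "d x y \<le> n" if "lv y = n" for n y using that
  proof (induction n arbitrary: y)
    case 0
    then have "ps y < 1" using lv_ps(2)[of y] by (simp add: level_sizes_def)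
    then have "y = x" using lv_ps(3)[of y] 0 vs_0 by (simp add: vx_def level_offsets_def)
    then show ?case by simp
  next
    case (Suc n)
    note l = lv_ps(1,2)[of y]
    obtain p where p: "p \<in> set (down_nbs ! lv y ! ps y)" using nbs_facts(3)[OF l] Suc.prems by (cases "down_nbs ! lv y ! ps y") auto
    have "adj y (vx (lv y - 1) p)" using adj_vx[OF l] p lv_ps(3)[of y] by auto
    moreover have "lv (vx (lv y - 1) p) = n"
      using lv_vx(1)[of "lv y - 1" p] nbs_facts(6)[OF l p] l Suc.prems by simp
    ultimately have "d x y \<le> Suc (d x (vx (lv y - 1) p))" "d x (vx (lv y - 1) p) \<le> n"
      using dist_adj_le adj_sym Suc.IH by blast+
    then show ?case by simp
  qed
  show ?thesis using le[OF refl, of y] ge[OF refl, of y] by simp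
qed

sublocale terwilliger adj x
  by unfold_locales (use adj_sym in blast)

definition sv :: "nat \<Rightarrow> int list \<Rightarrow> complex^'v" where
  "sv l s = (\<chi> y. if lv y = l then of_int (s ! ps y) else 0)"

lemma E_sv: "E l *v sv l' s = (if l' = l then sv l' s else 0)"
  by (simp add: Finite_Cartesian_Product.vec_eq_iff E_mv gdist_lv sv_def)

lemma A_mv: "(A *v u) $ y = (\<Sum>z\<in>{z. adj y z}. u $ z)"
proof -
  have "A $ y $ z * u $ z = (if adj y z then u $ z else 0)" for z by (simp add: adjacency_matrix_def)
  then have "(A *v u) $ y = (\<Sum>z\<in>UNIV. if adj y z then u $ z else 0)" by (simp add: matrix_vector_mult_def)
  also have "\<dots> = (\<Sum>z\<in>{z. adj y z}. u $ z)" by (simp add: sum.If_cases)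
  finally show ?thesis .
qed

lemma sum_vx:
  assumes "l' < 9" "\<And>p. p \<in> S \<Longrightarrow> p < level_sizes ! l'"
  shows "(\<Sum>z\<in>vx l' ` S. sv l s $ z) = (if l' = l then \<Sum>p\<in>S. of_int (s ! p) else 0)"
proof -
  have "inj_on (vx l') S" by (rule inj_on_inverseI[of _ ps]) (use lv_vx(2) assms in blast)
  then have "(\<Sum>z\<in>vx l' ` S. sv l s $ z) = (\<Sum>p\<in>S. sv l s $ vx l' p)" by (simp add: sum.reindex)
  also have "\<dots> = (\<Sum>p\<in>S. if l' = l then of_int (s ! p) else 0)"
  proof (rule sum.cong[OF refl])
    fix p assume "p \<in> S"
    from lv_vx[OF assms(1) assms(2)[OF this]]
    show "sv l s $ vx l' p = (if l' = l then of_int (s ! p) else 0)"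
      by (cases "l' = l") (auto simp: sv_def)
  qed
  finally show ?thesis by simp
qed

lemma A_sv: "(A *v sv l s) $ y = of_int (A_slice (lv y) l s ! ps y)"
proof -
  define l' k where "l' = lv y" and "k = ps y"
  have lk: "l' < 9" "k < level_sizes ! l'" and y: "y = vx l' k" unfolding l'_def k_def using lv_ps[of y] by auto
  note nf = nbs_facts[OF lk]
  let ?D = "set (down_nbs ! l' ! k)" and ?U = "set (up_nbs ! l' ! k)"
  have D: "(\<Sum>z\<in>vx (l' - 1) ` ?D. sv l s $ z) = (if l' = Suc l then of_int (gather s (down_nbs ! l' ! k)) else 0)"
  proof (cases "l' = 0")
    case True then show ?thesis using nf(4) by simp
  next
    case False
    then have "l' - 1 = l \<longleftrightarrow> l' = Suc l" by auto
    moreover have "(\<Sum>z\<in>vx (l' - 1) ` ?D. sv l s $ z) = (if l' - 1 = l then \<Sum>p\<in>?D. of_int (s ! p) else 0)"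
      by (rule sum_vx) (use lk nf(6) in auto)
    ultimately show ?thesis unfolding gather_sum[OF nf(1)] of_int_sum by (simp only:)
  qed
  have U: "(\<Sum>z\<in>vx (Suc l') ` ?U. sv l s $ z) = (if Suc l' = l then of_int (gather s (up_nbs ! l' ! k)) else 0)"
  proof (cases "l' = 8")
    case True then show ?thesis using nf(5) by simp
  next
    case False
    have "(\<Sum>z\<in>vx (Suc l') ` ?U. sv l s $ z) = (if Suc l' = l then \<Sum>p\<in>?U. of_int (s ! p) else 0)"
      by (rule sum_vx) (use lk False nf(7) in auto)
    then show ?thesis unfolding gather_sum[OF nf(2)] of_int_sum by (simp only:)
  qed
  \<comment> \<open>The neighbours below and above lie on different levels, so the sum over the
    neighbourhood splits into the two gathered sums.\<close>
  have "vx (l' - 1) ` ?D \<inter> vx (Suc l') ` ?U = {}"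
  proof (rule equals0I)
    fix z assume "z \<in> vx (l' - 1) ` ?D \<inter> vx (Suc l') ` ?U"
    then obtain p r where pr: "p \<in> ?D" "r \<in> ?U" "z = vx (l' - 1) p" "z = vx (Suc l') r" by auto
    have "l' \<noteq> 8" using nf(5) pr(2) by auto
    then have "l' - 1 = Suc l'"
      using lv_vx(1)[of "l' - 1" p] lv_vx(1)[of "Suc l'" r] nf(6)[OF pr(1)] nf(7)[OF pr(2)] pr lk by simp
    then show False by simp
  qed
  then have "(A *v sv l s) $ y = (\<Sum>z\<in>vx (l' - 1) ` ?D. sv l s $ z) + (\<Sum>z\<in>vx (Suc l') ` ?U. sv l s $ z)"
    unfolding A_mv y adj_vx[OF lk] by (intro sum.union_disjoint) auto
  then show ?thesis unfolding D U l'_def[symmetric] k_def[symmetric] A_slice_def using lk nf(9,10) by auto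
qed

lemma herm_sv:
  assumes "l < 9" "length s = level_sizes ! l" "length s' = level_sizes ! l"
  shows "herm (sv l s) (sv l s') = of_int (dot s s')"
proof -
  have "herm (sv l s) (sv l s') = (\<Sum>y\<in>UNIV. if lv y = l then of_int (s ! ps y * s' ! ps y) else 0)"
    unfolding herm_def by (rule sum.cong[OF refl]) (simp add: sv_def)
  also have "\<dots> = (\<Sum>y\<in>{y. lv y = l}. of_int (s ! ps y * s' ! ps y))" by (simp add: sum.If_cases)
  also have "{y. lv y = l} = vx l ` {..<level_sizes ! l}"
  proof
    show "{y. lv y = l} \<subseteq> vx l ` {..<level_sizes ! l}"
      using lv_ps by (auto intro!: image_eqI[where x = "ps _"])
  qed (use lv_vx(1) assms(1) in auto)
  also have "(\<Sum>y\<in>vx l ` {..<level_sizes ! l}. complex_of_int (s ! ps y * s' ! ps y)) =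
      (\<Sum>k<level_sizes ! l. of_int (s ! k * s' ! k))"
  proof -
    have "inj_on (vx l) {..<level_sizes ! l}" by (rule inj_on_inverseI[of _ ps]) (use lv_vx(2) assms(1) in simp)
    then have "(\<Sum>y\<in>vx l ` {..<level_sizes ! l}. complex_of_int (s ! ps y * s' ! ps y)) =
      (\<Sum>k<level_sizes ! l. complex_of_int (s ! ps (vx l k) * s' ! ps (vx l k)))" by (simp add: sum.reindex)
    also have "\<dots> = (\<Sum>k<level_sizes ! l. of_int (s ! k * s' ! k))"
      by (rule sum.cong[OF refl]) (simp add: lv_vx assms(1))
    finally show ?thesis .
  qed
  finally show ?thesis using dot_sum[of s s'] assms(2,3) by simp
qed

end

section \<open>The modules of the Foster graph\<close>

definition type_val :: "int \<times> int \<Rightarrow> complex" where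
  "type_val p = of_int (fst p) + of_int (snd p) * complex_of_real (sqrt 6)"

text \<open>Irrationality of \<open>sqrt 6\<close> by descent: \<open>a\<close>, and thereupon
  \<open>b\<close>, must be even, and half of \<open>b\<close> satisfies an equation of the same
  form.\<close>

lemma sq_6_sq:
  assumes "(a::nat)\<^sup>2 = 6 * b\<^sup>2" shows "b = 0"
  using assms
proof (induction b arbitrary: a rule: less_induct)
  case (less b)
  show ?case
  proof (rule ccontr)
    assume "b \<noteq> 0"
    have "even (a\<^sup>2)" using less.prems by simp
    then obtain c where c: "a = 2 * c" by auto
    have e: "2 * c\<^sup>2 = 3 * b\<^sup>2" using less.prems unfolding c by (simp add: power_mult_distrib)
    have "even (3 * b\<^sup>2)" unfolding e[symmetric] by simp
    then have "even b" by simp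
    then obtain f where f: "b = 2 * f" by auto
    have "c\<^sup>2 = 6 * f\<^sup>2" using e unfolding f by (simp add: power_mult_distrib)
    moreover have "f < b" using f \<open>b \<noteq> 0\<close> by simp
    ultimately have "f = 0" using less.IH by blast
    then show False using f \<open>b \<noteq> 0\<close> by simp
  qed
qed

lemma type_val_eq_0:
  assumes "type_val p = 0" shows "p = (0, 0)"
proof -
  obtain a b where p: "p = (a, b)" by (cases p)
  have "complex_of_real (of_int a + of_int b * sqrt 6) = 0" using assms by (simp add: p type_val_def)
  then have 0: "of_int a + of_int b * sqrt 6 = (0::real)" by (simp only: of_real_eq_0_iff)
  then have "real_of_int a = - (of_int b * sqrt 6)" by linarith
  then have "(real_of_int a)\<^sup>2 = (of_int b)\<^sup>2 * 6" by (simp add: power_mult_distrib)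
  then have "real_of_int (a\<^sup>2) = real_of_int (6 * b\<^sup>2)" by simp
  then have "a\<^sup>2 = 6 * b\<^sup>2" by (simp only: of_int_eq_iff)
  then have "(nat \<bar>a\<bar>)\<^sup>2 = 6 * (nat \<bar>b\<bar>)\<^sup>2" by (simp add: nat_mult_distrib flip: nat_power_eq)
  then have "b = 0" using sq_6_sq by fastforce
  then show ?thesis using 0 p by simp
qed

lemma type_val_diff: "type_val p - type_val r = type_val (fst p - fst r, snd p - snd r)"
  by (simp add: type_val_def algebra_simps)

lemma type_val_inj: "type_val p = type_val r \<Longrightarrow> p = r"
  using type_val_eq_0[of "(fst p - fst r, snd p - snd r)"] type_val_diff[of p r] by (auto simp: prod_eq_iff)

lemma type_val_mult: "type_val (pair_mult p r) = type_val p * type_val r"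
proof -
  have "complex_of_real (sqrt 6) * complex_of_real (sqrt 6) = 6" by (simp flip: of_real_mult)
  then have "(of_int b * complex_of_real (sqrt 6)) * (of_int d * complex_of_real (sqrt 6)) = 6 * of_int (b * d)" for b d
    by (simp add: mult_ac)
  then show ?thesis by (simp add: type_val_def pair_mult_def algebra_simps)
qed

lemma separators_all:
  assumes "t < 9" "t' < 9" "j < length (type_levels ! t')" shows "separator_ok t t' j"
proof (cases "t < 5")
  case True
  show ?thesis using separators_ok_0[unfolded list_all_upt, rule_format, OF True assms(2,3)] .
next
  case False
  then have "t \<in> set [5..<9]" using assms(1) by (simp only: set_upt atLeastLessThan_iff not_less simp_thms)
  with separators_ok_5 have "list_all (\<lambda>t'. list_all (separator_ok t t') [0..<length (type_levels ! t')]) [0..<9]"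
    unfolding list_all_iff[of _ "[5..<9]"] by (rule bspec)
  from this[unfolded list_all_upt, rule_format, OF assms(2,3)] show ?thesis .
qed

context labelled_foster
begin

definition tp :: "nat \<Rightarrow> nat" where "tp w = module_types ! w"
definition dm :: "nat \<Rightarrow> nat" where "dm t = length (type_levels ! t)"
definition lev :: "nat \<Rightarrow> nat \<Rightarrow> nat" where "lev t i = type_levels ! t ! i"
definition Bt :: "nat \<Rightarrow> nat \<Rightarrow> nat \<Rightarrow> complex" where "Bt t i j = of_int (type_mats ! t ! i ! j)"
definition bas :: "nat \<Rightarrow> nat \<Rightarrow> complex^'v" where "bas w i = sv (lev (tp w) i) (module_slices ! w ! i)"

lemma module_facts:
  assumes "w < 19"
  shows "tp w < 9" "length (module_slices ! w) = dm (tp w)"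
    "\<And>i. i < dm (tp w) \<Longrightarrow> length (module_slices ! w ! i) = level_sizes ! lev (tp w) i"
    "\<And>j l'. j < dm (tp w) \<Longrightarrow> l' < 9 \<Longrightarrow> A_slice l' (lev (tp w) j) (module_slices ! w ! j) =
      slice_comb (level_sizes ! l') l' (type_levels ! tp w) (map (\<lambda>row. row ! j) (type_mats ! tp w)) (module_slices ! w)"
  using modules_ok[unfolded list_all_upt, rule_format, OF assms]
  unfolding module_ok_def Let_def tp_def dm_def lev_def list_all_upt list_all2_conv_all_nth by blast+

lemma type_facts:
  assumes "t < 9"
  shows "0 < dm t" "length (type_mats ! t) = dm t" "\<And>i. i < dm t \<Longrightarrow> length (type_mats ! t ! i) = dm t"
    "\<And>i. i < dm t \<Longrightarrow> lev t i \<le> 8" "\<And>i. i < dm t \<Longrightarrow> lev t 0 \<le> lev t i" "sorted (type_levels ! t)"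
    "length (type_evs ! t) = dm t" "distinct (type_evs ! t)" "\<And>i. i < dm t \<Longrightarrow> lev t i = lev t 0 \<Longrightarrow> i = 0"
proof -
  have h: "type_wf t" using types_wf[unfolded list_all_upt] assms by blast
  show "0 < dm t" "length (type_mats ! t) = dm t" "sorted (type_levels ! t)"
    "length (type_evs ! t) = dm t" "distinct (type_evs ! t)"
    using h unfolding type_wf_def Let_def dm_def by blast+
  then show "\<And>i. i < dm t \<Longrightarrow> length (type_mats ! t ! i) = dm t"
    using h unfolding type_wf_def Let_def dm_def by (simp add: list_all_length)
  show "\<And>i. i < dm t \<Longrightarrow> lev t i \<le> 8" "\<And>i. i < dm t \<Longrightarrow> lev t 0 \<le> lev t i"
    using h unfolding type_wf_def Let_def dm_def lev_def by (simp_all add: list_all_length)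
  show "\<And>i. i < dm t \<Longrightarrow> lev t i = lev t 0 \<Longrightarrow> i = 0"
    using h unfolding type_wf_def Let_def dm_def lev_def list_all_upt by blast
qed

lemma lev_less: "t < 9 \<Longrightarrow> i < dm t \<Longrightarrow> lev t i < 9"
  using type_facts(4)[of t i] by simp

lemma E_bas: "E l *v bas w i = (if lev (tp w) i = l then bas w i else 0)"
  unfolding bas_def by (rule E_sv)

lemma sum_vec_nth: "(\<Sum>i\<in>I. F i) $ y = (\<Sum>i\<in>I. F i $ y)" for F :: "nat \<Rightarrow> complex^'v"
  by (rule sum_component)

lemma A_bas:
  assumes w: "w < 19" and j: "j < dm (tp w)"
  shows "A *v bas w j = (\<Sum>i<dm (tp w). Bt (tp w) i j *s bas w i)"
proof -
  let ?t = "tp w" and ?ss = "module_slices ! w"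
  note mf = module_facts[OF w]
  note tf = type_facts[OF mf(1)]
  have "(A *v bas w j) $ y = (\<Sum>i<dm ?t. Bt ?t i j *s bas w i) $ y" for y
  proof -
    let ?sz = "level_sizes ! lv y" and ?c = "map (\<lambda>row. row ! j) (type_mats ! ?t)"
    have "A_slice (lv y) (lev ?t j) (?ss ! j) = slice_comb ?sz (lv y) (type_levels ! ?t) ?c ?ss"
      by (rule mf(4)[OF j lv_ps(1)])
    moreover have "slice_comb ?sz (lv y) (type_levels ! ?t) ?c ?ss ! ps y =
        (\<Sum>i<length (type_levels ! ?t). if type_levels ! ?t ! i = lv y then ?c ! i * ?ss ! i ! ps y else 0)"
    proof (rule slice_comb_nth[THEN conjunct2])
      show "length ?c = length (type_levels ! ?t)" using tf(2) by (simp add: dm_def)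
      show "length ?ss = length (type_levels ! ?t)" using mf(2) by (simp add: dm_def)
      show "ps y < ?sz" by (rule lv_ps(2))
      fix i assume "i < length (type_levels ! ?t)" "type_levels ! ?t ! i = lv y"
      then show "length (?ss ! i) = ?sz" using mf(3)[of i] by (simp add: dm_def lev_def)
    qed
    ultimately have "(A *v bas w j) $ y =
        of_int (\<Sum>i<dm ?t. if lev ?t i = lv y then ?c ! i * ?ss ! i ! ps y else 0)"
      unfolding bas_def A_sv by (simp only: dm_def lev_def)
    also have "\<dots> = (\<Sum>i<dm ?t. (Bt ?t i j *s bas w i) $ y)"
      unfolding of_int_sum
    proof (rule sum.cong[OF refl])
      fix i assume "i \<in> {..<dm ?t}"
      then have "?c ! i = type_mats ! ?t ! i ! j" using tf(2) by simp
      then show "of_int (if lev ?t i = lv y then ?c ! i * ?ss ! i ! ps y else 0) = (Bt ?t i j *s bas w i) $ y"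
        by (simp add: bas_def sv_def Bt_def)
    qed
    finally show ?thesis unfolding sum_vec_nth .
  qed
  then show ?thesis by (simp add: Finite_Cartesian_Product.vec_eq_iff)
qed

text \<open>Evaluated at the vertices of one level, the relation involves only the one or two basis
  vectors on that level, and \<open>independent_ok\<close> applies.\<close>

lemma bas_independent:
  assumes w: "w < 19" and 0: "(\<Sum>i<dm (tp w). c i *s bas w i) = 0" and i: "i < dm (tp w)"
  shows "c i = 0"
proof -
  let ?t = "tp w" and ?ss = "module_slices ! w"
  let ?l = "lev ?t i" and ?s = "module_slices ! w ! i"
  note mf = module_facts[OF w]
  have l: "?l < 9" by (rule lev_less[OF mf(1) i])
  have coord: "(\<Sum>j\<in>{j. j < dm ?t \<and> lev ?t j = ?l}. c j * of_int (?ss ! j ! k)) = 0" if k: "k < level_sizes ! ?l" for k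
  proof -
    have "0 = (\<Sum>j<dm ?t. (c j *s bas w j) $ vx ?l k)" unfolding sum_vec_nth[symmetric] 0 by simp
    also have "\<dots> = (\<Sum>j<dm ?t. if lev ?t j = ?l then c j * of_int (?ss ! j ! k) else 0)"
      by (rule sum.cong[OF refl]) (simp add: bas_def sv_def lv_vx[OF l k] eq_commute[of ?l])
    also have "\<dots> = (\<Sum>j\<in>{j \<in> {..<dm ?t}. lev ?t j = ?l}. c j * of_int (?ss ! j ! k))"
      by (rule sum.inter_filter[symmetric]) simp
    finally show ?thesis by simp
  qed
  have iok: "independent_ok w i"
    using independents_ok[unfolded list_all_upt, rule_format, OF w] i by (simp add: dm_def tp_def)
  define js where "js = filter (\<lambda>j. type_levels ! ?t ! j = ?l \<and> j \<noteq> i) [0..<length (type_levels ! ?t)]"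
  have set: "{j. j < dm ?t \<and> lev ?t j = ?l} = insert i (set js)"
    unfolding js_def using i by (auto simp: dm_def lev_def)
  have nin: "i \<notin> set js" unfolding js_def by simp
  have iok': "case js of [] \<Rightarrow> list_ex (\<lambda>p. ?s ! p \<noteq> 0) [0..<level_sizes ! ?l]
      | [j] \<Rightarrow> list_ex (\<lambda>p. list_ex (\<lambda>r. ?s ! p * (?ss ! j) ! r \<noteq> ?s ! r * (?ss ! j) ! p) [0..<level_sizes ! ?l]) [0..<level_sizes ! ?l]
      | _ \<Rightarrow> False"
    using iok unfolding independent_ok_def Let_def js_def lev_def tp_def .
  show ?thesis
  proof (cases js)
    case Nil
    then obtain p where p: "p < level_sizes ! ?l" "?s ! p \<noteq> 0" using iok' by (auto simp: list_ex_iff)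
    have "c i * of_int (?s ! p) = 0" using coord[OF p(1)] unfolding set Nil by simp
    then show ?thesis using p(2) by simp
  next
    case (Cons j rest)
    then have js: "js = [j]" using iok' by (cases rest) auto
    then obtain p r where pr: "p < level_sizes ! ?l" "r < level_sizes ! ?l"
        "?s ! p * (?ss ! j) ! r \<noteq> ?s ! r * (?ss ! j) ! p" using iok' by (auto simp: list_ex_iff)
    have e: "c i * of_int (?s ! k) + c j * of_int (?ss ! j ! k) = 0" if "k < level_sizes ! ?l" for k
      using coord[OF that] nin unfolding set js by simp
    \<comment> \<open>Cramer's rule: the minor at positions \<open>p\<close> and \<open>r\<close>
      eliminates \<open>c j\<close>.\<close>
    have "c i * of_int (?s ! p * ?ss ! j ! r - ?s ! r * ?ss ! j ! p) =
        of_int (?ss ! j ! r) * (c i * of_int (?s ! p) + c j * of_int (?ss ! j ! p)) -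
        of_int (?ss ! j ! p) * (c i * of_int (?s ! r) + c j * of_int (?ss ! j ! r))"
      by (simp add: algebra_simps)
    also have "\<dots> = 0" unfolding e[OF pr(1)] e[OF pr(2)] by simp
    finally have "c i = 0 \<or> complex_of_int (?s ! p * ?ss ! j ! r - ?s ! r * ?ss ! j ! p) = 0" by (simp only: mult_eq_0_iff)
    then show ?thesis using pr(3) by (simp only: of_int_eq_0_iff right_minus_eq) blast
  qed
qed

subsection \<open>The operators sending seeds to basis vectors\<close>

definition comb :: "nat \<Rightarrow> int list \<Rightarrow> complex^'v" where
  "comb w c = (\<Sum>i<dm (tp w). of_int (c ! i) *s bas w i)"

lemma comb_plus:
  "length c = dm (tp w) \<Longrightarrow> length e = dm (tp w) \<Longrightarrow> comb w (list_plus c e) = comb w c + comb w e"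
  unfolding comb_def by (simp add: nth_list_plus vector_sadd_rdistrib sum.distrib)

lemma comb_scal: "length c = dm (tp w) \<Longrightarrow> comb w (scal a c) = of_int a *s comb w c"
  unfolding comb_def by (simp add: nth_scal smult_sum vector_smult_assoc)

lemma comb_unit: "j < dm (tp w) \<Longrightarrow> comb w (unit_list (dm (tp w)) j) = bas w j"
proof -
  assume j: "j < dm (tp w)"
  have "comb w (unit_list (dm (tp w)) j) = (\<Sum>i<dm (tp w). (if i = j then 1 else 0) *s bas w i)"
    unfolding comb_def by (rule sum.cong[OF refl]) (simp add: nth_unit_list)
  then show ?thesis unfolding sum_delta_smult[OF j] by simp
qed

lemma length_levels: "length (type_levels ! t) = dm t"
  by (simp add: dm_def)

lemma length_mats: "w < 19 \<Longrightarrow> length (type_mats ! tp w) = dm (tp w)"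
  using type_facts(2)[OF module_facts(1)] .

lemma E_comb: "length c = dm (tp w) \<Longrightarrow> E l *v comb w c = comb w (level_mask (type_levels ! tp w) l c)"
  unfolding comb_def mv_sum mv_smult E_bas
  by (rule sum.cong[OF refl]) (simp add: nth_level_mask dm_def lev_def)

lemma A_comb:
  assumes w: "w < 19" and c: "length c = dm (tp w)"
  shows "A *v comb w c = comb w (mat_app (type_mats ! tp w) c)"
proof -
  let ?t = "tp w" and ?n = "dm (tp w)"
  note tf = type_facts[OF module_facts(1)[OF w]]
  have "A *v comb w c = (\<Sum>j<?n. \<Sum>i<?n. (of_int (c ! j) * Bt ?t i j) *s bas w i)"
    unfolding comb_def mv_sum mv_smult
    by (rule sum.cong[OF refl]) (simp add: A_bas[OF w] smult_sum vector_smult_assoc)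
  also have "\<dots> = (\<Sum>i<?n. \<Sum>j<?n. (of_int (c ! j) * Bt ?t i j) *s bas w i)" by (rule sum.swap)
  also have "\<dots> = comb w (mat_app (type_mats ! ?t) c)"
    unfolding comb_def
  proof (rule sum.cong[OF refl])
    fix i assume i: "i \<in> {..<?n}"
    have "mat_app (type_mats ! ?t) c ! i = (\<Sum>j<?n. type_mats ! ?t ! i ! j * c ! j)"
      using i tf(2,3) c by (simp add: nth_mat_app dot_sum)
    then show "(\<Sum>j<?n. (of_int (c ! j) * Bt ?t i j) *s bas w i) = of_int (mat_app (type_mats ! ?t) c ! i) *s bas w i"
      unfolding sum_smult[symmetric] by (simp add: Bt_def mult.commute)
  qed
  finally show ?thesis .
qed

section \<open>Words and polynomials in the generators as matrices\<close>

primrec gop :: "gen_op \<Rightarrow> complex^'v^'v" where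
  "gop A_op = A"
| "gop (E_op l) = E l"

primrec wmat :: "gen_op list \<Rightarrow> complex^'v^'v" where
  "wmat [] = Finite_Cartesian_Product.mat 1"
| "wmat (g # gs) = gop g ** wmat gs"

primrec smat :: "gen_op list list \<Rightarrow> complex^'v^'v" where
  "smat [] = 0"
| "smat (g # gs) = wmat g + smat gs"

primrec pmat :: "gen_op list list \<Rightarrow> int list \<Rightarrow> complex^'v^'v" where
  "pmat gs [] = 0"
| "pmat gs (a # cs) = mscale (of_int a) (Finite_Cartesian_Product.mat 1) + smat gs ** pmat gs cs"

primrec Apow :: "nat \<Rightarrow> complex^'v^'v" where
  "Apow 0 = Finite_Cartesian_Product.mat 1"
| "Apow (Suc k) = A ** Apow k"

primrec cmat_words :: "nat \<Rightarrow> (int \<times> nat) list \<Rightarrow> complex^'v^'v" where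
  "cmat_words l [] = 0"
| "cmat_words l (p # ws) = mscale (of_int (fst p)) (E l ** Apow (snd p)) + cmat_words l ws"

text \<open>The matrices act on integer coordinates by the functions that the checks evaluate. A
  check on a type thereby holds in every module of that type.\<close>

lemma gop_comb:
  "w < 19 \<Longrightarrow> length c = dm (tp w) \<Longrightarrow>
    gop g *v comb w c = comb w (coord_op (type_levels ! tp w) (type_mats ! tp w) g c) \<and>
    length (coord_op (type_levels ! tp w) (type_mats ! tp w) g c) = dm (tp w)"
  by (cases g) (simp_all add: A_comb E_comb length_mats length_levels)

lemma wmat_comb:
  "w < 19 \<Longrightarrow> length c = dm (tp w) \<Longrightarrow>
    wmat gs *v comb w c = comb w (coord_word (type_levels ! tp w) (type_mats ! tp w) gs c) \<and>
    length (coord_word (type_levels ! tp w) (type_mats ! tp w) gs c) = dm (tp w)"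
  by (induction gs) (simp_all add: gop_comb flip: matrix_vector_mul_assoc)

lemma smat_comb:
  "w < 19 \<Longrightarrow> length c = dm (tp w) \<Longrightarrow>
    smat gs *v comb w c = comb w (coord_sum (type_levels ! tp w) (type_mats ! tp w) gs c) \<and>
    length (coord_sum (type_levels ! tp w) (type_mats ! tp w) gs c) = dm (tp w)"
  by (induction gs) (simp_all add: wmat_comb comb_plus comb_scal matrix_vector_mult_add_rdistrib)

lemma pmat_comb:
  "w < 19 \<Longrightarrow> length c = dm (tp w) \<Longrightarrow>
    pmat gs cs *v comb w c = comb w (coord_poly (type_levels ! tp w) (type_mats ! tp w) gs cs c) \<and>
    length (coord_poly (type_levels ! tp w) (type_mats ! tp w) gs cs c) = dm (tp w)"
  by (induction cs) (simp_all add: smat_comb comb_plus comb_scal matrix_vector_mult_add_rdistrib mscale_mv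
      flip: matrix_vector_mul_assoc)

lemma Apow_comb:
  "w < 19 \<Longrightarrow> length c = dm (tp w) \<Longrightarrow> Apow k *v comb w c = comb w (mat_pow (type_mats ! tp w) k c) \<and>
    length (mat_pow (type_mats ! tp w) k c) = dm (tp w)"
  by (induction k) (simp_all add: A_comb length_mats flip: matrix_vector_mul_assoc)

lemma cmat_words_comb:
  assumes "w < 19" "length c = dm (tp w)"
  shows "cmat_words l ws *v comb w c = comb w (word_comb (type_levels ! tp w) (type_mats ! tp w) l ws c) \<and>
    length (word_comb (type_levels ! tp w) (type_mats ! tp w) l ws c) = dm (tp w)"
proof (induction ws)
  case Nil
  then show ?case using assms by (simp add: comb_scal)
next
  case (Cons p ws)
  obtain a k where p: "p = (a, k)" by (cases p)
  note P = Apow_comb[OF assms, of k]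
  have "length (level_mask (type_levels ! tp w) l (mat_pow (type_mats ! tp w) k c)) = dm (tp w)"
    using P by (simp add: dm_def)
  then show ?case using Cons P unfolding p
    by (simp add: comb_plus comb_scal E_comb matrix_vector_mult_add_rdistrib mscale_mv flip: matrix_vector_mul_assoc)
qed

section \<open>Membership in the algebra and self-adjointness\<close>

lemma zero_in_T: "0 \<in> T"
proof -
  have "mscale 0 A = 0" by (simp add: mscale_def Finite_Cartesian_Product.vec_eq_iff)
  then show ?thesis using T_mscale[OF A_in_T, of 0] by simp
qed

definition sep_ok :: "gen_op list list \<Rightarrow> nat \<Rightarrow> bool" where
  "sep_ok gs r \<longleftrightarrow> r \<le> 8 \<and> (\<forall>g\<in>set gs. rev g = g \<and> g \<noteq> [] \<and> hd g = E_op r \<and> (\<forall>l. E_op l \<in> set g \<longrightarrow> l \<le> 8))"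

lemma wmat_T: "(\<forall>l. E_op l \<in> set g \<longrightarrow> l \<le> 8) \<Longrightarrow> wmat g \<in> T"
proof (induction g)
  case (Cons h g)
  have "gop h \<in> T" using Cons.prems A_in_T E_in_T diam by (cases h) auto
  then show ?case using Cons by (simp add: T_mult)
qed (simp add: T_one)

lemma smat_T: "sep_ok gs r \<Longrightarrow> smat gs \<in> T"
  by (induction gs) (auto simp: sep_ok_def zero_in_T T_add wmat_T)

lemma pmat_T: "sep_ok gs r \<Longrightarrow> pmat gs cs \<in> T"
  by (induction cs) (simp_all add: zero_in_T T_add T_mscale T_one T_mult smat_T)

lemma Apow_T: "Apow k \<in> T"
  by (induction k) (simp_all add: T_one T_mult A_in_T)

lemma cmat_words_T: "l \<le> 8 \<Longrightarrow> cmat_words l ws \<in> T"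
  using diam by (induction ws) (simp_all add: zero_in_T T_add T_mscale T_mult E_in_T Apow_T)

lemma wmat_append: "wmat (g @ h) = wmat g ** wmat h"
  by (induction g) (simp_all add: matrix_mul_assoc)

lemma adjoint_wmat: "adjoint_mat (wmat g) = wmat (rev g)"
proof (induction g)
  case (Cons h g)
  have "adjoint_mat (gop h) = gop h" by (cases h) (simp_all add: adjoint_A adjoint_E)
  then show ?case using Cons by (simp add: adjoint_mult wmat_append)
qed (simp add: adjoint_one)

lemma adjoint_zero: "adjoint_mat 0 = 0"
  by (simp add: adjoint_mat_def Finite_Cartesian_Product.vec_eq_iff)

lemma adjoint_smat: "sep_ok gs r \<Longrightarrow> adjoint_mat (smat gs) = smat gs"
  by (induction gs) (auto simp: sep_ok_def adjoint_zero adjoint_add adjoint_wmat)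

lemma E_idem: "E r ** E r = E r"
proof -
  have "(E r ** E r) *v u = E r *v u" for u
    by (simp add: Finite_Cartesian_Product.vec_eq_iff E_mv flip: matrix_vector_mul_assoc)
  then show ?thesis by (simp add: matrix_eq)
qed

lemma E_wmat: "hd g = E_op r \<Longrightarrow> g \<noteq> [] \<Longrightarrow> E r ** wmat g = wmat g"
  by (cases g) (simp_all add: matrix_mul_assoc E_idem)

lemma E_smat: "sep_ok gs r \<Longrightarrow> E r ** smat gs = smat gs"
  by (induction gs) (auto simp: sep_ok_def E_wmat matrix_add_ldistrib)

lemma smat_pmat_commute: "smat gs ** pmat gs cs = pmat gs cs ** smat gs"
proof (induction cs)
  case (Cons a cs)
  have "smat gs ** (smat gs ** pmat gs cs) = (smat gs ** pmat gs cs) ** smat gs"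
    unfolding Cons by (simp only: matrix_mul_assoc Cons)
  then show ?case by (simp add: matrix_add_ldistrib matrix_mult_add_left mult_mscale mscale_mult)
qed simp

lemma adjoint_pmat:
  assumes "sep_ok gs r" shows "adjoint_mat (pmat gs cs) = pmat gs cs"
  by (induction cs)
    (simp_all add: adjoint_zero adjoint_add adjoint_mscale adjoint_one adjoint_mult adjoint_smat[OF assms] smat_pmat_commute)

text \<open>\<open>smat gs\<close> absorbs \<open>E r\<close> on the left because its words begin
  with it, and on the right by taking adjoints. The constant term is a scalar.\<close>

lemma E_pmat_commute:
  assumes "sep_ok gs r" shows "E r ** pmat gs cs = pmat gs cs ** E r"
proof -
  have s: "smat gs ** E r = smat gs"
    using arg_cong[OF E_smat[OF assms], of adjoint_mat] by (simp add: adjoint_mult adjoint_smat[OF assms] adjoint_E)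
  show ?thesis
  proof (induction cs)
    case (Cons a cs)
    have "E r ** (smat gs ** pmat gs cs) = smat gs ** pmat gs cs" by (simp add: matrix_mul_assoc E_smat[OF assms])
    also have "\<dots> = (smat gs ** E r) ** pmat gs cs" unfolding s ..
    also have "\<dots> = (smat gs ** pmat gs cs) ** E r" using Cons by (simp add: matrix_mul_assoc[symmetric])
    finally show ?case by (simp add: matrix_add_ldistrib matrix_mult_add_left mult_mscale mscale_mult)
  qed simp
qed

text \<open>The constant term of the polynomial acts on all levels; the factor \<open>E r\<close>
  confines the operator to the endpoint level.\<close>

definition sep_proj :: "nat \<Rightarrow> complex^'v^'v" where
  "sep_proj t = (case separators ! t of (r, gs, cs, dn) \<Rightarrow> mscale (1 / of_int dn) (pmat gs cs ** E r))"

definition Pop :: "nat \<Rightarrow> nat \<Rightarrow> complex^'v^'v" where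
  "Pop t i = mscale (1 / of_int (type_dens ! t ! i)) (cmat_words (lev t i) (type_words ! t ! i)) ** sep_proj t"

lemma separator_facts:
  assumes "t < 9" "separators ! t = (r, gs, cs, dn)"
  shows "dn \<noteq> 0" "r = lev t 0" "sep_ok gs r"
proof -
  have h: "separator_wf t" using separators_wf[unfolded list_all_upt] assms(1) by blast
  then show "dn \<noteq> 0" "r = lev t 0" unfolding separator_wf_def assms(2) lev_def by simp_all
  show "sep_ok gs r" using h unfolding separator_wf_def assms(2) sep_ok_def by (fastforce simp: list_all_iff)
qed

lemma Pop_T: "t < 9 \<Longrightarrow> i < dm t \<Longrightarrow> Pop t i \<in> T"
proof -
  assume t: "t < 9" "i < dm t"
  obtain r gs cs dn where s: "separators ! t = (r, gs, cs, dn)" by (cases "separators ! t") auto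
  note sf = separator_facts[OF t(1) s]
  have "sep_proj t \<in> T"
    unfolding sep_proj_def s prod.case using sf(3) diam
    by (intro T_mscale T_mult pmat_T[OF sf(3)] E_in_T) (simp add: sep_ok_def)
  then show ?thesis unfolding Pop_def by (intro T_mult T_mscale cmat_words_T type_facts(4) t)
qed

text \<open>The word for the seed is \<open>E r\<close> itself, so \<open>Pop t 0\<close> is
  \<open>sep_proj t\<close>: a real polynomial in a self-adjoint matrix times a projection commuting
  with it.\<close>

lemma Pop_adjoint: assumes "t < 9" shows "adjoint_mat (Pop t 0) = Pop t 0"
proof -
  obtain r gs cs dn where s: "separators ! t = (r, gs, cs, dn)" by (cases "separators ! t") auto
  note sf = separator_facts[OF assms s]
  have wf: "type_words ! t ! 0 = [(1, 0)]" "type_dens ! t ! 0 = 1"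
    using words_first[unfolded list_all_upt, rule_format, OF assms] by auto
  have one: "mscale 1 M = M" for M :: "complex^'v^'v" by (simp add: mscale_def)
  have X: "sep_proj t = mscale (1 / of_int dn) (pmat gs cs ** E r)" unfolding sep_proj_def s by simp
  have "Pop t 0 = E r ** sep_proj t" unfolding Pop_def wf sf(2)[symmetric] by (simp add: one)
  also have "\<dots> = mscale (1 / of_int dn) ((E r ** pmat gs cs) ** E r)" unfolding X mult_mscale matrix_mul_assoc ..
  also have "\<dots> = mscale (1 / of_int dn) (pmat gs cs ** (E r ** E r))"
    unfolding E_pmat_commute[OF sf(3)] by (simp only: matrix_mul_assoc)
  also have "\<dots> = sep_proj t" unfolding E_idem X ..
  finally have "Pop t 0 = sep_proj t" .
  moreover have "adjoint_mat (sep_proj t) = sep_proj t"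
    unfolding X adjoint_mscale adjoint_mult adjoint_E adjoint_pmat[OF sf(3)] E_pmat_commute[OF sf(3)] by simp
  ultimately show ?thesis by simp
qed

lemma sep_proj_bas:
  assumes w: "w < 19" and t: "t < 9" and j: "j < dm (tp w)"
  shows "sep_proj t *v bas w j = (if tp w = t \<and> j = 0 then bas w 0 else 0)"
proof -
  obtain r gs cs dn where s: "separators ! t = (r, gs, cs, dn)" by (cases "separators ! t") auto
  note sf = separator_facts[OF t s]
  have X: "sep_proj t *v bas w j = (1 / of_int dn) *s (pmat gs cs *v (E r *v bas w j))"
    unfolding sep_proj_def s by (simp add: mscale_mv flip: matrix_vector_mul_assoc)
  show ?thesis
  proof (cases "lev (tp w) j = r")
    case False
    have "\<not> (tp w = t \<and> j = 0)"
    proof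
      assume "tp w = t \<and> j = 0"
      then show False using False sf(2) by simp
    qed
    then show ?thesis unfolding X E_bas using False by auto
  next
    case True
    have tw: "tp w < 9" by (rule module_facts(1)[OF w])
    have ok: "separator_ok t (tp w) j"
      using separators_all[OF t tw] j unfolding dm_def .
    let ?n = "dm (tp w)"
    have n0: "0 < ?n" by (rule type_facts(1)[OF tw])
    have val: "coord_poly (type_levels ! tp w) (type_mats ! tp w) gs cs (unit_list ?n j) =
        (if t = tp w \<and> j = 0 then scal dn (unit_list ?n 0) else scal 0 (unit_list ?n 0))"
    proof -
      have "replicate ?n 0 = scal 0 (unit_list ?n 0)" by (rule nth_equalityI) (simp_all add: nth_scal)
      then show ?thesis using ok True unfolding separator_ok_def s prod.case Let_def dm_def[symmetric] lev_def by simp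
    qed
    have "pmat gs cs *v bas w j = comb w (coord_poly (type_levels ! tp w) (type_mats ! tp w) gs cs (unit_list ?n j))"
      using pmat_comb[OF w, of "unit_list ?n j" gs cs] comb_unit[OF j] by simp
    also have "\<dots> = (if t = tp w \<and> j = 0 then of_int dn *s bas w 0 else 0)"
      unfolding val using comb_scal[of "unit_list ?n 0" w] comb_unit[OF n0] by auto
    finally have "sep_proj t *v bas w j = (1 / of_int dn) *s (if t = tp w \<and> j = 0 then of_int dn *s bas w 0 else 0)"
      unfolding X E_bas if_P[OF True] by simp
    then show ?thesis using sf(1) by (auto simp: vector_smult_assoc)
  qed
qed

lemma word_bas:
  assumes w: "w < 19" and i: "i < dm (tp w)"
  shows "cmat_words (lev (tp w) i) (type_words ! tp w ! i) *v bas w 0 = of_int (type_dens ! tp w ! i) *s bas w i"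
    "type_dens ! tp w ! i \<noteq> 0"
proof -
  have tw: "tp w < 9" by (rule module_facts(1)[OF w])
  have n0: "0 < dm (tp w)" by (rule type_facts(1)[OF tw])
  have ok: "word_ok (tp w) i" using words_ok[unfolded list_all_upt, rule_format, OF tw] i by (simp add: dm_def)
  then show "type_dens ! tp w ! i \<noteq> 0" unfolding word_ok_def Let_def by blast
  have v: "word_comb (type_levels ! tp w) (type_mats ! tp w) (lev (tp w) i) (type_words ! tp w ! i)
      (unit_list (dm (tp w)) 0) = scal (type_dens ! tp w ! i) (unit_list (dm (tp w)) i)"
    using ok unfolding word_ok_def Let_def dm_def lev_def by blast
  show "cmat_words (lev (tp w) i) (type_words ! tp w ! i) *v bas w 0 = of_int (type_dens ! tp w ! i) *s bas w i"
    using cmat_words_comb[OF w, of "unit_list (dm (tp w)) 0" "lev (tp w) i" "type_words ! tp w ! i"]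
    unfolding v comb_unit[OF n0] by (simp add: comb_scal comb_unit[OF i])
qed

lemma Pop_bas:
  assumes w: "w < 19" and t: "t < 9" "i < dm t" and j: "j < dm (tp w)"
  shows "Pop t i *v bas w j = (if tp w = t \<and> j = 0 then bas w i else 0)"
proof -
  have "Pop t i *v bas w j = (1 / of_int (type_dens ! t ! i)) *s
      (cmat_words (lev t i) (type_words ! t ! i) *v (sep_proj t *v bas w j))"
    unfolding Pop_def by (simp add: mscale_mv flip: matrix_vector_mul_assoc)
  then show ?thesis unfolding sep_proj_bas[OF w t(1) j]
    using word_bas[OF w, of i] t(2) by (auto simp: vector_smult_assoc)
qed

section \<open>Eigenvectors of the type matrices, seeds and dimension count\<close>

definition evt :: "nat \<Rightarrow> nat \<Rightarrow> complex" where "evt t k = type_val (type_evs ! t ! k)"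
definition fvt :: "nat \<Rightarrow> nat \<Rightarrow> nat \<Rightarrow> complex" where "fvt t k i = type_val (type_evecs ! t ! k ! i)"

lemma evt_real: "cnj (evt t k) = evt t k"
  by (simp add: evt_def type_val_def)

lemma fvt_eigen:
  assumes t: "t < 9" and k: "k < dm t"
  shows "\<And>i. i < dm t \<Longrightarrow> (\<Sum>j<dm t. Bt t i j * fvt t k j) = evt t k * fvt t k i" "\<exists>i<dm t. fvt t k i \<noteq> 0"
proof -
  let ?v = "type_evecs ! t ! k"
  have ok: "length ?v = dm t" "list_ex (\<lambda>p. p \<noteq> (0, 0)) ?v"
    "map (\<lambda>row. (dot row (map fst ?v), dot row (map snd ?v))) (type_mats ! t) = map (pair_mult (type_evs ! t ! k)) ?v"
    using evecs_ok[unfolded list_all_upt, rule_format, OF t] k unfolding evec_ok_def Let_def dm_def by blast+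
  note tf = type_facts[OF t]
  show "(\<Sum>j<dm t. Bt t i j * fvt t k j) = evt t k * fvt t k i" if i: "i < dm t" for i
  proof -
    let ?r = "type_mats ! t ! i"
    have "(dot ?r (map fst ?v), dot ?r (map snd ?v)) = pair_mult (type_evs ! t ! k) (?v ! i)"
      using arg_cong[OF ok(3), of "\<lambda>l. l ! i"] i tf(2) ok(1) by simp
    then have "type_val (dot ?r (map fst ?v), dot ?r (map snd ?v)) = evt t k * fvt t k i"
      by (simp only: type_val_mult evt_def fvt_def)
    moreover have "type_val (dot ?r (map fst ?v), dot ?r (map snd ?v)) = (\<Sum>j<dm t. Bt t i j * fvt t k j)"
      using ok(1) tf(3)[OF i]
      by (simp add: type_val_def dot_sum Bt_def fvt_def distrib_left sum.distrib sum_distrib_right mult.assoc)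
    ultimately show ?thesis by simp
  qed
  obtain p where "p \<in> set ?v" "p \<noteq> (0, 0)" using ok(2) by (auto simp: list_ex_iff)
  then show "\<exists>i<dm t. fvt t k i \<noteq> 0" unfolding fvt_def using ok(1) type_val_eq_0 by (metis in_set_conv_nth)
qed

lemma herm_seeds:
  assumes "w < 19" "w' < 19" "w \<noteq> w'" "tp w = tp w'"
  shows "herm (bas w 0) (bas w' 0) = 0"
proof -
  have "w = w' \<or> module_types ! w \<noteq> module_types ! w' \<or> dot (module_slices ! w ! 0) (module_slices ! w' ! 0) = 0"
    using seeds_ok[unfolded list_all_upt, rule_format, OF assms(1,2)] .
  then have d: "dot (module_slices ! w ! 0) (module_slices ! w' ! 0) = 0" using assms(3,4) unfolding tp_def by blast
  have t: "tp w < 9" "tp w' < 9" and n: "0 < dm (tp w)" "0 < dm (tp w')" using module_facts(1) type_facts(1) assms by auto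
  have "herm (sv (lev (tp w) 0) (module_slices ! w ! 0)) (sv (lev (tp w) 0) (module_slices ! w' ! 0)) = of_int 0"
    unfolding d[symmetric]
    by (rule herm_sv[OF lev_less[OF t(1) n(1)] module_facts(3)[OF assms(1) n(1)]])
      (use module_facts(3)[OF assms(2) n(2)] assms(4) in simp)
  then show ?thesis unfolding bas_def assms(4)[symmetric] by simp
qed

lemma ex_module_of_type: "t < 9 \<Longrightarrow> \<exists>w<19. tp w = t"
  using types_realised[unfolded list_all_upt, rule_format, of t] by (auto simp: list_ex_iff tp_def)

lemma total_dimension: "(\<Sum>w<19. dm (tp w)) = CARD('v)"
proof -
  have "(\<Sum>w<19. dm (tp w)) = sum_list (map (\<lambda>w. dm (tp w)) [0..<19])"
    unfolding interv_sum_list_conv_sum_set_nat set_upt atLeast0LessThan ..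
  also have "\<dots> = 90" using total_ok unfolding dm_def tp_def .
  also have "90 = CARD('v)" using distinct_card[OF distinct_vs] set_vs length_vs by simp
  finally show ?thesis .
qed

sublocale module_family_spectrum adj x 19 9 tp dm lev Bt bas Pop evt fvt
proof unfold_locales
  fix t :: nat assume t: "t < 9"
  show "inj_on (evt t) {..<dm t}"
  proof (rule inj_onI)
    fix k k' assume "k \<in> {..<dm t}" "k' \<in> {..<dm t}" "evt t k = evt t k'"
    then show "k = k'" using type_val_inj[of "type_evs ! t ! k" "type_evs ! t ! k'"]
        nth_eq_iff_index_eq[OF type_facts(8)[OF t], of k k'] type_facts(7)[OF t] by (simp add: evt_def)
  qed
qed (rule module_facts(1) ex_module_of_type type_facts(1) A_bas E_bas bas_independent Pop_T Pop_bas Pop_adjoint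
    herm_seeds total_dimension fvt_eigen(1) fvt_eigen(2) evt_real; assumption)+

end

section \<open>The decomposition of the standard module\<close>

definition eval_list :: "(int \<times> int) list" where
  "eval_list = concat (map (\<lambda>w. type_evs ! (module_types ! w)) [0..<19])"

definition spectrum_table :: "((int \<times> int) \<times> nat) list" where
  "spectrum_table = [((3, 0), 1), ((0, 1), 12), ((2, 0), 9), ((1, 0), 18), ((0, 0), 10), ((- 1, 0), 18),
     ((- 2, 0), 9), ((0, - 1), 12), ((- 3, 0), 1)]"

lemma spectrum_ok: "distinct (map fst spectrum_table)" "set (map fst spectrum_table) = set eval_list"
  "list_all (\<lambda>p. count_list eval_list (fst p) = snd p) spectrum_table"
  by code_simp+

definition type_profiles :: "(nat \<times> nat \<times> nat list) list" where
  "type_profiles = [(1, 8, [1, 1, 1, 1, 1, 1, 1, 1, 1]), (2, 6, [1, 1, 1, 1, 1, 1, 1]), (3, 4, [1, 1, 2, 2, 1]),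
     (3, 2, [1, 2, 1]), (3, 3, [1, 1, 2, 1]), (1, 0, [1]), (3, 1, [1, 1]), (2, 3, [1, 1, 1, 1]), (1, 3, [1, 1, 1, 1])]"

definition profile_ok :: "nat \<Rightarrow> bool" where
  "profile_ok t \<longleftrightarrow> (let ls = type_levels ! t; p = type_profiles ! t in
     count_list module_types t = fst p \<and> card (set ls) - 1 = fst (snd p) \<and>
     map (count_list ls) [ls ! 0..<ls ! 0 + fst (snd p) + 1] = snd (snd p))"

lemma profiles_ok: "list_all profile_ok [0..<9]"
  by code_simp

lemma A_seed_ok: "list_all (\<lambda>t. t = 5 \<or> mat_app (type_mats ! t) (unit_list (length (type_levels ! t)) 0) =
    unit_list (length (type_levels ! t)) 1) [0..<9]"
  by code_simp

lemma count_list_card: "count_list l a = card {i. i < length l \<and> l ! i = a}"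
proof -
  have "count_list l a = length (filter (\<lambda>y. y = a) l)" by (induction l) auto
  then show ?thesis by (simp add: length_filter_conv_card)
qed

lemma type_val_eq_iff: "type_val p = type_val r \<longleftrightarrow> p = r"
  using type_val_inj by blast

lemma upt_simps: "[0..<2] = [0, Suc 0]" "[0..<4] = [0, Suc 0, 2, 3]" "[0..<5] = [0, Suc 0, 2, 3, 4]"
  "[0..<7] = [0, Suc 0, 2, 3, 4, 5, 6]"
  by (simp_all add: upt_rec numeral_eq_Suc)

context labelled_foster
begin

definition ord :: "nat \<Rightarrow> 'v list" where
  "ord l = map (vx l) [0..<level_sizes ! l]"

lemma level_ordering_ord: "level_ordering adj x ord"
  unfolding level_ordering_def diam
proof (intro allI impI)
  fix l :: nat assume "l \<le> 8"
  then have l: "l < 9" by simp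
  have "inj_on (vx l) {..<level_sizes ! l}" by (rule inj_on_inverseI[of _ ps]) (use lv_vx(2)[OF l] in simp)
  then have "distinct (ord l)" unfolding ord_def by (simp add: distinct_map atLeast0LessThan)
  moreover have "set (ord l) = gsphere adj l x"
  proof
    show "set (ord l) \<subseteq> gsphere adj l x" unfolding ord_def gsphere_def gdist_lv using lv_vx(1)[OF l] by auto
    show "gsphere adj l x \<subseteq> set (ord l)"
    proof
      fix y assume "y \<in> gsphere adj l x"
      then have "lv y = l" unfolding gsphere_def gdist_lv by simp
      then show "y \<in> set (ord l)" unfolding ord_def using lv_ps(2,3)[of y] by (auto intro!: image_eqI[of _ _ "ps y"])
    qed
  qed
  ultimately show "distinct (ord l) \<and> set (ord l) = gsphere adj l x" ..
qed

lemma essential_part_sv: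
  assumes "l < 9" "length s = level_sizes ! l" shows "essential_part ord l (sv l s) = map of_int s"
  unfolding essential_part_def ord_def
  by (rule nth_equalityI) (use assms lv_vx[OF assms(1)] in \<open>simp_all add: sv_def\<close>)

lemma endpoint_bas: "w < 19 \<Longrightarrow> endpoint adj x (W w) = lev (tp w) 0"
  by (rule endpoint_W) (use type_facts(5) module_facts(1) in blast)+

lemma seed_bas:
  assumes w: "w < 19"
  shows "seed_vector adj x ord (W w) (map of_int (module_slices ! w ! 0)) (bas w 0)"
proof -
  have t: "tp w < 9" by (rule module_facts(1)[OF w])
  have n: "0 < dm (tp w)" by (rule type_facts(1)[OF t])
  have I: "{i. i < dm (tp w) \<and> lev (tp w) i = lev (tp w) 0} = {0}" using type_facts(9)[OF t] n by auto
  have D: "dual_part adj x (lev (tp w) 0) (W w) = vec.span {bas w 0}" unfolding dual_part_W[OF w] I by simp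
  have 1: "vec.dim (dual_part adj x (lev (tp w) 0) (W w)) = 1" unfolding dim_dual_part[OF w] I by simp
  have "essential_part ord (lev (tp w) 0) (bas w 0) = map of_int (module_slices ! w ! 0)"
    unfolding bas_def by (rule essential_part_sv[OF lev_less[OF t n] module_facts(3)[OF w n]])
  then show ?thesis unfolding seed_vector_def endpoint_bas[OF w] using pure_b[OF w n] D 1 by simp
qed

lemma multiplicity_bas:
  assumes "w < 19" shows "multiplicity_in T (map W [0..<19]) (W w) = count_list module_types (tp w)"
proof -
  have l: "length module_types = 19" by (simp add: module_types_def)
  have "multiplicity_in T (map W [0..<19]) (W w) = card {i. i < 19 \<and> T_isomorphic T (W i) (W w)}"
    unfolding multiplicity_in_def length_filter_conv_card by (rule arg_cong[where f = card]) auto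
  also have "{i. i < 19 \<and> T_isomorphic T (W i) (W w)} = {i. i < 19 \<and> module_types ! i = tp w}"
    using isomorphic_iff assms by (auto simp: tp_def)
  finally show ?thesis unfolding count_list_card l .
qed

lemma profile_bas:
  assumes w: "w < 19" and p: "type_profiles ! tp w = (m, \<delta>, sh)"
  shows "module_profile adj x (map W [0..<19]) (W w) (lev (tp w) 0) m (dm (tp w)) \<delta> sh"
proof -
  have t: "tp w < 9" by (rule module_facts(1)[OF w])
  let ?ls = "type_levels ! tp w"
  have ok: "count_list module_types (tp w) = m" "card (set ?ls) - 1 = \<delta>"
    "map (count_list ?ls) [lev (tp w) 0..<lev (tp w) 0 + \<delta> + 1] = sh"
    using profiles_ok[unfolded list_all_upt, rule_format, OF t] unfolding profile_ok_def Let_def p lev_def by simp_all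
  have img: "lev (tp w) ` {..<dm (tp w)} = set ?ls" unfolding lev_def dm_def by (auto simp: set_conv_nth)
  have d: "module_diameter adj x (W w) = \<delta>"
    using diameter_W[OF w] type_facts(4)[OF t] ok(2) unfolding img diam by simp
  have "vec.dim (dual_part adj x l (W w)) = count_list ?ls l" for l
    unfolding dim_dual_part[OF w] count_list_card lev_def dm_def ..
  then have "module_shape adj x (W w) = sh" unfolding module_shape_def endpoint_bas[OF w] d using ok(3) by simp
  then show ?thesis unfolding module_profile_def
    using endpoint_bas[OF w] multiplicity_bas[OF w] ok(1) dim_W[OF w] d by simp
qed

text \<open>The listed values are \<open>dm t\<close> distinct eigenvalues, and a matrix of that
  size has no more.\<close>

lemma spectrum_type:
  assumes t: "t < 9" and M: "M \<in> carrier_mat (dm t) (dm t)" "\<And>i j. i < dm t \<Longrightarrow> j < dm t \<Longrightarrow> M $$ (i, j) = Bt t i j"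
  shows "spectrum M = set (map type_val (type_evs ! t))"
proof -
  have img: "evt t ` {..<dm t} = set (map type_val (type_evs ! t))"
    using type_facts(7)[OF t] unfolding evt_def set_map by (auto simp: set_conv_nth)
  have "evt t k \<in> spectrum M" if k: "k < dm t" for k
  proof -
    define v where "v = Matrix.vec (dm t) (fvt t k)"
    obtain i where i: "i < dm t" "fvt t k i \<noteq> 0" using fvt_eigen(2)[OF t k] by blast
    have "v \<noteq> 0\<^sub>v (dm t)"
    proof
      assume "v = 0\<^sub>v (dm t)"
      then have "vec_index v i = vec_index (0\<^sub>v (dm t)) i" by simp
      then show False using i by (simp add: v_def)
    qed
    moreover have "M *\<^sub>v v = evt t k \<cdot>\<^sub>v v"
    proof (rule Matrix.eq_vecI)
      fix i assume "i < dim_vec (evt t k \<cdot>\<^sub>v v)"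
      then have i: "i < dm t" by (simp add: v_def)
      have "vec_index (M *\<^sub>v v) i = (\<Sum>j<dm t. Bt t i j * fvt t k j)"
        using M i by (simp add: v_def scalar_prod_def atLeast0LessThan)
      then show "vec_index (M *\<^sub>v v) i = vec_index (evt t k \<cdot>\<^sub>v v) i"
        using fvt_eigen(1)[OF t k i] i by (simp add: v_def)
    qed (use M in \<open>simp add: v_def\<close>)
    ultimately have "eigenvector M v (evt t k)" using M unfolding eigenvector_def by (simp add: v_def)
    then show ?thesis unfolding spectrum_def eigenvalue_def by blast
  qed
  then have sub: "evt t ` {..<dm t} \<subseteq> spectrum M" by blast
  have fin: "finite (spectrum M)" "card (spectrum M) \<le> dm t" using card_finite_spectrum[OF M(1)] by auto
  have "card (evt t ` {..<dm t}) = dm t" using card_image[OF ev_inj[OF t]] by simp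
  then have "evt t ` {..<dm t} = spectrum M" using card_seteq[OF fin(1) sub] fin(2) by simp
  then show ?thesis using img by simp
qed

lemma basis_data_bas:
  assumes w: "w < 19" and rws: "rws = map (map of_int) (type_mats ! tp w)" and n: "n = dm (tp w)"
    and vs: "us = map (bas w) [0..<n]" and ev: "S = set (map type_val (type_evs ! tp w))"
  shows "basis_data adj x (W w) us (mat_of_rows_list n rws) S"
proof -
  have t: "tp w < 9" by (rule module_facts(1)[OF w])
  note tf = type_facts[OF t]
  let ?M = "mat_of_rows_list n rws"
  have M: "?M \<in> carrier_mat n n" using tf(2) by (simp add: mat_of_rows_list_def rws n)
  have Mij: "?M $$ (i, j) = Bt (tp w) i j" if "i < n" "j < n" for i j
    using that tf(2) tf(3)[of i] by (simp add: mat_of_rows_list_def rws n Bt_def)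
  note I = W_independent[OF w]
  have "distinct us" unfolding vs n using I by (simp add: distinct_map atLeast0LessThan)
  moreover have s: "set us = bas w ` {..<dm (tp w)}" unfolding vs n by (simp add: atLeast0LessThan)
  then have "vec.independent (set us)" "vec.span (set us) = W w" using I unfolding W_def by auto
  moreover have "list_all2 (pure_vector adj x) (type_levels ! tp w) us"
    unfolding vs n using pure_b[OF w] by (auto simp: list_all2_conv_all_nth dm_def lev_def)
  ultimately have "pure_basis adj x (W w) us" unfolding pure_basis_def using tf(6) by blast
  moreover have "represents A ?M us"
    unfolding represents_def using M A_bas[OF w] Mij by (simp add: vs n)
  moreover have "spectrum ?M = S" unfolding ev by (rule spectrum_type[OF t]) (use M Mij n in simp_all)
  ultimately show ?thesis unfolding basis_data_def by blast
qed

section \<open>Basis vectors as words applied to the seed\<close>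

lemma Apow_funpow: "Apow k *v u = ((\<lambda>u. A *v u) ^^ k) u"
  by (induction k) (simp_all flip: matrix_vector_mul_assoc)

lemma mscale_one: "mscale 1 M = M"
  by (simp add: mscale_def)

lemma word_single:
  assumes "w < 19" "i < dm (tp w)" "type_words ! tp w ! i = [(1, k)]" "type_dens ! tp w ! i = 1" "lev (tp w) i = l"
  shows "E l *v ((\<lambda>u. A *v u) ^^ k) (bas w 0) = bas w i"
  using word_bas(1)[OF assms(1,2)] unfolding assms(3-5)
  by (simp add: mscale_one Apow_funpow flip: matrix_vector_mul_assoc)

lemma word_double:
  assumes "w < 19" "i < dm (tp w)" "type_words ! tp w ! i = [(1, k), (- a, k')]" "type_dens ! tp w ! i = 1" "lev (tp w) i = l"
  shows "E l *v ((\<lambda>u. A *v u) ^^ k) (bas w 0) - of_int a *s (E l *v ((\<lambda>u. A *v u) ^^ k') (bas w 0)) = bas w i"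
  using word_bas(1)[OF assms(1,2)] unfolding assms(3-5)
  by (simp add: mscale_one mscale_mv Apow_funpow matrix_vector_mult_add_rdistrib matrix_vector_mult_diff_rdistrib flip: matrix_vector_mul_assoc)

text \<open>Index 5 is type VI, where \<open>A\<close> annihilates the seed. For all other types the
  second basis vector is the image of the seed.\<close>

lemma A_seed:
  assumes w: "w < 19" and t: "tp w \<noteq> 5" and 1: "1 < dm (tp w)"
  shows "A *v bas w 0 = bas w 1" "lev (tp w) 1 = l \<Longrightarrow> A *v bas w 0 = E l *v (A *v bas w 0)"
proof -
  have t9: "tp w < 9" by (rule module_facts(1)[OF w])
  have n: "0 < dm (tp w)" using 1 by simp
  have "mat_app (type_mats ! tp w) (unit_list (dm (tp w)) 0) = unit_list (dm (tp w)) 1"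
    using A_seed_ok[unfolded list_all_upt, rule_format, OF t9] t unfolding dm_def by blast
  then show A: "A *v bas w 0 = bas w 1"
    using A_comb[OF w, of "unit_list (dm (tp w)) 0"] comb_unit[OF n] comb_unit[OF 1] by simp
  show "A *v bas w 0 = E l *v (A *v bas w 0)" if "lev (tp w) 1 = l"
    unfolding A E_bas using that by simp
qed

text \<open>The multiplicity of an eigenvalue is the number of its occurrences in the eigenvalue
  lists of the 19 modules taken together. Injectivity of \<open>type_val\<close> lets the count be
  made on integer pairs.\<close>

lemma has_spectrum_table: "has_spectrum A (map (\<lambda>p. (type_val (fst p), snd p)) spectrum_table)"
proof -
  have idx: "eval_of ` eindex = type_val ` set eval_list"
  proof -
    have "eval_of ` eindex = (\<Union>w<19. evt (tp w) ` {..<dm (tp w)})"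
      unfolding eindex_def eval_of_def by force
    also have "\<dots> = (\<Union>w<19. type_val ` set (type_evs ! tp w))"
    proof (rule SUP_cong[OF refl])
      fix w :: nat assume "w \<in> {..<19}"
      then have "length (type_evs ! tp w) = dm (tp w)" using type_facts(7) module_facts(1) by simp
      then show "evt (tp w) ` {..<dm (tp w)} = type_val ` set (type_evs ! tp w)"
        unfolding evt_def by (auto simp: set_conv_nth)
    qed
    also have "\<dots> = type_val ` set eval_list" unfolding eval_list_def tp_def set_concat set_map set_upt atLeast0LessThan
      by (simp only: image_UN image_image)
    finally show ?thesis .
  qed
  have cnt: "card {p \<in> eindex. eval_of p = type_val q} = count_list eval_list q" for q
  proof -
    have "{p \<in> eindex. eval_of p = type_val q} = (SIGMA w:{..<19}. {k. k < dm (tp w) \<and> type_evs ! tp w ! k = q})"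
      unfolding eindex_def eval_of_def evt_def by (auto simp: type_val_eq_iff)
    then have "card {p \<in> eindex. eval_of p = type_val q} = (\<Sum>w<19. card {k. k < dm (tp w) \<and> type_evs ! tp w ! k = q})"
      by (simp add: card_SigmaI)
    also have "\<dots> = (\<Sum>w<19. count_list (type_evs ! tp w) q)"
    proof (rule sum.cong[OF refl])
      fix w :: nat assume "w \<in> {..<19}"
      then have "length (type_evs ! tp w) = dm (tp w)" using type_facts(7) module_facts(1) by simp
      then show "card {k. k < dm (tp w) \<and> type_evs ! tp w ! k = q} = count_list (type_evs ! tp w) q"
        unfolding count_list_card by simp
    qed
    also have "\<dots> = sum_list (map (\<lambda>w. count_list (type_evs ! tp w) q) [0..<19])"
      unfolding interv_sum_list_conv_sum_set_nat set_upt atLeast0LessThan ..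
    also have "\<dots> = count_list eval_list q"
    proof -
      have "sum_list (map (\<lambda>w. count_list (g w) q) ws) = count_list (concat (map g ws)) q" for g :: "nat \<Rightarrow> (int \<times> int) list" and ws
        by (induction ws) auto
      then show ?thesis unfolding eval_list_def tp_def .
    qed
    finally show ?thesis .
  qed
  have fsts: "map fst (map (\<lambda>p. (type_val (fst p), snd p)) spectrum_table) = map type_val (map fst spectrum_table)" by simp
  have inj: "inj_on type_val S" for S using type_val_inj by (rule inj_onI)
  show ?thesis unfolding has_spectrum_def fsts
  proof (intro conjI ballI)
    show "distinct (map type_val (map fst spectrum_table))"
      using spectrum_ok(1) inj unfolding distinct_map[of type_val] by blast
    show "{\<theta>. eigenspace A \<theta> \<noteq> {0}} = set (map type_val (map fst spectrum_table))"
      unfolding eigenspace_nonzero idx set_map[of type_val] spectrum_ok(2) by blast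
    fix p assume "p \<in> set (map (\<lambda>p. (type_val (fst p), snd p)) spectrum_table)"
    then obtain r where r: "r \<in> set spectrum_table" "p = (type_val (fst r), snd r)" by auto
    have "count_list eval_list (fst r) = snd r" using spectrum_ok(3) r(1) unfolding list_all_iff by blast
    then show "case p of (\<theta>, m) \<Rightarrow> vec.dim (eigenspace A \<theta>) = m" unfolding r(2) prod.case dim_eigenspace cnt .
  qed
qed

subsection \<open>The types in the order of the theorem\<close>

abbreviation pw :: "nat \<Rightarrow> complex^'v \<Rightarrow> complex^'v" where "pw k v \<equiv> ((\<lambda>u. A *v u) ^^ k) v"
abbreviation Ws :: "(complex^'v) set list" where "Ws \<equiv> map W [0..<19]"
abbreviation s6 :: complex where "s6 \<equiv> complex_of_real (sqrt 6)"

lemma dm_simps: "dm 0 = 9" "dm 1 = 7" "dm (Suc 0) = 7" "dm 2 = 7" "dm 3 = 4" "dm 4 = 5" "dm 5 = 1" "dm 6 = 2" "dm 7 = 4" "dm 8 = 4"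
  by (simp_all add: dm_def type_levels_def)

lemma type_O:
  "module_profile adj x Ws (W 0) 0 1 9 8 [1, 1, 1, 1, 1, 1, 1, 1, 1]"
  "basis_data adj x (W 0) (map (e_star adj x) [0..<9])
    (mat_of_rows_list 9
      [[0, 3, 0, 0, 0, 0, 0, 0, 0], [1, 0, 2, 0, 0, 0, 0, 0, 0], [0, 1, 0, 2, 0, 0, 0, 0, 0],
       [0, 0, 1, 0, 2, 0, 0, 0, 0], [0, 0, 0, 1, 0, 2, 0, 0, 0], [0, 0, 0, 0, 2, 0, 1, 0, 0],
       [0, 0, 0, 0, 0, 2, 0, 1, 0], [0, 0, 0, 0, 0, 0, 2, 0, 1], [0, 0, 0, 0, 0, 0, 0, 3, 0]])
    {3, s6, 2, 1, 0, - 1, - 2, - s6, - 3}"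
proof -
  have t: "tp 0 = 0" by (simp add: tp_def module_types_def)
  show "module_profile adj x Ws (W 0) 0 1 9 8 [1, 1, 1, 1, 1, 1, 1, 1, 1]"
    using profile_bas[of 0, unfolded t dm_simps] by (simp add: type_profiles_def lev_def type_levels_def)
  \<comment> \<open>All coordinates of the first module are 1 on the respective level.\<close>
  have e: "e_star adj x l = bas 0 l" if "l < 9" for l
  proof -
    have "module_slices ! 0 ! l = replicate (level_sizes ! l) 1" "lev 0 l = l"
      using that by (auto simp: module_slices_def level_sizes_def lev_def type_levels_def numeral_eq_Suc less_Suc_eq)
    then show ?thesis using lv_ps(2)
      by (auto simp: bas_def t e_star_def sv_def gdist_lv Finite_Cartesian_Product.vec_eq_iff)
  qed
  show "basis_data adj x (W 0) (map (e_star adj x) [0..<9])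
    (mat_of_rows_list 9
      [[0, 3, 0, 0, 0, 0, 0, 0, 0], [1, 0, 2, 0, 0, 0, 0, 0, 0], [0, 1, 0, 2, 0, 0, 0, 0, 0],
       [0, 0, 1, 0, 2, 0, 0, 0, 0], [0, 0, 0, 1, 0, 2, 0, 0, 0], [0, 0, 0, 0, 2, 0, 1, 0, 0],
       [0, 0, 0, 0, 0, 2, 0, 1, 0], [0, 0, 0, 0, 0, 0, 2, 0, 1], [0, 0, 0, 0, 0, 0, 0, 3, 0]])
    {3, s6, 2, 1, 0, - 1, - 2, - s6, - 3}"
  proof (rule basis_data_bas)
    show "map (e_star adj x) [0..<9] = map (bas 0) [0..<9]" using e by (intro map_cong) auto
  qed (simp_all add: t dm_simps type_mats_def type_evs_def type_val_def)
qed

text \<open>The basis is given as a function \<open>us\<close> of the seed, so that the lists of the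
  theorem, written in terms of a bound seed, can be matched and evaluated at
  \<open>bas w 0\<close>.\<close>

lemma module_data:
  assumes w: "w < 19" "tp w = t" and a: "a = map of_int (module_slices ! w ! 0)"
    and us: "us (bas w 0) = map (bas w) [0..<n]"
    and profile: "type_profiles ! t = (m, \<delta>, sh)" "lev t 0 = r" "dm t = n"
    and rws: "rws = map (map of_int) (type_mats ! t)" and S: "S = set (map type_val (type_evs ! t))"
  shows "\<exists>\<nu>. seed_vector adj x ord (W w) a \<nu> \<and> module_profile adj x Ws (W w) r m n \<delta> sh \<and>
    basis_data adj x (W w) (us \<nu>) (mat_of_rows_list n rws) S"
proof (intro exI[of _ "bas w 0"] conjI)
  show "seed_vector adj x ord (W w) a (bas w 0)" unfolding a by (rule seed_bas[OF w(1)])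
  show "module_profile adj x Ws (W w) r m n \<delta> sh" using profile_bas[OF w(1), of m \<delta> sh] w(2) profile by simp
  show "basis_data adj x (W w) (us (bas w 0)) (mat_of_rows_list n rws) S"
    by (rule basis_data_bas[OF w(1)]) (simp_all add: w(2) rws profile(3) us S)
qed

lemma module_data_A:
  assumes w: "w < 19" "tp w = t" and a: "a = map of_int (module_slices ! w ! 0)"
    and us: "us (bas w 0) = map (bas w) [0..<n]"
    and profile: "type_profiles ! t = (m, \<delta>, sh)" "lev t 0 = r" "dm t = n"
    and rws: "rws = map (map of_int) (type_mats ! t)" and S: "S = set (map type_val (type_evs ! t))"
    and A: "t \<noteq> 5" "1 < n" "lev t 1 = l"
  shows "\<exists>\<nu>. seed_vector adj x ord (W w) a \<nu> \<and> A *v \<nu> = E l *v (A *v \<nu>) \<and>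
    module_profile adj x Ws (W w) r m n \<delta> sh \<and>
    basis_data adj x (W w) (us \<nu>) (mat_of_rows_list n rws) S"
proof (intro exI[of _ "bas w 0"] conjI)
  show "seed_vector adj x ord (W w) a (bas w 0)" unfolding a by (rule seed_bas[OF w(1)])
  show "A *v bas w 0 = E l *v (A *v bas w 0)" by (rule A_seed(2)[OF w(1)]) (use w A profile(3) in simp_all)
  show "module_profile adj x Ws (W w) r m n \<delta> sh" using profile_bas[OF w(1), of m \<delta> sh] w(2) profile by simp
  show "basis_data adj x (W w) (us (bas w 0)) (mat_of_rows_list n rws) S"
    by (rule basis_data_bas[OF w(1)]) (simp_all add: w(2) rws profile(3) us S)
qed

lemmas word_simps = dm_simps type_words_def type_dens_def lev_def type_levels_def upt_simps

lemma words_II: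
  assumes w: "w < 19" "tp w = 1"
  shows "[bas w 0, A *v bas w 0, E 3 *v pw 2 (bas w 0), E 4 *v pw 3 (bas w 0), E 5 *v pw 4 (bas w 0),
      E 6 *v pw 5 (bas w 0), E 7 *v pw 6 (bas w 0)] = map (bas w) [0..<7]"
  using A_seed(1)[OF w(1)] word_single[OF w(1), of 2 2 3] word_single[OF w(1), of 3 3 4]
    word_single[OF w(1), of 4 4 5] word_single[OF w(1), of 5 5 6] word_single[OF w(1), of 6 6 7]
  by (simp add: w(2) word_simps)

lemma words_III:
  assumes w: "w < 19" "tp w = 2"
  shows "[bas w 0, A *v bas w 0, E 4 *v pw 2 (bas w 0), E 4 *v pw 4 (bas w 0) - 6 *s (E 4 *v pw 2 (bas w 0)),
      E 5 *v pw 3 (bas w 0), E 5 *v pw 5 (bas w 0) - 7 *s (E 5 *v pw 3 (bas w 0)), E 6 *v pw 6 (bas w 0)] = map (bas w) [0..<7]"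
  using A_seed(1)[OF w(1)] word_single[OF w(1), of 2 2 4] word_double[OF w(1), of 3 4 6 2 4]
    word_single[OF w(1), of 4 3 5] word_double[OF w(1), of 5 5 7 3 5] word_single[OF w(1), of 6 6 6]
  by (simp add: w(2) word_simps)

lemma words_IV:
  assumes w: "w < 19" "tp w = 3"
  shows "[bas w 0, A *v bas w 0, E 4 *v pw 3 (bas w 0), E 5 *v pw 2 (bas w 0)] = map (bas w) [0..<4]"
  using A_seed(1)[OF w(1)] word_single[OF w(1), of 2 3 4] word_single[OF w(1), of 3 2 5]
  by (simp add: w(2) word_simps)

lemma words_V:
  assumes w: "w < 19" "tp w = 4"
  shows "[bas w 0, A *v bas w 0, E 5 *v pw 2 (bas w 0), E 5 *v pw 4 (bas w 0), E 6 *v pw 3 (bas w 0)] = map (bas w) [0..<5]"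
  using A_seed(1)[OF w(1)] word_single[OF w(1), of 2 2 5] word_single[OF w(1), of 3 4 5]
    word_single[OF w(1), of 4 3 6]
  by (simp add: w(2) word_simps)

lemma words_VII:
  assumes w: "w < 19" "tp w = 6"
  shows "[bas w 0, A *v bas w 0] = map (bas w) [0..<2]"
  using A_seed(1)[OF w(1)]
  by (simp add: w(2) word_simps)

lemma words_VIII:
  assumes w: "w < 19" "tp w = 7"
  shows "[bas w 0, A *v bas w 0, E 6 *v pw 2 (bas w 0), E 7 *v pw 3 (bas w 0)] = map (bas w) [0..<4]"
  using A_seed(1)[OF w(1)] word_single[OF w(1), of 2 2 6] word_single[OF w(1), of 3 3 7]
  by (simp add: w(2) word_simps)

lemma words_IX:
  assumes w: "w < 19" "tp w = 8"
  shows "[bas w 0, A *v bas w 0, E 7 *v pw 2 (bas w 0), E 8 *v pw 3 (bas w 0)] = map (bas w) [0..<4]"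
  using A_seed(1)[OF w(1)] word_single[OF w(1), of 2 2 7] word_single[OF w(1), of 3 3 8]
  by (simp add: w(2) word_simps)

lemma concat_types: "concat [[W 0], [W 1, W 2], [W 3, W 4, W 5], [W 6, W 7, W 8], [W 9, W 10, W 11], [W 12],
    [W 13, W 14, W 15], [W 16, W 17], [W 18]] = Ws"
  by (simp add: upt_rec numeral_eq_Suc)

lemma types_isomorphic_iff:
  "\<forall>i<9. \<forall>j<9. \<forall>U\<in>set ([[W 0], [W 1, W 2], [W 3, W 4, W 5], [W 6, W 7, W 8], [W 9, W 10, W 11], [W 12],
    [W 13, W 14, W 15], [W 16, W 17], [W 18]] ! i). \<forall>V\<in>set ([[W 0], [W 1, W 2], [W 3, W 4, W 5], [W 6, W 7, W 8],
    [W 9, W 10, W 11], [W 12], [W 13, W 14, W 15], [W 16, W 17], [W 18]] ! j). T_isomorphic T U V \<longleftrightarrow> i = j"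
  (is "\<forall>i<9. \<forall>j<9. \<forall>U\<in>set (?t ! i). \<forall>V\<in>set (?t ! j). _ U V i j")
proof (intro allI impI ballI)
  define ws :: "nat list list" where
    "ws = [[0], [1, 2], [3, 4, 5], [6, 7, 8], [9, 10, 11], [12], [13, 14, 15], [16, 17], [18]]"
  have t: "?t = map (map W) ws" by (simp add: ws_def)
  have ok: "list_all (\<lambda>i. list_all (\<lambda>w. w < 19 \<and> module_types ! w = i) (ws ! i)) [0..<9]"
    unfolding ws_def by code_simp
  have l: "length ws = 9" by (simp add: ws_def)
  fix i j U V assume ij: "i < (9::nat)" "j < (9::nat)" and "U \<in> set (?t ! i)" "V \<in> set (?t ! j)"
  then have "U \<in> set (map W (ws ! i))" "V \<in> set (map W (ws ! j))" unfolding t by (simp_all add: l)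
  then obtain w w' where w: "w \<in> set (ws ! i)" "U = W w" "w' \<in> set (ws ! j)" "V = W w'"
    by (auto simp only: set_map image_iff)
  have "w < 19 \<and> tp w = i" "w' < 19 \<and> tp w' = j"
    using ok[unfolded list_all_upt, rule_format, OF ij(1)] ok[unfolded list_all_upt, rule_format, OF ij(2)] w(1,3)
    unfolding list_all_iff tp_def by simp_all
  then show "T_isomorphic T U V \<longleftrightarrow> i = j" using isomorphic_iff w(2,4) by simp
qed

lemma dim_T_257: "cmat.dim T = 9\<^sup>2 + 7\<^sup>2 + 7\<^sup>2 + 4\<^sup>2 + 5\<^sup>2 + 1\<^sup>2 + 2\<^sup>2 + 4\<^sup>2 + 4\<^sup>2" "cmat.dim T = 257"
proof -
  have "{..<9} = {0, 1, 2, 3, 4, 5, 6, 7, 8::nat}" by auto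
  then show "cmat.dim T = 9\<^sup>2 + 7\<^sup>2 + 7\<^sup>2 + 4\<^sup>2 + 5\<^sup>2 + 1\<^sup>2 + 2\<^sup>2 + 4\<^sup>2 + 4\<^sup>2"
    unfolding dim_T by (simp add: dm_simps)
  then show "cmat.dim T = 257" by simp
qed

end

theorem mainTheorem13:
  fixes adj :: "'v::finite \<Rightarrow> 'v \<Rightarrow> bool" and x :: 'v
  assumes "distance_regular adj" and "CARD('v) = 90"
    and "intersection_array adj = ([3, 2, 2, 2, 2, 1, 1, 1], [1, 1, 1, 1, 2, 2, 2, 3])"
  shows "let T = terwilliger_algebra adj x; A = adjacency_matrix adj; E = dual_idem adj x;
      pw = (\<lambda>k v. ((\<lambda>u. A *v u) ^^ k) v); s6 = complex_of_real (sqrt 6)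
    in
    has_spectrum A
      [(3, 1), (s6, 12), (2, 9), (1, 18), (0, 10), (- 1, 18), (- 2, 9), (- s6, 12), (- 3, 1)] \<and>
    (\<exists>ord W0 W1a W1b W2a W2b W2c W3a W3b W3c W3d W3e W3f W4a W4b W4c W4d W4e W4f W5.
      let types = [[W0], [W1a, W1b], [W2a, W2b, W2c], [W3a, W3b, W3c], [W3d, W3e, W3f],
                   [W4a], [W4b, W4c, W4d], [W4e, W4f], [W5]];
          Ws = concat types
      in
      level_ordering adj x ord \<and>
      orthogonal_decomposition T Ws \<and>
      (\<forall>i<9. \<forall>j<9. \<forall>U\<in>set (types ! i). \<forall>W\<in>set (types ! j). T_isomorphic T U W \<longleftrightarrow> i = j) \<and>
      module_profile adj x Ws W0 0 1 9 8 [1, 1, 1, 1, 1, 1, 1, 1, 1] \<and>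
      basis_data adj x W0 (map (e_star adj x) [0..<9])
        (mat_of_rows_list 9
          [[0, 3, 0, 0, 0, 0, 0, 0, 0],
           [1, 0, 2, 0, 0, 0, 0, 0, 0],
           [0, 1, 0, 2, 0, 0, 0, 0, 0],
           [0, 0, 1, 0, 2, 0, 0, 0, 0],
           [0, 0, 0, 1, 0, 2, 0, 0, 0],
           [0, 0, 0, 0, 2, 0, 1, 0, 0],
           [0, 0, 0, 0, 0, 2, 0, 1, 0],
           [0, 0, 0, 0, 0, 0, 2, 0, 1],
           [0, 0, 0, 0, 0, 0, 0, 3, 0]])
        {3, s6, 2, 1, 0, - 1, - 2, - s6, - 3} \<and>
      (\<forall>(W, a)\<in>{(W1a, [1, - 1, 0]),
                  (W1b, [1, 1, - 2])}. \<exists>\<nu>.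
        seed_vector adj x ord W a \<nu> \<and> A *v \<nu> = E 2 *v (A *v \<nu>) \<and>
        module_profile adj x Ws W 1 2 7 6 [1, 1, 1, 1, 1, 1, 1] \<and>
        basis_data adj x W
          [\<nu>,
           A *v \<nu>,
           E 3 *v pw 2 \<nu>,
           E 4 *v pw 3 \<nu>,
           E 5 *v pw 4 \<nu>,
           E 6 *v pw 5 \<nu>,
           E 7 *v pw 6 \<nu>]
          (mat_of_rows_list 7
            [[0, 2, 0, 0, 0, 0, 0],
             [1, 0, 2, 0, 0, 0, 0],
             [0, 1, 0, 2, 0, 0, 0],
             [0, 0, 1, 0, 1, 0, 0],
             [0, 0, 0, 1, 0, 2, 0],
             [0, 0, 0, 0, 1, 0, 2],
             [0, 0, 0, 0, 0, 1, 0]])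
          {s6, 2, 1, 0, - 1, - 2, - s6}) \<and>
      (\<forall>(W, a)\<in>{(W2a, alternating [1, 0, 0]),
                  (W2b, alternating [0, 1, 0]),
                  (W2c, alternating [0, 0, 1])}. \<exists>\<nu>.
        seed_vector adj x ord W a \<nu> \<and> A *v \<nu> = E 3 *v (A *v \<nu>) \<and>
        module_profile adj x Ws W 2 3 7 4 [1, 1, 2, 2, 1] \<and>
        basis_data adj x W
          [\<nu>,
           A *v \<nu>,
           E 4 *v pw 2 \<nu>,
           E 4 *v pw 4 \<nu> - 6 *s (E 4 *v pw 2 \<nu>),
           E 5 *v pw 3 \<nu>,
           E 5 *v pw 5 \<nu> - 7 *s (E 5 *v pw 3 \<nu>),
           E 6 *v pw 6 \<nu>]
          (mat_of_rows_list 7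
            [[0, 2, 0, 0, 0, 0, 0],
             [1, 0, 2, 0, 0, 0, 0],
             [0, 1, 0, 0, 2, 0, 0],
             [0, 0, 0, 0, 1, 2, 0],
             [0, 0, 1, 1, 0, 0, 0],
             [0, 0, 0, 1, 0, 0, 2],
             [0, 0, 0, 0, 0, 1, 0]])
          {s6, 2, 1, 0, - 1, - 2, - s6}) \<and>
      (\<forall>(W, a)\<in>{(W3a, alternating [0, 0, 1, - 1, 1, - 1]),
                  (W3b, alternating [2, 0, 1, 1, - 1, - 1]),
                  (W3c, alternating [0, 2, - 1, - 1, - 1, - 1])}. \<exists>\<nu>.
        seed_vector adj x ord W a \<nu> \<and> A *v \<nu> = E 4 *v (A *v \<nu>) \<and>
        module_profile adj x Ws W 3 3 4 2 [1, 2, 1] \<and>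
        basis_data adj x W
          [\<nu>,
           A *v \<nu>,
           E 4 *v pw 3 \<nu>,
           E 5 *v pw 2 \<nu>]
          (mat_of_rows_list 4
            [[0, 2, 6, 0],
             [1, 0, 0, - 2],
             [0, 0, 0, 1],
             [0, 1, 5, 0]])
          {2, 1, - 1, - 2}) \<and>
      (\<forall>(W, a)\<in>{(W3d, alternating [0, 0, 1, - 1, - 1, 1]),
                  (W3e, alternating [1, - 1, - 1, - 1, 0, 0]),
                  (W3f, alternating [1, 1, 0, 0, 1, 1])}. \<exists>\<nu>.
        seed_vector adj x ord W a \<nu> \<and> A *v \<nu> = E 4 *v (A *v \<nu>) \<and>
        module_profile adj x Ws W 3 3 5 3 [1, 1, 2, 1] \<and>
        basis_data adj x W
          [\<nu>,
           A *v \<nu>,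
           E 5 *v pw 2 \<nu>,
           E 5 *v pw 4 \<nu>,
           E 6 *v pw 3 \<nu>]
          (mat_of_rows_list 5
            [[0, 2, 0, 0, 0],
             [1, 0, 3, 19, 0],
             [0, 1, 0, 0, - 5],
             [0, 0, 0, 0, 1],
             [0, 0, 1, 7, 0]])
          {s6, 1, 0, - 1, - s6}) \<and>
      (\<forall>(W, a)\<in>{(W4a, alternating [1, - 1, - 1, 1, 1, - 1, - 1, - 1, 1, - 1, - 1, - 1])}. \<exists>\<nu>.
        seed_vector adj x ord W a \<nu> \<and>
        module_profile adj x Ws W 4 1 1 0 [1] \<and>
        basis_data adj x W
          [\<nu>]
          (mat_of_rows_list 1
            [[0]])
          {0}) \<and>
      (\<forall>(W, a)\<in>{(W4b, alternating [1, 1, 1, 1, - 1, - 1, 1, - 1, 0, 0, 0, 0]),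
                  (W4c, alternating [- 1, - 1, 1, 1, 1, 1, 1, - 1, - 2, - 2, 0, 0]),
                  (W4d, alternating [1, 1, - 1, - 1, 1, 1, 1, - 1, 0, 0, - 2, 2])}. \<exists>\<nu>.
        seed_vector adj x ord W a \<nu> \<and> A *v \<nu> = E 5 *v (A *v \<nu>) \<and>
        module_profile adj x Ws W 4 3 2 1 [1, 1] \<and>
        basis_data adj x W
          [\<nu>,
           A *v \<nu>]
          (mat_of_rows_list 2
            [[0, 1],
             [1, 0]])
          {1, - 1}) \<and>
      (\<forall>(W, a)\<in>{(W4e, alternating [1, - 1, - 1, 1, - 1, 1, 1, 1, 0, 0, 0, 0]),
                  (W4f, alternating [1, - 1, - 1, 1, 1, - 1, - 1, - 1, - 2, 2, 2, 2])}. \<exists>\<nu>.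
        seed_vector adj x ord W a \<nu> \<and> A *v \<nu> = E 5 *v (A *v \<nu>) \<and>
        module_profile adj x Ws W 4 2 4 3 [1, 1, 1, 1] \<and>
        basis_data adj x W
          [\<nu>,
           A *v \<nu>,
           E 6 *v pw 2 \<nu>,
           E 7 *v pw 3 \<nu>]
          (mat_of_rows_list 4
            [[0, 3, 0, 0],
             [1, 0, 2, 0],
             [0, 1, 0, 2],
             [0, 0, 1, 0]])
          {s6, 1, - 1, - s6}) \<and>
      (\<forall>(W, a)\<in>{(W5, alternating [1, 1, 1, - 1, - 1, - 1, - 1, 1, - 1, 1, 1, 1])}. \<exists>\<nu>.
        seed_vector adj x ord W a \<nu> \<and> A *v \<nu> = E 6 *v (A *v \<nu>) \<and>
        module_profile adj x Ws W 5 1 4 3 [1, 1, 1, 1] \<and>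
        basis_data adj x W
          [\<nu>,
           A *v \<nu>,
           E 7 *v pw 2 \<nu>,
           E 8 *v pw 3 \<nu>]
          (mat_of_rows_list 4
            [[0, 2, 0, 0],
             [1, 0, 2, 0],
             [0, 1, 0, 3],
             [0, 0, 1, 0]])
          {s6, 1, - 1, - s6})) \<and>
    cmat.dim T = 9^2 + 7^2 + 7^2 + 4^2 + 5^2 + 1^2 + 2^2 + 4^2 + 4^2 \<and>
    cmat.dim T = 257"
proof -
  obtain vs where vs: "length vs = 90" "distinct vs" "set vs = UNIV" "vs ! 0 = x"
    "\<And>n. n < 90 \<Longrightarrow> {z. adj (vs ! n) z} = (!) vs ` set (foster_nbs ! n)"
    by (rule foster_graph_labelling[OF foster_graphI(1)[OF assms(1,3)] assms(2)]) (rule that; assumption)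
  interpret foster_graph adj by (rule foster_graphI(1)[OF assms(1,3)])
  interpret L: labelled_foster adj x vs
    by unfold_locales (fact vs foster_graphI(2)[OF assms(1,3)])+
  note defs = L.tp_def module_types_def module_slices_def alternating_def
    L.dm_simps L.lev_def type_levels_def type_profiles_def type_mats_def type_evs_def type_val_def
  show ?thesis
    unfolding Let_def
    apply (intro conjI)
    subgoal using L.has_spectrum_table by (simp add: spectrum_table_def type_val_def)
    subgoal
      apply (rule exI[of _ L.ord])
      apply (rule exI[of _ "L.W 0"], rule exI[of _ "L.W 1"], rule exI[of _ "L.W 2"], rule exI[of _ "L.W 3"],
          rule exI[of _ "L.W 4"], rule exI[of _ "L.W 5"], rule exI[of _ "L.W 6"], rule exI[of _ "L.W 7"],
          rule exI[of _ "L.W 8"], rule exI[of _ "L.W 9"], rule exI[of _ "L.W 10"], rule exI[of _ "L.W 11"],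
          rule exI[of _ "L.W 12"], rule exI[of _ "L.W 13"], rule exI[of _ "L.W 14"], rule exI[of _ "L.W 15"],
          rule exI[of _ "L.W 16"], rule exI[of _ "L.W 17"], rule exI[of _ "L.W 18"])
      unfolding L.concat_types
      apply (intro conjI)
      subgoal by (rule L.level_ordering_ord)
      subgoal by (rule L.orthogonal_decomposition_W)
      subgoal by (rule L.types_isomorphic_iff)
      subgoal by (rule L.type_O(1))
      subgoal by (rule L.type_O(2))
      subgoal by (simp only: ball_simps prod.case; intro conjI TrueI; rule L.module_data_A[where t = 1]; (rule L.words_II)?; simp add: defs)
      subgoal by (simp only: ball_simps prod.case; intro conjI TrueI; rule L.module_data_A[where t = 2]; (rule L.words_III)?; simp add: defs)
      subgoal by (simp only: ball_simps prod.case; intro conjI TrueI; rule L.module_data_A[where t = 3]; (rule L.words_IV)?; simp add: defs)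
      subgoal by (simp only: ball_simps prod.case; intro conjI TrueI; rule L.module_data_A[where t = 4]; (rule L.words_V)?; simp add: defs)
      subgoal by (simp only: ball_simps prod.case; intro conjI TrueI; rule L.module_data[where t = 5]; simp add: defs)
      subgoal by (simp only: ball_simps prod.case; intro conjI TrueI; rule L.module_data_A[where t = 6]; (rule L.words_VII)?; simp add: defs)
      subgoal by (simp only: ball_simps prod.case; intro conjI TrueI; rule L.module_data_A[where t = 7]; (rule L.words_VIII)?; simp add: defs)
      subgoal by (simp only: ball_simps prod.case; intro conjI TrueI; rule L.module_data_A[where t = 8]; (rule L.words_IX)?; simp add: defs)
      done
    subgoal by (rule L.dim_T_257(1))
    subgoal by (rule L.dim_T_257(2))
    done
qed
end
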